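(* Let $\Phi$ be the root system of type $\mathrm D_4$ with simple roots $\alpha_1,\alpha_2,\alpha_3,\alpha_4$, where $\alpha_2$ is the trivalent simple root, and let $J=\{1,3,4\}$. Let $i\in J$, let $\{i,j,k\}=J$, and put $$\beta_i=\alpha_i+2\alpha_2+2\alpha_j+2\alpha_k .$$ For every dominant weight $\mu$ with $\mu_2=1$ such that $\lambda=\mu+\beta_i$ is dominant, $$a(\mu,\lambda)=\begin{cases}-2,&\mu_i=0,\\ -1,&\mu_i>0.\end{cases}$$
   Context: For a weight $\nu$, $\nu_i=\langle\nu,\alpha_i^\vee\rangle$ denotes its $i$-th Dynkin label ($\alpha_i^\vee$ the simple coroots). Atomic numbers: let $\mathfrak g$ be a complex semisimple Lie algebra with weight lattice $\Lambda$, dominant weights $\Lambda^+$, Weyl group $W$. The root order on $\Lambda$ is $\mu\le\lambda\iff\lambda-\mu$ is a nonnegative integral combination of simple roots. For $\lambda\in\Lambda^+$, $V(\lambda)$ is the irreducible module of highest weight $\lambda$ and $\Theta_\lambda=\sum_\nu e^\nu$, the sum over the set of (distinct) weights $\nu$ of $V(\lambda)$, each taken once. The $\Theta_\mu$ ($\mu\in\Lambda^+$) form a $\mathbb Z$-basis of $\mathbb Z[\Lambda]^W$, and the atomic numbers $a(\mu,\lambda)$ are the unique integers with $\operatorname{ch}V(\lambda)=\sum_{\mu\in\Lambda^+}a(\mu,\lambda)\Theta_\mu$ ($a(\mu,\lambda)=0$ unless $\mu\le\lambda$). Here $\mathfrak g$ is of type $\mathrm D_4$. *)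

theory Defs
  imports Complex_Main
begin

section \<open>Complex Lie algebras\<close>

locale lie_algebra = vector_space scale
  for scale :: "complex \<Rightarrow> 'g::ab_group_add \<Rightarrow> 'g" +
  fixes bracket :: "'g \<Rightarrow> 'g \<Rightarrow> 'g"
  assumes bracket_add_left: "bracket (x + y) z = bracket x z + bracket y z"
    and bracket_add_right: "bracket x (y + z) = bracket x y + bracket x z"
    and bracket_scale_left: "bracket (scale c x) y = scale c (bracket x y)"
    and bracket_scale_right: "bracket x (scale c y) = scale c (bracket x y)"
    and bracket_self: "bracket x x = 0"
    and jacobi: "bracket x (bracket y z) + bracket y (bracket z x) + bracket z (bracket x y) = 0"
begin

definition lie_ideal :: "'g set \<Rightarrow> bool" where
  "lie_ideal A \<longleftrightarrow> subspace A \<and> (\<forall>x. \<forall>y\<in>A. bracket x y \<in> A)"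

definition semisimple :: bool where
  "semisimple \<longleftrightarrow>
     (\<exists>B. finite B \<and> span B = UNIV) \<and>
     (\<forall>A. lie_ideal A \<and> (\<forall>x\<in>A. \<forall>y\<in>A. bracket x y = 0) \<longrightarrow> A = {0})"

text \<open>Cartan subalgebras of a semisimple Lie algebra: abelian, self-centralizing, and acting
  by diagonalizable operators in the adjoint representation.\<close>

definition cartan_subalgebra :: "'g set \<Rightarrow> bool" where
  "cartan_subalgebra H \<longleftrightarrow>
     subspace H \<and>
     (\<forall>h\<in>H. \<forall>k\<in>H. bracket h k = 0) \<and>
     (\<forall>x. (\<forall>h\<in>H. bracket h x = 0) \<longrightarrow> x \<in> H) \<and>
     (\<forall>h\<in>H. span {x. \<exists>c. bracket h x = scale c x} = UNIV)"

text \<open>Linear functionals on the subspace \<open>H\<close> are functions on the whole type that vanish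
  outside \<open>H\<close>, so that two functionals agreeing on \<open>H\<close> are equal.\<close>

definition dual_space :: "'g set \<Rightarrow> ('g \<Rightarrow> complex) set" where
  "dual_space H = {a.
     (\<forall>x\<in>H. \<forall>y\<in>H. a (x + y) = a x + a y) \<and>
     (\<forall>c. \<forall>x\<in>H. a (scale c x) = c * a x) \<and>
     (\<forall>x. x \<notin> H \<longrightarrow> a x = 0)}"

definition root_space :: "'g set \<Rightarrow> ('g \<Rightarrow> complex) \<Rightarrow> 'g set" where
  "root_space H a = {x. \<forall>h\<in>H. bracket h x = scale (a h) x}"

definition roots :: "'g set \<Rightarrow> ('g \<Rightarrow> complex) set" where
  "roots H = {a \<in> dual_space H. a \<noteq> (\<lambda>_. 0) \<and> root_space H a \<noteq> {0}}"

text \<open>In a semisimple Lie algebra every root \<open>a\<close> has exactly one coroot in this sense.\<close>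

definition is_coroot :: "'g set \<Rightarrow> ('g \<Rightarrow> complex) \<Rightarrow> 'g \<Rightarrow> bool" where
  "is_coroot H a h \<longleftrightarrow>
     h \<in> span {bracket x y |x y. x \<in> root_space H a \<and> y \<in> root_space H (\<lambda>z. - a z)} \<and> a h = 2"

end


section \<open>Semisimple Lie algebras with a Cartan subalgebra and simple roots\<close>

locale based_semisimple_lie_algebra = lie_algebra scale bracket
  for scale :: "complex \<Rightarrow> 'g::ab_group_add \<Rightarrow> 'g" and bracket :: "'g \<Rightarrow> 'g \<Rightarrow> 'g" +
  fixes H :: "'g set"
    and I :: "'i set"
    and simple_root :: "'i \<Rightarrow> 'g \<Rightarrow> complex"
    and simple_coroot :: "'i \<Rightarrow> 'g"
  assumes semisimple: semisimple
    and cartan: "cartan_subalgebra H"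
    and finite_index: "finite I"
    and simple_root_root: "i \<in> I \<Longrightarrow> simple_root i \<in> roots H"
    and simple_root_independent:
      "(\<And>h. h \<in> H \<Longrightarrow> (\<Sum>i\<in>I. c i * simple_root i h) = 0) \<Longrightarrow> i \<in> I \<Longrightarrow> c i = 0"
    and root_expansion:
      "a \<in> roots H \<Longrightarrow> \<exists>n :: 'i \<Rightarrow> nat.
         (\<forall>h\<in>H. a h = (\<Sum>i\<in>I. of_nat (n i) * simple_root i h)) \<or>
         (\<forall>h\<in>H. a h = - (\<Sum>i\<in>I. of_nat (n i) * simple_root i h))"
    and simple_coroot: "i \<in> I \<Longrightarrow> is_coroot H (simple_root i) (simple_coroot i)"
begin

definition dynkin_label :: "('g \<Rightarrow> complex) \<Rightarrow> 'i \<Rightarrow> complex" where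
  "dynkin_label \<nu> i = \<nu> (simple_coroot i)"

definition weight_lattice :: "('g \<Rightarrow> complex) set" where
  "weight_lattice = {\<nu> \<in> dual_space H. \<forall>i\<in>I. dynkin_label \<nu> i \<in> \<int>}"

definition dominant_weights :: "('g \<Rightarrow> complex) set" where
  "dominant_weights = {\<nu> \<in> weight_lattice. \<forall>i\<in>I. dynkin_label \<nu> i \<in> \<nat>}"

definition root_le :: "('g \<Rightarrow> complex) \<Rightarrow> ('g \<Rightarrow> complex) \<Rightarrow> bool" where
  "root_le \<mu> \<nu> \<longleftrightarrow>
     (\<exists>n :: 'i \<Rightarrow> nat. \<forall>h\<in>H. \<nu> h - \<mu> h = (\<Sum>i\<in>I. of_nat (n i) * simple_root i h))"

definition positive_roots :: "('g \<Rightarrow> complex) set" where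
  "positive_roots = {a \<in> roots H. root_le (\<lambda>_. 0) a}"

end


section \<open>Modules\<close>

text \<open>The underlying vector space of a module is a subspace \<open>M\<close> of the type \<open>'v\<close>, so that
  modules of different dimensions can live on the same type.\<close>

locale lie_module = lie_algebra scale bracket + V: vector_space scaleV
  for scale :: "complex \<Rightarrow> 'g::ab_group_add \<Rightarrow> 'g" and bracket :: "'g \<Rightarrow> 'g \<Rightarrow> 'g"
    and scaleV :: "complex \<Rightarrow> 'v::ab_group_add \<Rightarrow> 'v" +
  fixes M :: "'v set"
    and act :: "'g \<Rightarrow> 'v \<Rightarrow> 'v"
  assumes subspace_carrier: "V.subspace M"
    and act_closed: "v \<in> M \<Longrightarrow> act x v \<in> M"
    and act_add: "v \<in> M \<Longrightarrow> w \<in> M \<Longrightarrow> act x (v + w) = act x v + act x w"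
    and act_scale: "v \<in> M \<Longrightarrow> act x (scaleV c v) = scaleV c (act x v)"
    and add_act: "v \<in> M \<Longrightarrow> act (x + y) v = act x v + act y v"
    and scale_act: "v \<in> M \<Longrightarrow> act (scale c x) v = scaleV c (act x v)"
    and bracket_act: "v \<in> M \<Longrightarrow> act (bracket x y) v = act x (act y v) - act y (act x v)"
begin

definition submodule :: "'v set \<Rightarrow> bool" where
  "submodule N \<longleftrightarrow> V.subspace N \<and> N \<subseteq> M \<and> (\<forall>x. \<forall>v\<in>N. act x v \<in> N)"

definition irreducible_module :: bool where
  "irreducible_module \<longleftrightarrow> M \<noteq> {0} \<and> (\<forall>N. submodule N \<longrightarrow> N = {0} \<or> N = M)"

definition weight_space :: "'g set \<Rightarrow> ('g \<Rightarrow> complex) \<Rightarrow> 'v set" where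
  "weight_space H \<nu> = {v \<in> M. \<forall>h\<in>H. act h v = scaleV (\<nu> h) v}"

definition weights :: "'g set \<Rightarrow> ('g \<Rightarrow> complex) set" where
  "weights H = {\<nu> \<in> dual_space H. weight_space H \<nu> \<noteq> {0}}"

end


section \<open>Irreducible characters and atomic numbers\<close>

text \<open>A choice, for every dominant weight \<open>lam\<close>, of an irreducible module of highest weight \<open>lam\<close>,
  with underlying space \<open>V lam\<close> and action \<open>act lam\<close>. Such a module exists and is unique up to
  isomorphism by the theorem of the highest weight.\<close>

locale irreducible_highest_weight_modules =
  based_semisimple_lie_algebra scale bracket H I simple_root simple_coroot + V: vector_space scaleV
  for scale :: "complex \<Rightarrow> 'g::ab_group_add \<Rightarrow> 'g" and bracket :: "'g \<Rightarrow> 'g \<Rightarrow> 'g"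
    and H :: "'g set" and I :: "'i set"
    and simple_root :: "'i \<Rightarrow> 'g \<Rightarrow> complex" and simple_coroot :: "'i \<Rightarrow> 'g"
    and scaleV :: "complex \<Rightarrow> 'v::ab_group_add \<Rightarrow> 'v" +
  fixes V :: "('g \<Rightarrow> complex) \<Rightarrow> 'v set"
    and act :: "('g \<Rightarrow> complex) \<Rightarrow> 'g \<Rightarrow> 'v \<Rightarrow> 'v"
  assumes module: "lam \<in> dominant_weights \<Longrightarrow> lie_module scale bracket scaleV (V lam) (act lam)"
    and irreducible:
      "lam \<in> dominant_weights \<Longrightarrow> lie_module.irreducible_module scaleV (V lam) (act lam)"
    and highest_weight_vector:
      "lam \<in> dominant_weights \<Longrightarrow>
         \<exists>v \<in> lie_module.weight_space scaleV (V lam) (act lam) H lam.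
           v \<noteq> 0 \<and> (\<forall>a\<in>positive_roots. \<forall>x\<in>root_space H a. act lam x v = 0)"
begin

text \<open>An element \<open>\<Sum>\<nu>. c \<nu> e\<^sup>\<nu>\<close> of the group ring is represented by its coefficient function \<open>c\<close>.\<close>

definition ch :: "('g \<Rightarrow> complex) \<Rightarrow> ('g \<Rightarrow> complex) \<Rightarrow> int" where
  "ch lam \<nu> = int (V.dim (lie_module.weight_space scaleV (V lam) (act lam) H \<nu>))"

definition Theta :: "('g \<Rightarrow> complex) \<Rightarrow> ('g \<Rightarrow> complex) \<Rightarrow> int" where
  "Theta lam \<nu> = (if \<nu> \<in> lie_module.weights scale scaleV (V lam) (act lam) H then 1 else 0)"

definition atomic_number :: "('g \<Rightarrow> complex) \<Rightarrow> ('g \<Rightarrow> complex) \<Rightarrow> int" where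
  "atomic_number \<mu> lam =
     (THE a. finite {\<kappa>. a \<kappa> \<noteq> 0} \<and> {\<kappa>. a \<kappa> \<noteq> 0} \<subseteq> dominant_weights \<and>
        (\<forall>\<nu>\<in>dual_space H. ch lam \<nu> = (\<Sum>\<kappa> | a \<kappa> \<noteq> 0. a \<kappa> * Theta \<kappa> \<nu>))) \<mu>"

end


section \<open>Type D4\<close>

text \<open>Cartan matrix of type D4 with trivalent node 2, for indices in \<open>{1, 2, 3, 4}\<close>.\<close>

definition D4_cartan :: "nat \<Rightarrow> nat \<Rightarrow> complex" where
  "D4_cartan i j = (if i = j then 2 else if i = 2 \<or> j = 2 then -1 else 0)"

end

theory Submission
  imports Defs
begin

text \<open>Moebius inversion in the root order expresses \<open>a(\<mu>, \<lambda>)\<close> as an alternating sum of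
  multiplicities of weights of \<open>V(\<lambda>)\<close> just above \<open>\<mu>\<close>. By the invariance of multiplicities under
  simple reflections and inclusion-exclusion over the three leaves of the diagram, this sum equals
  \<open>s + 1 - 3\<close>: here \<open>s\<close> is the dimension of the space \<open>K\<close> of vectors of weight \<open>\<mu>\<close> killed by the
  raising operators of the leaves, and 1 and 3 are the multiplicities of
  \<open>\<mu> + \<alpha>\<^sub>1 + \<alpha>\<^sub>3 + \<alpha>\<^sub>4\<close> and \<open>\<mu> + \<alpha>\<^sub>1 + \<alpha>\<^sub>2 + \<alpha>\<^sub>3 + \<alpha>\<^sub>4\<close>.

  A vector of \<open>V(\<lambda>)\<close> of weight other than \<open>\<lambda>\<close> vanishes if all simple raising operators kill it, so
  a vector of \<open>K\<close> is determined by its images of weight \<open>\<lambda>\<close> under words in these operators. By the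
  Serre relations all these images are multiples of a single one, hence \<open>s \<le> 1\<close>; one of the words
  passes through the weight \<open>\<lambda> - \<alpha>\<^sub>i\<close>, which does not occur if \<open>\<mu>\<^sub>i = 0\<close>, so then \<open>s = 0\<close>. If
  \<open>\<mu>\<^sub>i > 0\<close>, a nonzero vector of \<open>K\<close> is obtained from the highest weight vector by lowering
  operators corrected so as to preserve the kernels of the raising operators.\<close>

section \<open>Linear algebra on subspaces\<close>

text \<open>The Moebius function depends on the leaf labels of \<mu>: adding the simple root of the
  hub (the trivalent node) keeps \<mu> dominant only if all three are positive. In that case a
  second inclusion-exclusion, one hub root higher, has to be subtracted. Its joint kernel vanishes
  and hub reflections cancel the remaining terms, so both cases end in the same number.

  Each inclusion-exclusion rests on one fact about sl2: a raising operator maps onto every weight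
  space of positive label, so a difference of neighbouring multiplicities is the dimension of a
  kernel. This can be iterated over the leaves because they are pairwise orthogonal and the sl2 of
  one leaf preserves the kernels of the others.

  The Weyl group is never introduced. A function that is symmetric under simple reflections and
  supported below \<lambda> is determined by its dominant values, and that is all that comparing
  characters requires. Finite type enters the general theory through the inequality
  \<open>positivity\<close>: some simple root of the support can always be split off at a positive
  label. This yields both the generation of the Lie algebra and the occurrence of every dominant
  weight below \<lambda>.\<close>

context vector_space
begin

lemma independent_subset_card_le_dim:
  assumes "finite B" "S \<subseteq> span B" "independent T" "T \<subseteq> S"
  shows "finite T \<and> card T \<le> dim S"
proof -
  have T: "finite T"
    using independent_span_bound[of B T] assms by blast
  obtain C where C: "C \<subseteq> S" "independent C" "S \<subseteq> span C" "card C = dim S"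
    using basis_exists by blast
  have "finite C"
    using independent_span_bound[of B C] assms C by blast
  then show ?thesis
    using independent_span_bound[of C T] assms C by auto
qed

lemma dim_eq_0_subspace:
  assumes "finite B" "S \<subseteq> span B" "subspace S"
  shows "dim S = 0 \<longleftrightarrow> S = {0}"
proof
  assume 0: "dim S = 0"
  obtain C where C: "C \<subseteq> S" "independent C" "S \<subseteq> span C" "card C = dim S"
    using basis_exists by blast
  have "finite C"
    using independent_span_bound[of B C] assms C by blast
  then show "S = {0}"
    using C 0 subspace_0[OF assms(3)] by auto
next
  assume "S = {0}"
  then show "dim S = 0"
    using dim_eq_card_independent[OF independent_empty] dim_span[of "{}"] by simp
qed

text \<open>Additivity and homogeneity are asked for on \<open>S\<close> only, because a Lie algebra
  action is linear only on the carrier of the module. A relation among the images comes from a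
  vector of \<open>span B\<close> killed by \<open>f\<close>, which \<open>ker\<close> puts into
  \<open>span K\<close>; independence of \<open>B \<union> K\<close> then makes its coefficients
  vanish.\<close>

lemma independent_image_on:
  assumes S: "subspace S"
    and add: "\<And>x y. x \<in> S \<Longrightarrow> y \<in> S \<Longrightarrow> f (x + y) = f x + f y"
    and scl: "\<And>c x. x \<in> S \<Longrightarrow> f (scale c x) = scale c (f x)"
    and "B \<subseteq> S" "independent (B \<union> K)" "B \<inter> K = {}"
    and ker: "\<And>x. x \<in> S \<Longrightarrow> f x = 0 \<Longrightarrow> x \<in> span K"
  shows "inj_on f B" "independent (f ` B)"
proof -
  have f0: "f 0 = 0"
    using scl[OF subspace_0[OF S], of 0] by simp
  have fsum: "f (\<Sum>x\<in>A. scale (u x) x) = (\<Sum>x\<in>A. scale (u x) (f x))" if "finite A" "A \<subseteq> B" for A u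
    using that
  proof (induction A rule: finite_induct)
    case empty
    then show ?case using f0 by simp
  next
    case (insert x A)
    have "(\<Sum>x\<in>A. scale (u x) x) \<in> S"
      using insert assms(4) by (intro subspace_sum[OF S] subspace_scale[OF S]) auto
    moreover have "scale (u x) x \<in> S"
      using insert assms(4) by (intro subspace_scale[OF S]) auto
    ultimately show ?case
      using insert assms(4) add scl by (simp add: subset_iff)
  qed
  have zero: "u x = 0" if A: "finite A" "A \<subseteq> B" and s: "(\<Sum>x\<in>A. scale (u x) (f x)) = 0" and x: "x \<in> A" for A u x
  proof -
    have "(\<Sum>x\<in>A. scale (u x) x) \<in> S"
      using A assms(4) by (intro subspace_sum[OF S] subspace_scale[OF S]) auto
    then have "(\<Sum>x\<in>A. scale (u x) x) \<in> span K"
      using ker fsum[OF A] s by simp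
    then obtain t r where t: "finite t" "t \<subseteq> K" "(\<Sum>x\<in>A. scale (u x) x) = (\<Sum>a\<in>t. scale (r a) a)"
      unfolding span_explicit by auto
    let ?w = "\<lambda>y. if y \<in> A then u y else - r y"
    have "(\<Sum>y\<in>A \<union> t. scale (?w y) y) = (\<Sum>y\<in>A. scale (?w y) y) + (\<Sum>y\<in>t. scale (?w y) y)"
      using A t assms(6) by (intro sum.union_disjoint) auto
    also have "(\<Sum>y\<in>t. scale (?w y) y) = (\<Sum>y\<in>t. - scale (r y) y)"
      using A t assms(6) by (intro sum.cong) auto
    finally have "(\<Sum>y\<in>A \<union> t. scale (?w y) y) = 0"
      using t by (simp add: sum_negf)
    then have "?w x = 0"
      using independentD[OF assms(5), of "A \<union> t" ?w x] A t x by blast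
    then show ?thesis using x by simp
  qed
  show inj: "inj_on f B"
  proof (rule inj_onI, rule ccontr)
    fix x y assume xy: "x \<in> B" "y \<in> B" "f x = f y" "x \<noteq> y"
    have "(\<Sum>z\<in>{x, y}. scale (if z = x then 1 else -1) (f z)) = 0"
      using xy by simp
    from zero[OF _ _ this, of x] show False using xy by simp
  qed
  show "independent (f ` B)"
    unfolding dependent_explicit
  proof clarify
    fix A u and v
    assume A: "finite A" "A \<subseteq> f ` B" "v \<in> A" "u v \<noteq> 0" and s: "(\<Sum>v\<in>A. scale (u v) v) = 0"
    obtain C where C: "C \<subseteq> B" "A = f ` C"
      using A(2) by (meson subset_imageE)
    have injC: "inj_on f C" using inj C inj_on_subset by blast
    then have finC: "finite C" using A C finite_image_iff by blast
    have "(\<Sum>x\<in>C. scale (u (f x)) (f x)) = 0"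
      using s unfolding C(2) sum.reindex[OF injC] by simp
    moreover obtain x where "x \<in> C" "v = f x" using A C by blast
    ultimately show False using zero[OF finC C(1), of "\<lambda>x. u (f x)" x] A by simp
  qed
qed

text \<open>Rank-nullity: a basis \<open>C\<close> of the kernel is extended to a basis
  \<open>D\<close> of \<open>S\<close>, and \<open>f\<close> sends the added vectors injectively to
  a basis of the image.\<close>

lemma dim_kernel_on:
  assumes S: "subspace S" and fin: "finite B" "S \<subseteq> span B"
    and add: "\<And>x y. x \<in> S \<Longrightarrow> y \<in> S \<Longrightarrow> f (x + y) = f x + f y"
    and scl: "\<And>c x. x \<in> S \<Longrightarrow> f (scale c x) = scale c (f x)"
  shows "dim S = dim (f ` S) + dim {x \<in> S. f x = 0}"
proof -
  let ?K = "{x \<in> S. f x = 0}"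
  obtain C where C: "C \<subseteq> ?K" "independent C" "?K \<subseteq> span C" "card C = dim ?K"
    using basis_exists by blast
  obtain D where D: "C \<subseteq> D" "D \<subseteq> S" "independent D" "S \<subseteq> span D"
    using maximal_independent_subset_extend[of C S] C by blast
  have finD: "finite D"
    using independent_span_bound[of B D] fin D by blast
  have "independent ((D - C) \<union> C)" using D by (simp add: Un_absorb2)
  then have inj: "inj_on f (D - C)" and ind: "independent (f ` (D - C))"
    using independent_image_on[of S f "D - C" C] S add scl D C by blast+
  have f0: "f 0 = 0"
    using scl[OF subspace_0[OF S], of 0] by simp
  have "x \<in> S \<and> f x \<in> span (f ` (D - C))" if "x \<in> span D" for x
    using that
  proof (induction rule: span_induct_alt)
    case base
    then show ?case by (simp add: f0 span_zero subspace_0[OF S])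
  next
    case (step c x y)
    have y: "x \<in> S" "y \<in> S"
      using step D(2) by auto
    have "f x \<in> span (f ` (D - C))"
    proof (cases "x \<in> C")
      case True
      then have "f x = 0" using C(1) by blast
      then show ?thesis by (simp add: span_zero)
    next
      case False
      then show ?thesis using step(1) by (intro span_base imageI) simp
    qed
    moreover have "f (scale c x + y) = scale c (f x) + f y"
      using y add[OF subspace_scale[OF S]] scl by simp
    ultimately show ?case
      using step y span_add span_scale subspace_add[OF S] subspace_scale[OF S] by simp
  qed
  then have sp: "f ` S \<subseteq> span (f ` (D - C))" using D by blast
  have "card (f ` (D - C)) = dim (f ` S)"
    by (rule basis_card_eq_dim[OF _ sp ind]) (use D in blast)
  moreover have "card D = dim S" by (rule basis_card_eq_dim[OF D(2,4,3)])
  moreover have "card D = card (D - C) + card C"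
    using card_Diff_subset[of C D] card_mono[of D C] finite_subset[of C D] D(1) finD by simp
  ultimately show ?thesis using C card_image[OF inj] by simp
qed

lemma dim_le_of_inj_on:
  assumes S: "subspace S" and T: "finite B" "T \<subseteq> span B"
    and add: "\<And>x y. x \<in> S \<Longrightarrow> y \<in> S \<Longrightarrow> f (x + y) = f x + f y"
    and scl: "\<And>c x. x \<in> S \<Longrightarrow> f (scale c x) = scale c (f x)"
    and maps: "f ` S \<subseteq> T" and ker: "\<And>x. x \<in> S \<Longrightarrow> f x = 0 \<Longrightarrow> x = 0"
  shows "dim S \<le> dim T"
proof -
  obtain C where C: "C \<subseteq> S" "independent C" "S \<subseteq> span C" "card C = dim S"
    using basis_exists by blast
  have ker': "\<And>x. x \<in> S \<Longrightarrow> f x = 0 \<Longrightarrow> x \<in> span {}" using ker by simp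
  have inj: "inj_on f C" and ind: "independent (f ` C)"
    using independent_image_on[of S f C "{}"] S add scl C ker' by auto
  have "card (f ` C) \<le> dim T"
    using independent_subset_card_le_dim[OF T ind] C maps by blast
  then show ?thesis using C card_image[OF inj] by simp
qed

text \<open>Terms from the same member of the family are merged, so that each index occurs once and
  the independence of vectors of distinct weights can be applied to the sum.\<close>

lemma span_Union_subspacesE:
  assumes x: "x \<in> span (\<Union>a\<in>Z. W a)" and W: "\<And>a. a \<in> Z \<Longrightarrow> subspace (W a)"
  obtains A y where "finite A" "A \<subseteq> Z" "\<And>a. a \<in> A \<Longrightarrow> y a \<in> W a" "x = (\<Sum>a\<in>A. y a)"
proof -
  have "\<exists>A y. finite A \<and> A \<subseteq> Z \<and> (\<forall>a\<in>A. y a \<in> W a) \<and> x = (\<Sum>a\<in>A. y a)"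
    using x
  proof (induction rule: span_induct_alt)
    case base
    then show ?case by (intro exI[of _ "{}"]) auto
  next
    case (step c x z)
    then obtain A y a where A: "finite A" "A \<subseteq> Z" "\<forall>a\<in>A. y a \<in> W a" "z = (\<Sum>a\<in>A. y a)"
      and a: "a \<in> Z" "x \<in> W a"
      by blast
    have cx: "scale c x \<in> W a" using a W subspace_scale by blast
    show ?case
    proof (cases "a \<in> A")
      case True
      let ?y = "y(a := scale c x + y a)"
      have "(\<Sum>b\<in>A. ?y b) = ?y a + (\<Sum>b\<in>A - {a}. ?y b)"
        using True A by (simp add: sum.remove)
      also have "(\<Sum>b\<in>A - {a}. ?y b) = (\<Sum>b\<in>A - {a}. y b)" by (intro sum.cong) auto
      finally have "(\<Sum>b\<in>A. ?y b) = scale c x + z"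
        using A True sum.remove[of A a y] by (simp add: algebra_simps)
      moreover have "\<forall>b\<in>A. ?y b \<in> W b"
        using A cx a W subspace_add by auto
      ultimately show ?thesis using A by (intro exI[of _ A] exI[of _ ?y]) auto
    next
      case False
      let ?y = "y(a := scale c x)"
      have "(\<Sum>b\<in>A. ?y b) = (\<Sum>b\<in>A. y b)" using False by (intro sum.cong) auto
      then have "(\<Sum>b\<in>insert a A. ?y b) = scale c x + z"
        using A False by simp
      then show ?thesis using A False cx a
        by (intro exI[of _ "insert a A"] exI[of _ ?y]) auto
    qed
  qed
  then show ?thesis using that by blast
qed

end


section \<open>Strings of weight spaces for a pair of raising and lowering operators\<close>

text \<open>\<open>U n\<close> plays the role of the weight space of weight \<open>m + 2 n\<close> for the
  three-dimensional simple Lie algebra spanned by \<open>E\<close>, \<open>F\<close> and their commutator.\<close>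

locale sl2_string = vector_space scale
  for scale :: "complex \<Rightarrow> 'v::ab_group_add \<Rightarrow> 'v" +
  fixes U :: "int \<Rightarrow> 'v set" and E F :: "'v \<Rightarrow> 'v" and m :: int
  assumes subspace_U: "subspace (U n)"
    and E_in: "x \<in> U n \<Longrightarrow> E x \<in> U (n + 1)"
    and F_in: "x \<in> U n \<Longrightarrow> F x \<in> U (n - 1)"
    and E_add: "x \<in> U n \<Longrightarrow> y \<in> U n \<Longrightarrow> E (x + y) = E x + E y"
    and F_add: "x \<in> U n \<Longrightarrow> y \<in> U n \<Longrightarrow> F (x + y) = F x + F y"
    and E_scale: "x \<in> U n \<Longrightarrow> E (scale c x) = scale c (E x)"
    and F_scale: "x \<in> U n \<Longrightarrow> F (scale c x) = scale c (F x)"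
    and commutator: "x \<in> U n \<Longrightarrow> E (F x) - F (E x) = scale (of_int (m + 2 * n)) x"
    and E_nilpotent: "x \<in> U n \<Longrightarrow> \<exists>r. (E ^^ r) x = 0"
    and F_nilpotent: "x \<in> U n \<Longrightarrow> \<exists>r. (F ^^ r) x = 0"
begin

text \<open>Exchanging raising and lowering turns every fact about \<open>E\<close> into one about
  \<open>F\<close>; weights change sign, hence \<open>U (- n)\<close> and
  \<open>- m\<close>.\<close>

lemma flip: "sl2_string scale (\<lambda>n. U (- n)) F E (- m)"
proof
  fix n x assume x: "x \<in> U (- n)"
  have "F (E x) - E (F x) = scale (- of_int (m + 2 * (- n))) x"
    using commutator[OF x] by (metis minus_diff_eq scale_minus_left)
  also have "- of_int (m + 2 * (- n)) = (of_int (- m + 2 * n) :: complex)" by simp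
  finally show "F (E x) - E (F x) = scale (of_int (- m + 2 * n)) x" .
  show "F x \<in> U (- (n + 1))" "E x \<in> U (- (n - 1))"
    using F_in[OF x] E_in[OF x] by (simp_all add: minus_add_distrib)
qed (use subspace_U E_nilpotent F_nilpotent E_add F_add E_scale F_scale in \<open>blast+\<close>)

lemma E_zero [simp]: "E 0 = 0"
  using E_scale[OF subspace_0[OF subspace_U], of 0] by simp

lemma F_zero [simp]: "F 0 = 0"
  using F_scale[OF subspace_0[OF subspace_U], of 0] by simp

lemma E_pow_in: "x \<in> U n \<Longrightarrow> (E ^^ r) x \<in> U (n + int r)"
  by (induction r) (auto dest: E_in simp: algebra_simps)

lemma F_pow_in: "x \<in> U n \<Longrightarrow> (F ^^ r) x \<in> U (n - int r)"
  by (induction r) (auto dest: F_in simp: algebra_simps)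

lemma E_diff: "x \<in> U n \<Longrightarrow> y \<in> U n \<Longrightarrow> E (x - y) = E x - E y"
  using E_add[of x n "scale (-1) y"] E_scale[of y n "-1"] subspace_neg[OF subspace_U]
  by simp

lemma E_pow_add: "x \<in> U n \<Longrightarrow> y \<in> U n \<Longrightarrow> (E ^^ r) (x + y) = (E ^^ r) x + (E ^^ r) y"
  by (induction r) (auto simp: E_add[OF E_pow_in E_pow_in])

lemma E_pow_scale: "x \<in> U n \<Longrightarrow> (E ^^ r) (scale c x) = scale c ((E ^^ r) x)"
  by (induction r) (auto simp: E_scale[OF E_pow_in])

text \<open>Moving \<open>F\<close> past each of the \<open>r + 1\<close> factors contributes one
  commutator, with scalars \<open>m + 2 * n + 2 * t\<close> for \<open>t = 0, ..., r\<close>; their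
  sum is \<open>(r + 1) * (m + 2 * n + r)\<close>.\<close>

lemma F_E_pow_Suc:
  assumes x: "x \<in> U n"
  shows "F ((E ^^ Suc r) x)
    = (E ^^ Suc r) (F x) - scale (of_int ((int r + 1) * (m + 2 * n + int r))) ((E ^^ r) x)"
proof (induction r)
  case 0
  then show ?case using commutator[OF x] by (simp add: algebra_simps)
next
  case (Suc r)
  let ?y = "(E ^^ Suc r) x"
  have y: "?y \<in> U (n + int (Suc r))" using x by (rule E_pow_in)
  have "F (E ?y) = E (F ?y) - scale (of_int (m + 2 * (n + int (Suc r)))) ?y"
    using commutator[OF y] by (simp add: algebra_simps)
  also have "E (F ?y) = E ((E ^^ Suc r) (F x) - scale (of_int ((int r + 1) * (m + 2 * n + int r))) ((E ^^ r) x))"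
    using Suc.IH by simp
  also have "\<dots> = E ((E ^^ Suc r) (F x)) - scale (of_int ((int r + 1) * (m + 2 * n + int r))) (E ((E ^^ r) x))"
  proof -
    have 1: "(E ^^ Suc r) (F x) \<in> U (n + int r)"
      using E_pow_in[OF F_in[OF x], of "Suc r"] by (simp add: algebra_simps)
    have 2: "(E ^^ r) x \<in> U (n + int r)" using x by (rule E_pow_in)
    show ?thesis
      using E_diff[OF 1 subspace_scale[OF subspace_U 2]] E_scale[OF 2] by simp
  qed
  finally show ?case
    by (simp add: algebra_simps flip: scale_left_distrib)
qed

lemma F_E_pow:
  assumes "x \<in> U n" "r > 0"
  shows "F ((E ^^ r) x)
    = (E ^^ r) (F x) - scale (of_int (int r * (m + 2 * n + int r - 1))) ((E ^^ (r - 1)) x)"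
  using F_E_pow_Suc[OF assms(1), of "r - 1"] assms(2) by (simp add: of_nat_diff)

lemma E_pow_zero [simp]: "(E ^^ r) 0 = 0"
  by (induction r) auto

lemma F_pow_zero [simp]: "(F ^^ r) 0 = 0"
  by (induction r) auto

text \<open>At positive weight the scalars of \<open>F_E_pow_Suc\<close> never vanish, so
  \<open>E ^^ Suc r\<close> kills the vector only if \<open>E ^^ r\<close> does.\<close>

lemma lowest_positive_eq_0:
  assumes x: "x \<in> U n" and "F x = 0" "m + 2 * n > 0"
  shows "x = 0"
proof -
  have "(E ^^ r) x = 0 \<Longrightarrow> x = 0" for r
  proof (induction r)
    case (Suc r)
    have "scale (of_int ((int r + 1) * (m + 2 * n + int r))) ((E ^^ r) x) = 0"
      using F_E_pow_Suc[OF x, of r] Suc.prems assms by simp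
    moreover have "(int r + 1) * (m + 2 * n + int r) \<noteq> 0"
      using assms(3) by simp
    ultimately have "(E ^^ r) x = 0" by (metis scale_eq_0_iff of_int_eq_0_iff)
    then show ?case by (rule Suc.IH)
  qed simp
  then show ?thesis using E_nilpotent[OF x] by blast
qed

text \<open>At \<open>r = k\<close> the scalar in \<open>F_E_pow_Suc\<close> is zero, so
  \<open>(E ^^ Suc k) x\<close> is again killed by \<open>F\<close>, but it has the positive weight
  \<open>k + 2\<close>. The Serre relations are instances.\<close>

lemma lowest_E_pow_eq_0:
  assumes x: "x \<in> U n" and "F x = 0" "m + 2 * n = - int k"
  shows "(E ^^ Suc k) x = 0"
proof -
  have y: "(E ^^ Suc k) x \<in> U (n + int (Suc k))" using x by (rule E_pow_in)
  have "F ((E ^^ Suc k) x) = 0"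
    using F_E_pow_Suc[OF x, of k] assms by simp
  then show ?thesis
    using lowest_positive_eq_0[OF y] assms(3) by simp
qed

text \<open>Induction on the order of nilpotency of \<open>E\<close> at \<open>z\<close>: the
  operator \<open>F E - ?c\<close> lowers that order, and on \<open>U n\<close> it differs from
  \<open>E F\<close> by a nonzero scalar.\<close>

lemma E_onto:
  assumes z: "z \<in> U n" and pos: "m + 2 * n > 0"
  shows "\<exists>y\<in>U (n - 1). E y = z"
proof -
  have "(E ^^ r) z = 0 \<Longrightarrow> z \<in> U n \<Longrightarrow> \<exists>y\<in>U (n - 1). E y = z" for r z
  proof (induction r arbitrary: z)
    case 0
    then show ?case using subspace_0[OF subspace_U] by force
  next
    case (Suc r)
    \<comment> \<open>For \<open>z\<close> killed by \<open>E ^^ Suc r\<close>, moving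
      \<open>F\<close> to the left in \<open>(E ^^ r) (F (E z))\<close> leaves \<open>?c\<close>
      times \<open>(E ^^ r) z\<close>.\<close>
    let ?c = "of_int (int r * (m + 2 * n + int r + 1)) :: complex"
    let ?w = "F (E z) + scale (- ?c) z"
    have Fz: "F z \<in> U (n - 1)" and FEz: "F (E z) \<in> U n"
      using F_in E_in Suc.prems F_in[OF E_in] by fastforce+
    have w: "?w \<in> U n"
      using FEz Suc.prems by (intro subspace_add[OF subspace_U] subspace_scale[OF subspace_U])
    have "(E ^^ r) (F (E z)) = scale ?c ((E ^^ r) z)"
    proof (cases "r = 0")
      case True
      then show ?thesis using Suc.prems by simp
    next
      case False
      have "F ((E ^^ r) (E z)) = (E ^^ r) (F (E z))
        - scale (of_int (int r * (m + 2 * (n + 1) + int r - 1))) ((E ^^ (r - 1)) (E z))"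
        using F_E_pow[OF E_in[OF Suc.prems(2)], of r] False by simp
      moreover have "(E ^^ r) (E z) = 0"
        using Suc.prems(1) by (simp add: funpow_swap1)
      moreover have "(E ^^ (r - 1)) (E z) = (E ^^ r) z"
        using False by (cases r) (auto simp: funpow_swap1)
      ultimately show ?thesis by (simp add: algebra_simps)
    qed
    then have "(E ^^ r) ?w = 0"
      using E_pow_add[OF FEz subspace_scale[OF subspace_U Suc.prems(2)], of r "- ?c"]
        E_pow_scale[OF Suc.prems(2), of r "- ?c"] by simp
    then obtain y where y: "y \<in> U (n - 1)" "E y = ?w"
      using Suc.IH w by blast
    \<comment> \<open>\<open>scale ?d z = E (F z) - ?w\<close> and \<open>?w = E y\<close>;
      positivity of the weight makes \<open>?d\<close> invertible.\<close>
    let ?d = "of_int (m + 2 * n) + ?c"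
    have d: "?d \<noteq> 0"
    proof -
      have "m + 2 * n + int r * (m + 2 * n + int r + 1) > 0"
        using pos by (intro add_pos_nonneg[OF pos] mult_nonneg_nonneg) auto
      then show ?thesis by (metis of_int_add of_int_eq_0_iff less_irrefl)
    qed
    have "scale ?d z = E (F z) - E y"
      using commutator[OF Suc.prems(2)] y(2) by (simp add: algebra_simps)
    also have "\<dots> = E (F z - y)" using E_diff[OF Fz y(1)] by simp
    finally have "E (scale (1 / ?d) (F z - y)) = scale (1 / ?d) (scale ?d z)"
      using E_scale[OF subspace_diff[OF subspace_U Fz y(1)]] by simp
    then have "E (scale (1 / ?d) (F z - y)) = z" using d by simp
    moreover have "scale (1 / ?d) (F z - y) \<in> U (n - 1)"
      using subspace_scale[OF subspace_U] subspace_diff[OF subspace_U Fz y(1)] by blast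
    ultimately show ?case by blast
  qed
  then show ?thesis using E_nilpotent[OF z] z by blast
qed

lemma E_F_pow_Suc:
  assumes "x \<in> U n"
  shows "E ((F ^^ Suc r) x)
    = (F ^^ Suc r) (E x) + scale (of_int ((int r + 1) * (m + 2 * n - int r))) ((F ^^ r) x)"
proof -
  interpret fl: sl2_string scale "\<lambda>n. U (- n)" F E "- m" by (rule flip)
  have "E ((F ^^ Suc r) x)
    = (F ^^ Suc r) (E x) - scale (of_int ((int r + 1) * (- m + 2 * (- n) + int r))) ((F ^^ r) x)"
    by (rule fl.F_E_pow_Suc) (use assms in simp)
  also have "of_int ((int r + 1) * (- m + 2 * (- n) + int r)) = - of_int ((int r + 1) * (m + 2 * n - int r)) "
    by (simp add: algebra_simps)
  finally show ?thesis by simp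
qed

text \<open>Induction on the nilpotency order of \<open>E\<close>: the induction hypothesis gives \<open>E x = 0\<close>, and then
  \<open>E\<close> maps each \<open>F\<^sup>t\<^sup>+\<^sup>1 x\<close> to a nonzero multiple of \<open>F\<^sup>t x\<close>.\<close>

lemma F_pow_inj:
  assumes "x \<in> U n" "m + 2 * n = int k" "(F ^^ k) x = 0"
  shows "x = 0"
proof -
  have "(E ^^ r) x = 0 \<Longrightarrow> x \<in> U n \<Longrightarrow> m + 2 * n = int k \<Longrightarrow> (F ^^ k) x = 0 \<Longrightarrow> x = 0" for r x n k
  proof (induction r arbitrary: x n k)
    case (Suc r)
    have Ex: "E x \<in> U (n + 1)" using E_in Suc.prems by blast
    have F1: "(F ^^ Suc k) x = 0" using Suc.prems by simp
    then have F2: "(F ^^ Suc (Suc k)) x = 0" by simp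
    have "(F ^^ Suc (Suc k)) (E x) = 0"
      using E_F_pow_Suc[OF Suc.prems(2), of "Suc k"] F1 F2 by simp
    moreover have "(E ^^ r) (E x) = 0" using Suc.prems(1) by (simp add: funpow_swap1)
    ultimately have Ex0: "E x = 0"
      using Suc.IH[OF _ Ex, of "Suc (Suc k)"] Suc.prems(3) by simp
    have "j \<le> k \<Longrightarrow> (F ^^ (k - j)) x = 0" for j
    proof (induction j)
      case 0
      then show ?case using Suc.prems by simp
    next
      case (Suc j)
      define t where "t = k - Suc j"
      have t: "k - j = Suc t" "int t < int k" using Suc.prems by (auto simp: t_def)
      have "scale (of_int ((int t + 1) * (m + 2 * n - int t))) ((F ^^ t) x) = 0"
        using E_F_pow_Suc[OF \<open>x \<in> U n\<close>, of t] Suc.IH Suc.prems t Ex0 by simp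
      moreover have "(int t + 1) * (m + 2 * n - int t) \<noteq> 0"
        using t \<open>m + 2 * n = int k\<close> by simp
      ultimately show ?case unfolding t_def by (metis scale_eq_0_iff of_int_eq_0_iff)
    qed
    from this[of k] show ?case by simp
  qed simp
  then show ?thesis using assms E_nilpotent by blast
qed

text \<open>\<open>F ^^ k\<close> carries weight \<open>k\<close> to weight \<open>- k\<close>, that
  is index \<open>n\<close> to \<open>n - k = - m - n\<close>, and is injective by
  \<open>F_pow_inj\<close>.\<close>

lemma dim_reflect_le:
  assumes "finite B" "U (- m - n) \<subseteq> span B" and k: "m + 2 * n = int k"
  shows "dim (U n) \<le> dim (U (- m - n))"
proof (rule dim_le_of_inj_on[OF subspace_U assms(1,2), where f = "F ^^ k"])
  interpret fl: sl2_string scale "\<lambda>n. U (- n)" F E "- m" by (rule flip)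
  fix x assume x: "x \<in> U n"
  then show "(F ^^ k) x = 0 \<Longrightarrow> x = 0" using F_pow_inj k by blast
  show "(F ^^ k) (scale c x) = scale c ((F ^^ k) x)" for c
    using fl.E_pow_scale[of x "- n"] x by simp
  show "(F ^^ k) (x + y) = (F ^^ k) x + (F ^^ k) y" if "y \<in> U n" for y
    using fl.E_pow_add[of x "- n"] x that by simp
next
  show "(F ^^ k) ` U n \<subseteq> U (- m - n)"
  proof -
    have *: "n - int k = - m - n" using k by simp
    show ?thesis using F_pow_in[of _ n k] unfolding * by blast
  qed
qed

lemma dim_reflect:
  assumes fin: "\<And>n. \<exists>B. finite B \<and> U n \<subseteq> span B"
  shows "dim (U (- m - n)) = dim (U n)"
proof -
  have *: "dim (U (- m - n)) = dim (U n)" if k: "m + 2 * n = int k" for n k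
  proof (rule antisym)
    obtain B where B: "finite B" "U (- m - n) \<subseteq> span B" using fin by blast
    show "dim (U n) \<le> dim (U (- m - n))" by (rule dim_reflect_le[OF B k])
    interpret fl: sl2_string scale "\<lambda>n. U (- n)" F E "- m" by (rule flip)
    obtain B where B: "finite B" "U n \<subseteq> span B" using fin by blast
    show "dim (U (- m - n)) \<le> dim (U n)"
      using fl.dim_reflect_le[of B "m + n" k] B k by simp
  qed
  show ?thesis
  proof (cases "m + 2 * n \<ge> 0")
    case True
    then show ?thesis using *[of n "nat (m + 2 * n)"] by simp
  next
    case False
    then show ?thesis using *[of "- m - n" "nat (- m - 2 * n)"] by simp
  qed
qed

text \<open>The numerical hypothesis says that the weight of \<open>U (n + 1)\<close> is positive,
  so that \<open>E\<close> maps onto it; the weight of \<open>U n\<close> itself may be -1.\<close>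

lemma dim_E_kernel:
  assumes fin: "finite B" "U n \<subseteq> span B" and "m + 2 * n + 2 > 0"
  shows "dim (U n) = dim (U (n + 1)) + dim {x \<in> U n. E x = 0}"
proof -
  have "E ` U n = U (n + 1)"
    using E_in E_onto[of _ "n + 1"] assms(3) by force
  then show ?thesis
    using dim_kernel_on[OF subspace_U fin, of E] E_add E_scale by simp
qed

end


section \<open>Weight spaces\<close>

context lie_module
begin

lemma zero_in_carrier: "0 \<in> M"
  using subspace_carrier V.subspace_0 by blast

lemma add_in_carrier: "v \<in> M \<Longrightarrow> w \<in> M \<Longrightarrow> v + w \<in> M"
  using subspace_carrier V.subspace_add by blast

lemma diff_in_carrier: "v \<in> M \<Longrightarrow> w \<in> M \<Longrightarrow> v - w \<in> M"
  using subspace_carrier V.subspace_diff by blast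

lemma scale_in_carrier: "v \<in> M \<Longrightarrow> scaleV c v \<in> M"
  using subspace_carrier V.subspace_scale by blast

lemma act_zero_right [simp]: "act x 0 = 0"
  using act_scale[OF zero_in_carrier, of x 0] by simp

lemma act_zero_left: "v \<in> M \<Longrightarrow> act 0 v = 0"
  using scale_act[of v 0 0] by simp

lemma act_diff: "v \<in> M \<Longrightarrow> w \<in> M \<Longrightarrow> act x (v - w) = act x v - act x w"
  using act_add[of v "scaleV (-1) w" x] act_scale[of w x "-1"] scale_in_carrier[of w "-1"] by simp

lemma act_sum: "(\<And>a. a \<in> A \<Longrightarrow> y a \<in> M) \<Longrightarrow> act x (\<Sum>a\<in>A. y a) = (\<Sum>a\<in>A. act x (y a))"
proof (induction A rule: infinite_finite_induct)
  case (insert a A)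
  moreover from insert have "sum y A \<in> M"
    by (intro V.subspace_sum[OF subspace_carrier]) simp
  ultimately show ?case
    using act_add by simp
qed auto

lemma subspace_weight_space: "V.subspace (weight_space H \<nu>)"
  unfolding weight_space_def
  by (intro V.subspaceI)
    (auto simp: zero_in_carrier add_in_carrier scale_in_carrier act_add act_scale V.scale_right_distrib
      V.scale_left_commute)

lemma weight_space_cong: "(\<And>h. h \<in> H \<Longrightarrow> \<nu> h = \<kappa> h) \<Longrightarrow> weight_space H \<nu> = weight_space H \<kappa>"
  unfolding weight_space_def by auto

lemma weight_space_carrier: "v \<in> weight_space H \<nu> \<Longrightarrow> v \<in> M"
  unfolding weight_space_def by auto

text \<open>Applying \<open>h\<close> to the relation and subtracting \<open>wt b h\<close> times it
  removes the term of \<open>b\<close> and scales the others by \<open>wt a h - wt b h\<close>. With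
  \<open>H = {h}\<close> this covers eigenvectors of a single operator.\<close>

lemma weight_vectors_sum_eq_0:
  assumes "finite A" "\<And>a. a \<in> A \<Longrightarrow> y a \<in> weight_space H (wt a)"
    and "\<And>a b. a \<in> A \<Longrightarrow> b \<in> A \<Longrightarrow> a \<noteq> b \<Longrightarrow> \<exists>h\<in>H. wt a h \<noteq> wt b h"
    and "(\<Sum>a\<in>A. y a) = 0"
  shows "\<forall>a\<in>A. y a = 0"
  using assms
proof (induction A arbitrary: y rule: finite_induct)
  case (insert b A)
  have y: "y a \<in> M" "h \<in> H \<Longrightarrow> act h (y a) = scaleV (wt a h) (y a)" if "a \<in> insert b A" for a h
    using insert.prems(1)[OF that] unfolding weight_space_def by auto
  have *: "\<forall>a\<in>A. scaleV (wt a h - wt b h) (y a) = 0" if h: "h \<in> H" for h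
  proof (rule insert.IH)
    fix a assume "a \<in> A"
    then show "scaleV (wt a h - wt b h) (y a) \<in> weight_space H (wt a)"
      using insert.prems(1) V.subspace_scale[OF subspace_weight_space] by blast
  next
    have "act h (\<Sum>a\<in>insert b A. y a) = (\<Sum>a\<in>insert b A. scaleV (wt a h) (y a))"
    proof -
      have "act h (\<Sum>a\<in>insert b A. y a) = (\<Sum>a\<in>insert b A. act h (y a))"
        using act_sum y(1) by blast
      also have "\<dots> = (\<Sum>a\<in>insert b A. scaleV (wt a h) (y a))"
        using y(2) h by (intro sum.cong) auto
      finally show ?thesis .
    qed
    then have "(\<Sum>a\<in>insert b A. scaleV (wt a h) (y a)) - scaleV (wt b h) (\<Sum>a\<in>insert b A. y a) = 0"
      using insert.prems(3) by simp
    also have "(\<Sum>a\<in>insert b A. scaleV (wt a h) (y a)) - scaleV (wt b h) (\<Sum>a\<in>insert b A. y a)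
      = (\<Sum>a\<in>insert b A. scaleV (wt a h - wt b h) (y a))"
      by (simp add: V.scale_sum_right V.scale_left_diff_distrib sum_subtractf)
    finally show "(\<Sum>a\<in>A. scaleV (wt a h - wt b h) (y a)) = 0"
      using insert.hyps by simp
  qed (use insert.prems(2) in blast)
  have "y a = 0" if a: "a \<in> A" for a
  proof -
    obtain h where "h \<in> H" "wt a h \<noteq> wt b h"
      using insert.prems(2)[of a b] insert.hyps(2) a by blast
    then show ?thesis using * a by auto
  qed
  then show ?case using insert.prems(3) insert.hyps by simp
qed simp

end

section \<open>Root spaces and diagonalizable adjoint operators\<close>

context lie_algebra
begin

lemma bracket_anti: "bracket x y = - bracket y x"
proof -
  have "(bracket x x + bracket y x) + (bracket x y + bracket y y) = 0"
    using bracket_self[of "x + y"] by (simp only: bracket_add_left bracket_add_right)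
  then have "bracket x y + bracket y x = 0"
    by (simp add: bracket_self add.commute)
  then show ?thesis by (simp only: eq_neg_iff_add_eq_0)
qed

lemma bracket_zero_right [simp]: "bracket x 0 = 0"
  using bracket_scale_right[of x 0 0] by simp

lemma bracket_zero_left [simp]: "bracket 0 x = 0"
  using bracket_scale_left[of 0 0 x] by simp

lemma bracket_minus_right: "bracket x (- y) = - bracket x y"
  using bracket_scale_right[of x "-1" y] by simp

lemma bracket_minus_left: "bracket (- x) y = - bracket x y"
  using bracket_scale_left[of "-1" x y] by simp

lemma bracket_diff_right: "bracket x (y - z) = bracket x y - bracket x z"
  using bracket_add_right[of x y "- z"] bracket_minus_right by simp

lemma bracket_diff_left: "bracket (x - y) z = bracket x z - bracket y z"
  using bracket_add_left[of x "- y" z] bracket_minus_left by simp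

lemma jacobi_act: "bracket (bracket x y) z = bracket x (bracket y z) - bracket y (bracket x z)"
  using jacobi[of x y z] bracket_anti[of z "bracket x y"] bracket_anti[of z x]
  by (simp add: bracket_minus_right algebra_simps)

text \<open>Root spaces become weight spaces of the adjoint module, and the lemmas on weight spaces
  apply to both.\<close>

lemma adjoint: "lie_module scale bracket scale UNIV bracket"
  by unfold_locales
    (auto simp: bracket_add_left bracket_add_right bracket_scale_left bracket_scale_right jacobi_act)

lemma root_space_eq: "root_space H a = lie_module.weight_space scale UNIV bracket H a"
  unfolding root_space_def lie_module.weight_space_def[OF adjoint] by simp

lemma subspace_root_space: "subspace (root_space H a)"
  unfolding root_space_eq by (rule lie_module.subspace_weight_space[OF adjoint])

lemma root_space_cong: "(\<And>h. h \<in> H \<Longrightarrow> a h = b h) \<Longrightarrow> root_space H a = root_space H b"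
  unfolding root_space_def by auto

lemma bracket_root_space:
  assumes "x \<in> root_space H a" "y \<in> root_space H b" "\<And>h. h \<in> H \<Longrightarrow> c h = a h + b h"
  shows "bracket x y \<in> root_space H c"
proof -
  have "bracket h (bracket x y) = scale (c h) (bracket x y)" if h: "h \<in> H" for h
    using jacobi_act[of h x y] assms h
    by (simp add: root_space_def bracket_scale_left bracket_scale_right scale_left_distrib)
  then show ?thesis unfolding root_space_def by blast
qed

text \<open>Simultaneous diagonalization, one operator at a time: an operator commuting with
  \<open>ad h\<close> preserves its eigenspaces, so the components of a joint eigenvector of
  \<open>S\<close> are themselves joint eigenvectors of \<open>S\<close>.\<close>

lemma span_joint_eigenvectors:
  assumes "finite S" "\<And>h k. h \<in> S \<Longrightarrow> k \<in> S \<Longrightarrow> bracket h k = 0"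
    and "\<And>h. h \<in> S \<Longrightarrow> span {x. \<exists>c. bracket h x = scale c x} = UNIV"
  shows "span (\<Union>\<nu>. root_space S \<nu>) = UNIV"
  using assms
proof (induction S rule: finite_induct)
  case empty
  then show ?case by (auto simp: root_space_def intro: span_base)
next
  case (insert h S)
  interpret ad: lie_module scale bracket scale UNIV bracket by (rule adjoint)
  have "x \<in> span (\<Union>\<nu>. root_space (insert h S) \<nu>)" if x: "x \<in> root_space S \<nu>" for x \<nu>
  proof -
    have "x \<in> span (\<Union>c\<in>UNIV. root_space {h} (\<lambda>_. c))"
    proof -
      have "{x. \<exists>c. bracket h x = scale c x} = (\<Union>c\<in>UNIV. root_space {h} (\<lambda>_. c))"
        unfolding root_space_def by auto
      then show ?thesis using insert.prems(2)[of h] by auto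
    qed
    then obtain A y where A: "finite A" "\<And>c. c \<in> A \<Longrightarrow> y c \<in> root_space {h} (\<lambda>_. c)" "x = (\<Sum>c\<in>A. y c)"
      by (rule span_Union_subspacesE) (auto simp: subspace_root_space)
    have s: "bracket s (y c) = scale (\<nu> s) (y c)" if "s \<in> S" "c \<in> A" for s c
    proof -
      have "\<forall>c\<in>A. bracket s (y c) - scale (\<nu> s) (y c) = 0"
      proof (rule ad.weight_vectors_sum_eq_0[OF A(1), where wt = "\<lambda>c _. c" and H = "{h}"])
        fix c assume c: "c \<in> A"
        have "s \<in> root_space {h} (\<lambda>_. 0)"
          using insert.prems(1)[of h s] that(1) by (simp add: root_space_def)
        then have "bracket s (y c) \<in> root_space {h} (\<lambda>_. c)"
          using A(2)[OF c] by (rule bracket_root_space) simp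
        then show "bracket s (y c) - scale (\<nu> s) (y c) \<in> ad.weight_space {h} (\<lambda>_. c)"
          unfolding root_space_eq[symmetric]
          using A(2)[OF c] subspace_root_space subspace_diff subspace_scale by blast
      next
        have "(\<Sum>c\<in>A. bracket s (y c) - scale (\<nu> s) (y c)) = bracket s x - scale (\<nu> s) x"
          using ad.act_sum[of A y s] unfolding A(3) by (simp add: sum_subtractf scale_sum_right)
        then show "(\<Sum>c\<in>A. bracket s (y c) - scale (\<nu> s) (y c)) = 0"
          using x that(1) by (simp add: root_space_def)
      qed auto
      then show ?thesis using that(2) by simp
    qed
    have "y c \<in> root_space (insert h S) (\<nu>(h := c))" if "c \<in> A" for c
      using s A(2)[OF that] that insert.hyps unfolding root_space_def by auto
    then show ?thesis
      unfolding A(3) by (intro span_sum span_base) blast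
  qed
  then have "(\<Union>\<nu>. root_space S \<nu>) \<subseteq> span (\<Union>\<nu>. root_space (insert h S) \<nu>)" by blast
  then have "span (\<Union>\<nu>. root_space S \<nu>) \<subseteq> span (\<Union>\<nu>. root_space (insert h S) \<nu>)"
    by (intro span_minimal) auto
  moreover have "span (\<Union>\<nu>. root_space S \<nu>) = UNIV"
    using insert.IH insert.prems by blast
  ultimately show ?case by blast
qed

text \<open>The powers of \<open>ad e\<close> move an eigenvector of \<open>ad h\<close> through infinitely many eigenvalues.\<close>

lemma ad_locally_nilpotent:
  assumes fin: "finite B" "span B = UNIV"
    and h: "span {x. \<exists>c. bracket h x = scale c x} = UNIV"
    and e: "bracket h e = scale c e" "c \<noteq> 0"
  shows "\<exists>r. (bracket e ^^ r) x = 0"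
proof -
  interpret ad: lie_module scale bracket scale UNIV bracket by (rule adjoint)
  have pow_add: "(bracket e ^^ r) (x + y) = (bracket e ^^ r) x + (bracket e ^^ r) y" for r x y
    by (induction r) (auto simp: bracket_add_right)
  have pow_scale: "(bracket e ^^ r) (scale k x) = scale k ((bracket e ^^ r) x)" for r k x
    by (induction r) (auto simp: bracket_scale_right)
  have pow_0: "(bracket e ^^ (r + s)) x = 0" if "(bracket e ^^ r) x = 0" for r s x
    using that by (induction s) (auto simp: funpow_add)
  have eig: "\<exists>r. (bracket e ^^ r) x = 0" if x: "bracket h x = scale d x" for x d
  proof (rule ccontr)
    assume n: "\<nexists>r. (bracket e ^^ r) x = 0"
    let ?y = "\<lambda>r. (bracket e ^^ r) x"
    have eigen: "bracket h (?y r) = scale (d + of_nat r * c) (?y r)" for r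
    proof (induction r)
      case (Suc r)
      have "bracket h (bracket e (?y r)) = bracket (bracket h e) (?y r) + bracket e (bracket h (?y r))"
        using jacobi_act[of h e "?y r"] by simp
      then show ?case
        using Suc e(1) by (simp add: bracket_scale_left bracket_scale_right bracket_add_right algebra_simps)
    qed (use x in simp)
    have in_ws: "?y r \<in> ad.weight_space {h} (\<lambda>_. d + of_nat r * c)" for r
      using eigen by (simp add: ad.weight_space_def)
    have inj: "inj ?y"
    proof (rule injI, rule ccontr)
      fix r s assume rs: "?y r = ?y s" "r \<noteq> s"
      have "scale (d + of_nat r * c) (?y r) = scale (d + of_nat s * c) (?y r)"
        using eigen[of r] eigen[of s] rs by metis
      then show False using n rs(2) e(2) by simp
    qed
    let ?N = "Suc (card B)"
    have "independent (?y ` {..<?N})"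
      unfolding dependent_explicit
    proof clarify
      fix A u v assume A: "finite A" "A \<subseteq> ?y ` {..<?N}" "(\<Sum>v\<in>A. scale (u v) v) = 0"
        and "v \<in> A" "u v \<noteq> 0"
      then obtain r where v: "?y r \<in> A" "u (?y r) \<noteq> 0" by blast
      define R where "R = {r. ?y r \<in> A}"
      have AR: "A = ?y ` R" using A(2) by (auto simp: R_def)
      have finR: "finite R" using A(1) AR finite_image_iff[OF inj_on_subset[OF inj subset_UNIV]] by blast
      have "\<forall>r\<in>R. scale (u (?y r)) (?y r) = 0"
      proof (rule ad.weight_vectors_sum_eq_0[OF finR, where wt = "\<lambda>r _. d + of_nat r * c" and H = "{h}"])
        show "(\<Sum>r\<in>R. scale (u (?y r)) (?y r)) = 0"
          using A(3) unfolding AR sum.reindex[OF inj_on_subset[OF inj subset_UNIV]] by simp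
        show "scale (u (?y r)) (?y r) \<in> ad.weight_space {h} (\<lambda>_. d + of_nat r * c)" for r
          using in_ws subspace_scale[OF ad.subspace_weight_space] by blast
      qed (use e(2) in auto)
      then have "scale (u (?y r)) (?y r) = 0" using v(1) unfolding R_def by blast
      then show False using n v(2) by (simp only: scale_eq_0_iff) blast
    qed
    then have "card (?y ` {..<?N}) \<le> card B"
      using independent_span_bound[OF fin(1)] fin(2) by blast
    then show False using card_image[OF inj_on_subset[OF inj subset_UNIV], of "{..<?N}"] by simp
  qed
  have "x \<in> span {x. \<exists>c. bracket h x = scale c x}" using h by simp
  then show ?thesis
  proof (induction rule: span_induct_alt)
    case base
    show ?case by (rule exI[of _ 0]) simp
  next
    case (step k x y)
    then obtain r s where "(bracket e ^^ r) x = 0" "(bracket e ^^ s) y = 0"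
      using eig by blast
    then have "(bracket e ^^ (r + s)) (scale k x + y) = 0"
      using pow_0[of r x s] pow_0[of s y r] by (simp add: pow_add pow_scale add.commute)
    then show ?case by blast
  qed
qed

end


section \<open>Generators of a semisimple Lie algebra\<close>

context based_semisimple_lie_algebra
begin

lemma subspace_H: "subspace H"
  and H_abelian: "h \<in> H \<Longrightarrow> k \<in> H \<Longrightarrow> bracket h k = 0"
  and H_self_centralizing: "(\<And>h. h \<in> H \<Longrightarrow> bracket h x = 0) \<Longrightarrow> x \<in> H"
  and H_diagonalizable: "h \<in> H \<Longrightarrow> span {x. \<exists>c. bracket h x = scale c x} = UNIV"
  using cartan unfolding cartan_subalgebra_def by auto

lemma finite_spanning: "\<exists>B. finite B \<and> span B = UNIV"
  using semisimple unfolding semisimple_def by blast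

lemma root_space_0: "(\<And>h. h \<in> H \<Longrightarrow> a h = 0) \<Longrightarrow> root_space H a = H"
  unfolding root_space_def using H_abelian H_self_centralizing by auto

lemma dual_spaceD:
  assumes "a \<in> dual_space H"
  shows "x \<in> H \<Longrightarrow> y \<in> H \<Longrightarrow> a (x + y) = a x + a y"
    and "x \<in> H \<Longrightarrow> a (scale c x) = c * a x"
    and "x \<notin> H \<Longrightarrow> a x = 0"
  using assms unfolding dual_space_def by auto

lemma dual_space_add:
  "a \<in> dual_space H \<Longrightarrow> b \<in> dual_space H \<Longrightarrow> (\<lambda>h. a h + b h) \<in> dual_space H"
  unfolding dual_space_def by (auto simp: algebra_simps)

lemma dual_space_scale: "a \<in> dual_space H \<Longrightarrow> (\<lambda>h. c * a h) \<in> dual_space H"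
  unfolding dual_space_def by (auto simp: algebra_simps)

lemma dual_space_zero: "(\<lambda>h. 0) \<in> dual_space H"
  unfolding dual_space_def by auto

lemma dual_space_sum:
  "(\<And>a. a \<in> A \<Longrightarrow> b a \<in> dual_space H) \<Longrightarrow> (\<lambda>h. \<Sum>a\<in>A. b a h) \<in> dual_space H"
  by (induction A rule: infinite_finite_induct) (auto intro: dual_space_zero dual_space_add)

lemma dual_space_diff:
  "a \<in> dual_space H \<Longrightarrow> b \<in> dual_space H \<Longrightarrow> (\<lambda>h. a h - b h) \<in> dual_space H"
  using dual_space_add[of a "\<lambda>h. - 1 * b h"] dual_space_scale[of b "-1"] by simp

lemma dual_space_eqI:
  "a \<in> dual_space H \<Longrightarrow> b \<in> dual_space H \<Longrightarrow> (\<And>h. h \<in> H \<Longrightarrow> a h = b h) \<Longrightarrow> a = b"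
  by (rule ext) (metis dual_spaceD(3))

lemma simple_root_dual: "p \<in> I \<Longrightarrow> simple_root p \<in> dual_space H"
  using simple_root_root unfolding roots_def by blast

text \<open>A finite basis of \<open>H\<close> is diagonalized simultaneously. The elements acting
  on a given joint eigenvector by scalars form a subspace, which therefore contains
  \<open>H\<close>, and the scalar depends linearly on the element.\<close>

lemma root_space_decomposition: "span (\<Union>a\<in>dual_space H. root_space H a) = UNIV"
proof -
  obtain B where B: "finite B" "span B = UNIV" using finite_spanning by blast
  obtain S where S: "S \<subseteq> H" "independent S" "H \<subseteq> span S" using basis_exists[of H] by metis
  have finS: "finite S" using independent_span_bound[OF B(1) S(2)] B(2) by simp
  have "span (\<Union>\<nu>. root_space S \<nu>) = UNIV"
    by (rule span_joint_eigenvectors[OF finS]) (use S H_abelian H_diagonalizable in blast)+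
  moreover have "(\<Union>\<nu>. root_space S \<nu>) \<subseteq> span (\<Union>a\<in>dual_space H. root_space H a)"
  proof clarify
    fix x \<nu> assume x: "x \<in> root_space S \<nu>"
    show "x \<in> span (\<Union>a\<in>dual_space H. root_space H a)"
    proof (cases "x = 0")
      case True
      then show ?thesis by (simp add: span_zero)
    next
      case False
      let ?L = "{h. \<exists>c. bracket h x = scale c x}"
      have "subspace ?L"
      proof (rule subspaceI)
        show "0 \<in> ?L" by (auto intro: exI[of _ 0])
        show "h + k \<in> ?L" if "h \<in> ?L" "k \<in> ?L" for h k
          using that by (auto simp: bracket_add_left scale_left_distrib[symmetric])
        show "scale c h \<in> ?L" if "h \<in> ?L" for c h
          using that by (auto simp: bracket_scale_left)
      qed
      moreover have "S \<subseteq> ?L" using x unfolding root_space_def by blast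
      ultimately have "H \<subseteq> ?L" using span_minimal S(3) by blast
      then have "\<forall>h\<in>H. \<exists>c. bracket h x = scale c x" by blast
      from bchoice[OF this] obtain c where c: "\<And>h. h \<in> H \<Longrightarrow> bracket h x = scale (c h) x" by blast
      define a where "a h = (if h \<in> H then c h else 0)" for h
      have "a (h + k) = a h + a k" if "h \<in> H" "k \<in> H" for h k
      proof -
        have "scale (c (h + k)) x = scale (c h + c k) x"
          using c[of h] c[of k] c[of "h + k"] that subspace_add[OF subspace_H]
          by (simp add: bracket_add_left scale_left_distrib)
        then show ?thesis using False that subspace_add[OF subspace_H] by (simp add: a_def)
      qed
      moreover have "a (scale d h) = d * a h" if "h \<in> H" for h d
      proof -
        have "scale (c (scale d h)) x = scale (d * c h) x"
          using c[OF that] c[OF subspace_scale[OF subspace_H that], of d] bracket_scale_left[of d h x]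
          by (metis scale_scale)
        then have "c (scale d h) = d * c h" using False by (simp only: scale_cancel_right) simp
        then show ?thesis using that subspace_scale[OF subspace_H] by (simp add: a_def)
      qed
      ultimately have "a \<in> dual_space H" unfolding dual_space_def by (auto simp: a_def)
      moreover have "x \<in> root_space H a" using c by (simp add: root_space_def a_def)
      ultimately show ?thesis by (intro span_base) blast
    qed
  qed
  ultimately show ?thesis using span_minimal[OF _ subspace_span] by blast
qed

section \<open>sl2-triples of the simple roots and the Serre relations\<close>

lemma ad_nilpotent:
  assumes "h \<in> H" "bracket h e = scale c e" "c \<noteq> 0"
  shows "\<exists>r. (bracket e ^^ r) x = 0"
proof -
  obtain B where "finite B" "span B = UNIV" using finite_spanning by blast
  then show ?thesis
    by (rule ad_locally_nilpotent[OF _ _ H_diagonalizable[OF assms(1)] assms(2,3)])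
qed

text \<open>The base point \<open>a\<close> is an arbitrary functional with integral value at
  \<open>t\<close>, and spaces in the string may be zero. Nilpotency of both operators comes from
  \<open>t\<close>, for which \<open>x\<close> and \<open>y\<close> have the eigenvalues 2 and
  -2.\<close>

lemma ad_string:
  assumes x: "x \<in> root_space H b" and y: "y \<in> root_space H (\<lambda>h. - b h)"
    and t: "bracket x y = t" "b t = 2" "a t = of_int m"
  shows "sl2_string scale (\<lambda>n. root_space H (\<lambda>h. a h + of_int n * b h)) (bracket x) (bracket y) m"
proof
  have tH: "t \<in> H"
    using bracket_root_space[OF x y, of "\<lambda>_. 0"] root_space_0 t(1) by simp
  fix z z' c n
  show "bracket x (z + z') = bracket x z + bracket x z'" "bracket y (z + z') = bracket y z + bracket y z'"
    "bracket x (scale c z) = scale c (bracket x z)" "bracket y (scale c z) = scale c (bracket y z)"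
    by (simp_all add: bracket_add_right bracket_scale_right)
  show "subspace (root_space H (\<lambda>h. a h + of_int n * b h))" by (rule subspace_root_space)
  show "\<exists>r. (bracket x ^^ r) z = 0"
    by (rule ad_nilpotent[OF tH, of _ 2]) (use x tH t in \<open>auto simp: root_space_def\<close>)
  show "\<exists>r. (bracket y ^^ r) z = 0"
    by (rule ad_nilpotent[OF tH, of _ "-2"]) (use y tH t in \<open>auto simp: root_space_def\<close>)
  assume z: "z \<in> root_space H (\<lambda>h. a h + of_int n * b h)"
  show "bracket x z \<in> root_space H (\<lambda>h. a h + of_int (n + 1) * b h)"
    by (rule bracket_root_space[OF x z]) (simp add: algebra_simps)
  show "bracket y z \<in> root_space H (\<lambda>h. a h + of_int (n - 1) * b h)"
    by (rule bracket_root_space[OF y z]) (simp add: algebra_simps)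
  show "bracket x (bracket y z) - bracket y (bracket x z) = scale (of_int (m + 2 * n)) z"
  proof -
    have "bracket t z = scale (a t + of_int n * b t) z" using z tH unfolding root_space_def by blast
    also have "a t + of_int n * b t = of_int (m + 2 * n)" using t(2,3) by simp
    finally show ?thesis using jacobi_act[of x y z] t(1) by simp
  qed
qed

text \<open>For \<open>[x, y] = t\<close> with \<open>b t = 2\<close>, injectivity of \<open>(ad y)\<^sup>2\<close> on the root space of \<open>b\<close> forces the
  latter to be spanned by \<open>x\<close>; hence the coroot is \<open>t\<close>.\<close>

lemma ex_sl2_triple:
  assumes p: "p \<in> I"
  shows "\<exists>x y. x \<in> root_space H (simple_root p) \<and> y \<in> root_space H (\<lambda>h. - simple_root p h) \<and>
    bracket x y = simple_coroot p"
proof -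
  let ?b = "simple_root p"
  have b: "?b \<in> dual_space H" using simple_root_dual[OF p] .
  note bD = dual_spaceD[OF b]
  let ?S = "{bracket x y |x y. x \<in> root_space H ?b \<and> y \<in> root_space H (\<lambda>z. - ?b z)}"
  have co: "simple_coroot p \<in> span ?S" "?b (simple_coroot p) = 2"
    using simple_coroot[OF p] unfolding is_coroot_def by auto
  have inH: "bracket x y \<in> H" if "x \<in> root_space H ?b" "y \<in> root_space H (\<lambda>z. - ?b z)" for x y
    using bracket_root_space[OF that, of "\<lambda>_. 0"] root_space_0 by simp
  \<comment> \<open>Otherwise \<open>?b\<close> vanishes on the span that contains the coroot, where
    its value is 2.\<close>
  have "\<exists>x y. x \<in> root_space H ?b \<and> y \<in> root_space H (\<lambda>z. - ?b z) \<and> ?b (bracket x y) \<noteq> 0"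
  proof (rule ccontr)
    assume "\<not> ?thesis"
    then have z: "?b s = 0" if "s \<in> ?S" for s using that by blast
    have "s \<in> H \<and> ?b s = 0" if "s \<in> span ?S" for s
      using that
    proof (induction rule: span_induct_alt)
      case base
      then show ?case using subspace_0[OF subspace_H] bD(2)[of 0 0] by simp
    next
      case (step c s s')
      then have "s \<in> H" "?b s = 0" using inH z by blast+
      then show ?case using step bD subspace_add[OF subspace_H] subspace_scale[OF subspace_H] by simp
    qed
    then show False using co by auto
  qed
  then obtain x y0 where x: "x \<in> root_space H ?b" and y0: "y0 \<in> root_space H (\<lambda>z. - ?b z)"
    and ne: "?b (bracket x y0) \<noteq> 0" by blast
  define y where "y = scale (2 / ?b (bracket x y0)) y0"
  define t where "t = bracket x y"
  have y: "y \<in> root_space H (\<lambda>z. - ?b z)"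
    unfolding y_def using y0 subspace_scale[OF subspace_root_space] by blast
  have tH: "t \<in> H" unfolding t_def using inH x y by blast
  have bt: "?b t = 2"
    unfolding t_def y_def bracket_scale_right using bD(2)[OF inH[OF x y0]] ne by simp
  interpret st: sl2_string scale "\<lambda>n. root_space H (\<lambda>h. 0 + of_int n * ?b h)" "bracket x" "bracket y" 0
    by (rule ad_string[OF x y t_def[symmetric] bt]) simp
  interpret fl: sl2_string scale "\<lambda>n. root_space H (\<lambda>h. 0 + of_int (- n) * ?b h)" "bracket y" "bracket x" "- 0"
    by (rule st.flip)
  have bminus: "?b (- h) = - ?b h" if "h \<in> H" for h
    using bD(2)[OF that, of "-1"] by simp
  have x1: "\<exists>c. z = scale c x" if z: "z \<in> root_space H ?b" for z
  proof -
    \<comment> \<open>With this \<open>?c\<close>, \<open>?b\<close> vanishes at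
      \<open>bracket ?z y\<close>, so this element of \<open>H\<close> commutes with
      \<open>y\<close>, and \<open>bracket y ^^ 2\<close> kills \<open>?z\<close>, a vector of
      weight 2.\<close>
    let ?c = "?b (bracket z y) / 2"
    let ?z = "z - scale ?c x"
    have z': "?z \<in> root_space H ?b"
      using z x subspace_diff[OF subspace_root_space] subspace_scale[OF subspace_root_space] by blast
    have zy: "bracket ?z y \<in> H" using inH z' y by blast
    have "?b (bracket ?z y) = ?b (bracket z y) + ?b (scale (- ?c) t)"
      unfolding bracket_diff_left bracket_scale_left t_def[symmetric]
      using bD(1)[OF inH[OF z y] subspace_scale[OF subspace_H tH, of "- ?c"]] by simp
    then have "?b (bracket ?z y) = 0" using bD(2)[OF tH, of "- ?c"] bt by simp
    then have "bracket (bracket ?z y) y = 0"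
      using y zy unfolding root_space_def by simp
    then have "(bracket y ^^ 2) ?z = 0"
      using bracket_anti[of y ?z] bracket_anti[of y "bracket ?z y"] by (simp add: numeral_2_eq_2 bracket_minus_right)
    then have "?z = 0"
      using st.F_pow_inj[of ?z 1 2] z' by simp
    then show ?thesis by auto
  qed
  have y1: "\<exists>c. z = scale c y" if z: "z \<in> root_space H (\<lambda>z. - ?b z)" for z
  proof -
    let ?c = "?b (bracket x z) / 2"
    let ?z = "z - scale ?c y"
    have z': "?z \<in> root_space H (\<lambda>z. - ?b z)"
      using z y subspace_diff[OF subspace_root_space] subspace_scale[OF subspace_root_space] by blast
    have zx: "bracket x ?z \<in> H" using inH z' x by blast
    have "?b (bracket x ?z) = ?b (bracket x z) + ?b (scale (- ?c) t)"
      unfolding bracket_diff_right bracket_scale_right t_def[symmetric]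
      using bD(1)[OF inH[OF x z] subspace_scale[OF subspace_H tH, of "- ?c"]] by simp
    then have "?b (bracket x ?z) = 0" using bD(2)[OF tH, of "- ?c"] bt by simp
    then have "bracket (bracket x ?z) x = 0"
      using x zx unfolding root_space_def by simp
    then have "(bracket x ^^ 2) ?z = 0"
      using bracket_anti[of x "bracket x ?z"] by (simp add: numeral_2_eq_2)
    then have "?z = 0"
      using fl.F_pow_inj[of ?z 1 2] z' by simp
    then show ?thesis by auto
  qed
  have "?S \<subseteq> span {t}"
  proof clarify
    fix z w assume "z \<in> root_space H ?b" "w \<in> root_space H (\<lambda>z. - ?b z)"
    then obtain c d where "z = scale c x" "w = scale d y" using x1 y1 by blast
    then show "bracket z w \<in> span {t}"
      by (simp add: bracket_scale_left bracket_scale_right t_def span_scale span_base)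
  qed
  then have "simple_coroot p \<in> span {t}" using co(1) span_minimal by blast
  then obtain c where "simple_coroot p = scale c t" unfolding span_singleton by blast
  then have "simple_coroot p = t" using bD(2)[OF tH, of c] co(2) bt by simp
  then show ?thesis using x y t_def by metis
qed

text \<open>Both members are chosen at once because the bracket relation couples them.\<close>

definition sl2_triple :: "'i \<Rightarrow> 'g \<times> 'g" where
  "sl2_triple p = (SOME (x, y). x \<in> root_space H (simple_root p) \<and>
     y \<in> root_space H (\<lambda>h. - simple_root p h) \<and> bracket x y = simple_coroot p)"

definition e :: "'i \<Rightarrow> 'g" where "e p = fst (sl2_triple p)"
definition f :: "'i \<Rightarrow> 'g" where "f p = snd (sl2_triple p)"

lemma e_root_space: "p \<in> I \<Longrightarrow> e p \<in> root_space H (simple_root p)"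
  and f_root_space: "p \<in> I \<Longrightarrow> f p \<in> root_space H (\<lambda>h. - simple_root p h)"
  and bracket_e_f: "p \<in> I \<Longrightarrow> bracket (e p) (f p) = simple_coroot p"
proof -
  assume "p \<in> I"
  then have "\<exists>z. case z of (x, y) \<Rightarrow> x \<in> root_space H (simple_root p) \<and>
     y \<in> root_space H (\<lambda>h. - simple_root p h) \<and> bracket x y = simple_coroot p"
    using ex_sl2_triple by auto
  from someI_ex[OF this] show "e p \<in> root_space H (simple_root p)" "f p \<in> root_space H (\<lambda>h. - simple_root p h)"
    "bracket (e p) (f p) = simple_coroot p"
    unfolding sl2_triple_def[symmetric] e_def f_def by (auto simp: case_prod_beta)
qed

lemma simple_coroot_in_H: "p \<in> I \<Longrightarrow> simple_coroot p \<in> H"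
  using bracket_root_space[OF e_root_space f_root_space, of p p "\<lambda>_. 0"] bracket_e_f root_space_0 by simp

lemma simple_root_coroot_self: "p \<in> I \<Longrightarrow> simple_root p (simple_coroot p) = 2"
  using simple_coroot unfolding is_coroot_def by blast

lemma bracket_H_f: "h \<in> H \<Longrightarrow> p \<in> I \<Longrightarrow> bracket h (f p) = scale (- simple_root p h) (f p)"
  using f_root_space unfolding root_space_def by blast

lemma simple_roots_unique:
  assumes "\<And>h. h \<in> H \<Longrightarrow> (\<Sum>q\<in>I. c q * simple_root q h) = (\<Sum>q\<in>I. d q * simple_root q h)" "p \<in> I"
  shows "c p = d p"
proof -
  have "c p - d p = 0"
    using simple_root_independent[of "\<lambda>q. c q - d q"] assms
    by (simp add: algebra_simps sum_subtractf)
  then show ?thesis by simp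
qed

text \<open>A nonzero bracket would make the difference of two simple roots a root, with
  coefficients of both signs.\<close>

lemma bracket_e_f_distinct:
  assumes p: "p \<in> I" and q: "q \<in> I" and "p \<noteq> q"
  shows "bracket (e p) (f q) = 0"
proof (rule ccontr)
  let ?a = "\<lambda>h. simple_root p h - simple_root q h"
  let ?c = "\<lambda>r. (if r = p then 1 else if r = q then -1 else 0) :: complex"
  assume "bracket (e p) (f q) \<noteq> 0"
  moreover have "bracket (e p) (f q) \<in> root_space H ?a"
    by (rule bracket_root_space[OF e_root_space[OF p] f_root_space[OF q]]) simp
  ultimately have rs: "root_space H ?a \<noteq> {0}" by blast
  have a: "?a h = (\<Sum>r\<in>I. ?c r * simple_root r h)" for h
  proof -
    have "(\<Sum>r\<in>I. ?c r * simple_root r h) = (\<Sum>r\<in>{p, q}. ?c r * simple_root r h)"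
      by (rule sum.mono_neutral_right) (use finite_index p q in auto)
    then show ?thesis using assms(3) by simp
  qed
  have "?a \<noteq> (\<lambda>_. 0)"
  proof
    assume "?a = (\<lambda>_. 0)"
    then have "(\<Sum>r\<in>I. ?c r * simple_root r h) = 0" for h using a by metis
    from simple_root_independent[OF this p] show False by simp
  qed
  moreover have "?a \<in> dual_space H" using dual_space_diff simple_root_dual p q by blast
  ultimately have "?a \<in> roots H" using rs unfolding roots_def by blast
  from root_expansion[OF this] obtain n :: "'i \<Rightarrow> nat" where
    "(\<forall>h\<in>H. ?a h = (\<Sum>i\<in>I. of_nat (n i) * simple_root i h)) \<or>
     (\<forall>h\<in>H. ?a h = - (\<Sum>i\<in>I. of_nat (n i) * simple_root i h))"
    by (rule exE)
  then show False
  proof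
    assume n: "\<forall>h\<in>H. ?a h = (\<Sum>i\<in>I. of_nat (n i) * simple_root i h)"
    have "(\<Sum>r\<in>I. ?c r * simple_root r h) = (\<Sum>i\<in>I. of_nat (n i) * simple_root i h)"
      if "h \<in> H" for h
      by (rule trans[OF a[of h, symmetric] bspec[OF n that]])
    from simple_roots_unique[of ?c "\<lambda>r. of_nat (n r)", OF this q] have "of_nat (n q) = (- 1 :: complex)"
      using assms(3) by simp
    then have "of_nat (n q + 1) = (0 :: complex)" by simp
    then show False unfolding of_nat_eq_0_iff by simp
  next
    assume n: "\<forall>h\<in>H. ?a h = - (\<Sum>i\<in>I. of_nat (n i) * simple_root i h)"
    have "(\<Sum>r\<in>I. ?c r * simple_root r h) = (\<Sum>i\<in>I. (- of_nat (n i)) * simple_root i h)"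
      if "h \<in> H" for h
      using trans[OF a[of h, symmetric] bspec[OF n that]] by (simp only: sum_negf mult_minus_left)
    from simple_roots_unique[of ?c "\<lambda>r. - of_nat (n r)", OF this p] have "of_nat (n p) = (- 1 :: complex)"
      by (simp add: minus_equation_iff)
    then have "of_nat (n p + 1) = (0 :: complex)" by simp
    then show False unfolding of_nat_eq_0_iff by simp
  qed
qed

text \<open>For the sl2 of \<open>p\<close>, \<open>e q\<close> is a lowest vector of weight
  \<open>- k\<close> by \<open>bracket_e_f_distinct\<close>.\<close>

lemma serre_e:
  assumes "p \<in> I" "q \<in> I" "p \<noteq> q" "simple_root q (simple_coroot p) = - of_nat k"
  shows "(bracket (e p) ^^ Suc k) (e q) = 0"
proof -
  interpret st: sl2_string scale "\<lambda>n. root_space H (\<lambda>h. simple_root q h + of_int n * simple_root p h)"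
    "bracket (e p)" "bracket (f p)" "- int k"
    by (rule ad_string[OF e_root_space f_root_space bracket_e_f])
      (use assms simple_root_coroot_self in auto)
  show ?thesis
    by (rule st.lowest_E_pow_eq_0[of _ 0])
      (use assms bracket_e_f_distinct[of q p] bracket_anti[of "f p" "e q"] e_root_space in auto)
qed

lemma serre_f:
  assumes "p \<in> I" "q \<in> I" "p \<noteq> q" "simple_root q (simple_coroot p) = - of_nat k"
  shows "(bracket (f p) ^^ Suc k) (f q) = 0"
proof -
  interpret st: sl2_string scale "\<lambda>n. root_space H (\<lambda>h. - simple_root q h + of_int n * simple_root p h)"
    "bracket (e p)" "bracket (f p)" "int k"
    by (rule ad_string[OF e_root_space f_root_space bracket_e_f])
      (use assms simple_root_coroot_self in auto)
  interpret fl: sl2_string scale "\<lambda>n. root_space H (\<lambda>h. - simple_root q h + of_int (- n) * simple_root p h)"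
    "bracket (f p)" "bracket (e p)" "- int k"
    by (rule st.flip)
  show ?thesis
    by (rule fl.lowest_E_pow_eq_0[of _ 0])
      (use assms bracket_e_f_distinct[of p q] f_root_space in auto)
qed

end

text \<open>Positivity holds for every Cartan matrix of finite type: evaluate the
  positive definite form at \<open>\<Sum>q. n q * \<alpha>\<^sub>q\<close>.\<close>

locale cartan_type = based_semisimple_lie_algebra scale bracket H I simple_root simple_coroot
  for scale :: "complex \<Rightarrow> 'g::ab_group_add \<Rightarrow> 'g" and bracket :: "'g \<Rightarrow> 'g \<Rightarrow> 'g"
    and H :: "'g set" and I :: "'i set"
    and simple_root :: "'i \<Rightarrow> 'g \<Rightarrow> complex" and simple_coroot :: "'i \<Rightarrow> 'g" +
  fixes C :: "'i \<Rightarrow> 'i \<Rightarrow> int" and \<rho> :: 'g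
  assumes cartan_integer: "p \<in> I \<Longrightarrow> q \<in> I \<Longrightarrow> simple_root q (simple_coroot p) = of_int (C p q)"
    and positivity: "\<exists>p\<in>I. n p > 0 \<Longrightarrow> \<exists>p\<in>I. 0 < n p \<and> 0 < (\<Sum>q\<in>I. C p q * int (n q))"
    and \<rho>_in_H: "\<rho> \<in> H"
    and simple_root_\<rho>: "p \<in> I \<Longrightarrow> simple_root p \<rho> = 1"
begin

lemma sum_simple_roots_decrement:
  fixes n :: "'i \<Rightarrow> nat"
  assumes p: "p \<in> I" "0 < n p"
  shows "(\<Sum>q\<in>I. of_nat (n q) * simple_root q h)
      = (\<Sum>q\<in>I. of_nat ((n(p := n p - 1)) q) * simple_root q h) + simple_root p h"
    and "(\<Sum>q\<in>I. (n(p := n p - 1)) q) < (\<Sum>q\<in>I. n q)"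
proof -
  have split: "sum g I = g p + sum g (I - {p})" for g :: "'i \<Rightarrow> 'x::comm_monoid_add"
    using p(1) finite_index by (simp add: sum.remove)
  have "of_nat (n p) = (of_nat (n p - 1) + 1 :: complex)"
    using p(2) by (metis Suc_diff_1 add.commute of_nat_Suc)
  then show "(\<Sum>q\<in>I. of_nat (n q) * simple_root q h)
      = (\<Sum>q\<in>I. of_nat ((n(p := n p - 1)) q) * simple_root q h) + simple_root p h"
    unfolding split[of "\<lambda>q. of_nat (_ q) * simple_root q h"] by (simp add: algebra_simps)
  show "(\<Sum>q\<in>I. (n(p := n p - 1)) q) < (\<Sum>q\<in>I. n q)"
    using split[of n] split[of "n(p := n p - 1)"] p(2) by simp
qed

text \<open>Induction on height over all nonnegative combinations, not only roots. By
  \<open>positivity\<close> some simple root of the support pairs positively with the combination;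
  then \<open>bracket (e p)\<close> maps the space one step lower onto the given one, and
  \<open>bracket (f p)\<close> does the same for the negatives.\<close>

lemma generation:
  assumes P: "subspace P" "H \<subseteq> P" and ef: "\<And>p. p \<in> I \<Longrightarrow> e p \<in> P" "\<And>p. p \<in> I \<Longrightarrow> f p \<in> P"
    and br: "\<And>x y. x \<in> P \<Longrightarrow> y \<in> P \<Longrightarrow> bracket x y \<in> P"
  shows "P = UNIV"
proof -
  have pos: "root_space H (\<lambda>h. \<Sum>q\<in>I. of_nat (n q) * simple_root q h) \<subseteq> P \<and>
      root_space H (\<lambda>h. - (\<Sum>q\<in>I. of_nat (n q) * simple_root q h)) \<subseteq> P" for n :: "'i \<Rightarrow> nat"
  proof (induction "\<Sum>q\<in>I. n q" arbitrary: n rule: less_induct)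
    case less
    let ?a = "\<lambda>n h. \<Sum>q\<in>I. of_nat (n q) * simple_root q h"
    show ?case
    proof (cases "\<exists>p\<in>I. n p > 0")
      case False
      then show ?thesis using root_space_0[of "?a n"] root_space_0[of "\<lambda>h. - ?a n h"] P(2) by simp
    next
      case True
      then obtain p where p: "p \<in> I" "0 < n p" "0 < (\<Sum>q\<in>I. C p q * int (n q))"
        using positivity by blast
      let ?n = "n(p := n p - 1)"
      let ?m = "\<Sum>q\<in>I. C p q * int (n q)"
      have a': "?a n h = ?a ?n h + simple_root p h" for h
        by (rule sum_simple_roots_decrement(1)[OF p(1), of n, OF p(2)])
      have "(\<Sum>q\<in>I. ?n q) < (\<Sum>q\<in>I. n q)"
        by (rule sum_simple_roots_decrement(2)[OF p(1), of n, OF p(2)])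
      then have IH: "root_space H (?a ?n) \<subseteq> P" "root_space H (\<lambda>h. - ?a ?n h) \<subseteq> P"
        using less by blast+
      have m: "?a n (simple_coroot p) = of_int ?m"
        using p(1) by (simp add: cartan_integer mult.commute)
      interpret st: sl2_string scale "\<lambda>k. root_space H (\<lambda>h. ?a n h + of_int k * simple_root p h)"
        "bracket (e p)" "bracket (f p)" ?m
        by (rule ad_string[OF e_root_space f_root_space bracket_e_f])
          (use p m simple_root_coroot_self in auto)
      interpret sm: sl2_string scale "\<lambda>k. root_space H (\<lambda>h. - ?a n h + of_int k * simple_root p h)"
        "bracket (e p)" "bracket (f p)" "- ?m"
        by (rule ad_string[OF e_root_space f_root_space bracket_e_f])
          (use p m simple_root_coroot_self in auto)
      interpret fl: sl2_string scale "\<lambda>k. root_space H (\<lambda>h. - ?a n h + of_int (- k) * simple_root p h)"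
        "bracket (f p)" "bracket (e p)" "- (- ?m)"
        by (rule sm.flip)
      have "x \<in> P" if x: "x \<in> root_space H (?a n)" for x
      proof -
        obtain y where y: "y \<in> root_space H (\<lambda>h. ?a n h + of_int (0 - 1) * simple_root p h)" "bracket (e p) y = x"
          using st.E_onto[of x 0] x p(3) by auto
        have "root_space H (\<lambda>h. ?a n h + of_int (0 - 1) * simple_root p h) = root_space H (?a ?n)"
          by (rule root_space_cong) (simp add: a' del: fun_upd_apply)
        then show ?thesis using y IH(1) br[OF ef(1)[OF p(1)]] by blast
      qed
      moreover have "x \<in> P" if x: "x \<in> root_space H (\<lambda>h. - ?a n h)" for x
      proof -
        obtain y where y: "y \<in> root_space H (\<lambda>h. - ?a n h + of_int (- (0 - 1)) * simple_root p h)" "bracket (f p) y = x"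
          using fl.E_onto[of x 0] x p(3) by auto
        have "root_space H (\<lambda>h. - ?a n h + of_int (- (0 - 1)) * simple_root p h) = root_space H (\<lambda>h. - ?a ?n h)"
          by (rule root_space_cong) (simp add: a' del: fun_upd_apply)
        then show ?thesis using y IH(2) br[OF ef(2)[OF p(1)]] by blast
      qed
      ultimately show ?thesis by blast
    qed
  qed
  have "root_space H a \<subseteq> P" if a: "a \<in> dual_space H" for a
  proof -
    consider "root_space H a = {0}" | "a = (\<lambda>_. 0)" | "a \<in> roots H"
      using a unfolding roots_def by blast
    then show ?thesis
    proof cases
      case 1
      then show ?thesis using subspace_0[OF P(1)] by simp
    next
      case 2
      then show ?thesis using root_space_0 P(2) by simp
    next
      case 3
      from root_expansion[OF this] obtain n :: "'i \<Rightarrow> nat" where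
        "(\<forall>h\<in>H. a h = (\<Sum>i\<in>I. of_nat (n i) * simple_root i h)) \<or>
         (\<forall>h\<in>H. a h = - (\<Sum>i\<in>I. of_nat (n i) * simple_root i h))"
        by (rule exE)
      then show ?thesis
      proof
        assume "\<forall>h\<in>H. a h = (\<Sum>i\<in>I. of_nat (n i) * simple_root i h)"
        then show ?thesis using pos[of n] by (subst root_space_cong) auto
      next
        assume "\<forall>h\<in>H. a h = - (\<Sum>i\<in>I. of_nat (n i) * simple_root i h)"
        then show ?thesis using pos[of n] by (subst root_space_cong) auto
      qed
    qed
  qed
  then have "span (\<Union>a\<in>dual_space H. root_space H a) \<subseteq> P"
    by (intro span_minimal[OF _ P(1)]) blast
  then show ?thesis using root_space_decomposition by blast
qed

end


section \<open>Irreducible highest weight modules\<close>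

locale highest_weight_module =
  cartan_type scale bracket H I simple_root simple_coroot C \<rho> +
  lie_module scale bracket scaleV M act
  for scale :: "complex \<Rightarrow> 'g::ab_group_add \<Rightarrow> 'g" and bracket :: "'g \<Rightarrow> 'g \<Rightarrow> 'g"
    and H :: "'g set" and I :: "'i set"
    and simple_root :: "'i \<Rightarrow> 'g \<Rightarrow> complex" and simple_coroot :: "'i \<Rightarrow> 'g"
    and C :: "'i \<Rightarrow> 'i \<Rightarrow> int" and \<rho> :: 'g
    and scaleV :: "complex \<Rightarrow> 'v::ab_group_add \<Rightarrow> 'v" and M :: "'v set" and act :: "'g \<Rightarrow> 'v \<Rightarrow> 'v" +
  fixes lam :: "'g \<Rightarrow> complex" and v :: 'v
  assumes irreducible: irreducible_module
    and lam_dominant: "lam \<in> dominant_weights"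
    and v_weight: "v \<in> weight_space H lam"
    and v_nonzero: "v \<noteq> 0"
    and v_killed: "a \<in> positive_roots \<Longrightarrow> x \<in> root_space H a \<Longrightarrow> act x v = 0"
begin

abbreviation E :: "'i \<Rightarrow> 'v \<Rightarrow> 'v" where "E p \<equiv> act (e p)"
abbreviation F :: "'i \<Rightarrow> 'v \<Rightarrow> 'v" where "F p \<equiv> act (f p)"

definition word :: "'i list \<Rightarrow> 'v \<Rightarrow> 'v" where
  "word ps u = foldr F ps u"

definition word_weight :: "('g \<Rightarrow> complex) \<Rightarrow> 'i list \<Rightarrow> 'g \<Rightarrow> complex" where
  "word_weight \<nu> ps h = \<nu> h - (\<Sum>q\<leftarrow>ps. simple_root q h)"

lemma word_simps [simp]: "word [] u = u" "word (p # ps) u = F p (word ps u)"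
  by (simp_all add: word_def)

lemma lam_dual: "lam \<in> dual_space H"
  using lam_dominant unfolding dominant_weights_def weight_lattice_def by blast

lemma H_act: "u \<in> weight_space H \<nu> \<Longrightarrow> h \<in> H \<Longrightarrow> act h u = scaleV (\<nu> h) u"
  unfolding weight_space_def by blast

lemma v_in_carrier: "v \<in> M"
  using v_weight by (rule weight_space_carrier)

lemma root_space_act:
  assumes "x \<in> root_space H a" "u \<in> weight_space H \<nu>" "\<And>h. h \<in> H \<Longrightarrow> \<kappa> h = \<nu> h + a h"
  shows "act x u \<in> weight_space H \<kappa>"
proof -
  have u: "u \<in> M" using assms(2) by (rule weight_space_carrier)
  have "act h (act x u) = scaleV (\<kappa> h) (act x u)" if h: "h \<in> H" for h
  proof -
    have "act h (act x u) = act (bracket h x) u + act x (act h u)"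
      using bracket_act[OF u, of h x] by simp
    also have "\<dots> = scaleV (a h) (act x u) + scaleV (\<nu> h) (act x u)"
      using assms(1) h u H_act[OF assms(2) h] by (simp add: root_space_def scale_act act_scale)
    finally show ?thesis using assms(3)[OF h] by (simp add: V.scale_left_distrib)
  qed
  then show ?thesis using u act_closed unfolding weight_space_def by blast
qed

lemma E_weight: "p \<in> I \<Longrightarrow> u \<in> weight_space H \<nu> \<Longrightarrow> E p u \<in> weight_space H (\<lambda>h. \<nu> h + simple_root p h)"
  using root_space_act[OF e_root_space] by simp

lemma F_weight: "p \<in> I \<Longrightarrow> u \<in> weight_space H \<nu> \<Longrightarrow> F p u \<in> weight_space H (\<lambda>h. \<nu> h - simple_root p h)"
  using root_space_act[OF f_root_space] by simp

lemma E_F_same: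
  assumes "p \<in> I" "u \<in> weight_space H \<nu>"
  shows "E p (F p u) = F p (E p u) + scaleV (\<nu> (simple_coroot p)) u"
  using bracket_act[OF weight_space_carrier[OF assms(2)], of "e p" "f p"]
    H_act[OF assms(2) simple_coroot_in_H[OF assms(1)]] bracket_e_f[OF assms(1)]
  by (simp add: algebra_simps)

lemma E_F_distinct:
  assumes "p \<in> I" "q \<in> I" "p \<noteq> q" "u \<in> M"
  shows "E p (F q u) = F q (E p u)"
  using bracket_act[OF assms(4), of "e p" "f q"] bracket_e_f_distinct[OF assms(1-3)]
    act_zero_left[OF assms(4)] by simp

lemma E_v: "p \<in> I \<Longrightarrow> E p v = 0"
proof -
  assume p: "p \<in> I"
  have "(\<Sum>q\<in>I. of_nat (if q = p then 1 else 0) * simple_root q h) = simple_root p h" for h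
  proof -
    have "(\<Sum>q\<in>I. of_nat (if q = p then 1 else 0) * simple_root q h) = (\<Sum>q\<in>{p}. simple_root q h)"
      by (rule sum.mono_neutral_cong_right) (use p finite_index in auto)
    then show ?thesis by simp
  qed
  then have "root_le (\<lambda>_. 0) (simple_root p)"
    unfolding root_le_def by (intro exI[of _ "\<lambda>q. if q = p then 1 else 0"]) simp
  then have "simple_root p \<in> positive_roots"
    using simple_root_root p unfolding positive_roots_def by blast
  then show ?thesis using v_killed e_root_space p by blast
qed

lemma word_weight_space:
  assumes "u \<in> weight_space H \<nu>" "set ps \<subseteq> I"
  shows "word ps u \<in> weight_space H (word_weight \<nu> ps)"
  using assms(2)
proof (induction ps)
  case Nil
  then show ?case using assms(1) by (simp add: word_weight_def[abs_def])
next
  case (Cons p ps)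
  have "word_weight \<nu> (p # ps) = (\<lambda>h. word_weight \<nu> ps h - simple_root p h)"
    by (rule ext) (simp add: word_weight_def)
  then show ?case using F_weight[of p "word ps u"] Cons by simp
qed

lemma word_weight_dual: "\<nu> \<in> dual_space H \<Longrightarrow> set ps \<subseteq> I \<Longrightarrow> word_weight \<nu> ps \<in> dual_space H"
proof (induction ps)
  case Nil
  then show ?case by (simp add: word_weight_def[abs_def])
next
  case (Cons p ps)
  have "word_weight \<nu> (p # ps) = (\<lambda>h. word_weight \<nu> ps h - simple_root p h)"
    by (rule ext) (simp add: word_weight_def)
  then show ?case using Cons dual_space_diff simple_root_dual by simp
qed

lemma word_weight_\<rho>: "set ps \<subseteq> I \<Longrightarrow> word_weight \<nu> ps \<rho> = \<nu> \<rho> - of_nat (length ps)"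
  by (induction ps) (auto simp: word_weight_def simple_root_\<rho>)

lemma V_span_minimal_carrier: "B \<subseteq> M \<Longrightarrow> V.span B \<subseteq> M"
  using V.span_minimal subspace_carrier by blast

lemma act_span:
  assumes "B \<subseteq> M" "V.subspace N" "\<And>b. b \<in> B \<Longrightarrow> act x b \<in> N" "u \<in> V.span B"
  shows "act x u \<in> N"
proof -
  have "u \<in> M \<and> act x u \<in> N"
    using assms(4)
  proof (induction rule: V.span_induct_alt)
    case base
    then show ?case using zero_in_carrier V.subspace_0[OF assms(2)] by simp
  next
    case (step c b y)
    then have "b \<in> M" "act x b \<in> N" using assms(1,3) by auto
    then show ?case
      using step V.subspace_add[OF assms(2)] V.subspace_scale[OF assms(2)]
      by (simp add: act_add act_scale add_in_carrier scale_in_carrier)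
  qed
  then show ?thesis ..
qed

text \<open>The span of the lowering words of a singular vector is stable under the generators of
  the Lie algebra, hence a submodule.\<close>

lemma span_words:
  assumes u: "u \<in> weight_space H \<nu>" "u \<noteq> 0" and sing: "\<And>p. p \<in> I \<Longrightarrow> E p u = 0"
  shows "V.span {word ps u |ps. set ps \<subseteq> I} = M"
proof -
  let ?W = "{word ps u |ps. set ps \<subseteq> I}"
  let ?N = "V.span ?W"
  have wM: "word ps u \<in> M" if "set ps \<subseteq> I" for ps
    using word_weight_space[OF u(1) that] by (rule weight_space_carrier)
  then have WM: "?W \<subseteq> M" by blast
  have NM: "?N \<subseteq> M" using WM by (rule V_span_minimal_carrier)
  have wN: "word ps u \<in> ?N" if "set ps \<subseteq> I" for ps
    using that by (intro V.span_base) blast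
  let ?P = "{x. \<forall>w\<in>?N. act x w \<in> ?N}"
  have intro_P: "x \<in> ?P" if "\<And>ps. set ps \<subseteq> I \<Longrightarrow> act x (word ps u) \<in> ?N" for x
    using act_span[OF WM V.subspace_span, of x] that by blast
  have "?P = UNIV"
  proof (rule generation)
    show "subspace ?P"
    proof (rule subspaceI)
      show "0 \<in> ?P" using NM act_zero_left V.span_zero by auto
      show "x + y \<in> ?P" if "x \<in> ?P" "y \<in> ?P" for x y
        using that NM add_act V.span_add by fastforce
      show "scale c x \<in> ?P" if "x \<in> ?P" for c x
        using that NM scale_act V.span_scale by fastforce
    qed
    show "H \<subseteq> ?P"
    proof
      fix h assume h: "h \<in> H"
      show "h \<in> ?P"
      proof (rule intro_P)
        fix ps assume ps: "set ps \<subseteq> I"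
        show "act h (word ps u) \<in> ?N"
          using H_act[OF word_weight_space[OF u(1) ps] h] V.span_scale[OF wN[OF ps]] by simp
      qed
    qed
    show "f p \<in> ?P" if "p \<in> I" for p
    proof (rule intro_P)
      fix ps assume "set ps \<subseteq> I"
      then show "F p (word ps u) \<in> ?N" using wN[of "p # ps"] that by simp
    qed
    then have FN: "F p w \<in> ?N" if "p \<in> I" "w \<in> ?N" for p w using that by blast
    show "e p \<in> ?P" if p: "p \<in> I" for p
    proof (rule intro_P)
      fix ps assume "set ps \<subseteq> I"
      then show "E p (word ps u) \<in> ?N"
      proof (induction ps)
        case Nil
        then show ?case using sing p V.span_zero by simp
      next
        case (Cons q ps)
        then have q: "q \<in> I" "set ps \<subseteq> I" and IH: "E p (word ps u) \<in> ?N" by auto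
        show ?case
        proof (cases "p = q")
          case True
          then show ?thesis
            using E_F_same[OF p word_weight_space[OF u(1) q(2)]] FN[OF p IH] wN[OF q(2)]
              V.span_add V.span_scale by simp
        next
          case False
          then show ?thesis using E_F_distinct[OF p q(1) _ wM[OF q(2)]] FN[OF q(1) IH] by simp
        qed
      qed
    qed
    show "bracket x y \<in> ?P" if "x \<in> ?P" "y \<in> ?P" for x y
    proof -
      have "act (bracket x y) w \<in> ?N" if "w \<in> ?N" for w
        using \<open>x \<in> ?P\<close> \<open>y \<in> ?P\<close> that bracket_act[of w x y] NM V.span_diff by auto
      then show ?thesis by blast
    qed
  qed
  then have "submodule ?N"
    unfolding submodule_def using NM V.subspace_span by blast
  moreover have "?N \<noteq> {0}" using wN[of "[]"] u(2) by auto
  ultimately show ?thesis using irreducible unfolding irreducible_module_def by blast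
qed

text \<open>Grouping the words by weight writes \<open>w\<close> as a sum of weight vectors, of
  which only the part of weight \<open>\<kappa>\<close> can survive.\<close>

lemma weight_space_words_of:
  assumes u: "u \<in> weight_space H \<nu>" "u \<noteq> 0" and sing: "\<And>p. p \<in> I \<Longrightarrow> E p u = 0"
    and dual: "\<nu> \<in> dual_space H" "\<kappa> \<in> dual_space H"
  shows "weight_space H \<kappa> \<subseteq> V.span {word ps u |ps. set ps \<subseteq> I \<and> word_weight \<nu> ps = \<kappa>}"
proof
  fix w assume w: "w \<in> weight_space H \<kappa>"
  let ?S = "\<lambda>a. V.span {word ps u |ps. set ps \<subseteq> I \<and> word_weight \<nu> ps = a}"
  have sub: "?S a \<subseteq> weight_space H a" for a
    using word_weight_space[OF u(1)] by (intro V.span_minimal[OF _ subspace_weight_space]) blast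
  have "{word ps u |ps. set ps \<subseteq> I} \<subseteq> (\<Union>a\<in>dual_space H. ?S a)"
  proof clarify
    fix ps assume ps: "set ps \<subseteq> I"
    then have "word ps u \<in> ?S (word_weight \<nu> ps)" by (intro V.span_base) blast
    then show "word ps u \<in> (\<Union>a\<in>dual_space H. ?S a)"
      using word_weight_dual[OF dual(1) ps] by (rule UN_I[rotated])
  qed
  then have "V.span {word ps u |ps. set ps \<subseteq> I} \<subseteq> V.span (\<Union>a\<in>dual_space H. ?S a)"
    by (rule V.span_mono)
  moreover have "w \<in> V.span {word ps u |ps. set ps \<subseteq> I}"
    using span_words[OF u sing] weight_space_carrier[OF w] by simp
  ultimately have "w \<in> V.span (\<Union>a\<in>dual_space H. ?S a)" by (rule subsetD)
  then obtain A y where A: "finite A" "A \<subseteq> dual_space H" "\<And>a. a \<in> A \<Longrightarrow> y a \<in> ?S a" "w = (\<Sum>a\<in>A. y a)"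
    by (rule V.span_Union_subspacesE) auto
  \<comment> \<open>The grouped sum minus \<open>w\<close>, as one family over
    \<open>insert \<kappa> A\<close>, because \<open>\<kappa>\<close> may be missing from
    \<open>A\<close>.\<close>
  let ?y = "\<lambda>a. (if a \<in> A then y a else 0) - (if a = \<kappa> then w else 0)"
  have "\<forall>a\<in>insert \<kappa> A. ?y a = 0"
  proof (rule weight_vectors_sum_eq_0[where wt = "\<lambda>a. a" and H = H])
    show "finite (insert \<kappa> A)" using A(1) by simp
    show "?y a \<in> weight_space H a" if "a \<in> insert \<kappa> A" for a
      using that w A(3)[of a] sub[of a] V.subspace_diff[OF subspace_weight_space]
        V.subspace_0[OF subspace_weight_space] by (auto simp: V.subspace_neg[OF subspace_weight_space])
    show "\<exists>h\<in>H. a h \<noteq> b h" if "a \<in> insert \<kappa> A" "b \<in> insert \<kappa> A" "a \<noteq> b" for a b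
      using that dual_space_eqI[of a b] dual(2) A(2) by blast
    have "(\<Sum>a\<in>insert \<kappa> A. ?y a) = (\<Sum>a\<in>insert \<kappa> A. if a \<in> A then y a else 0) - (\<Sum>a\<in>insert \<kappa> A. if a = \<kappa> then w else 0)"
      by (rule sum_subtractf)
    also have "(\<Sum>a\<in>insert \<kappa> A. if a \<in> A then y a else 0) = (\<Sum>a\<in>A. y a)"
      by (rule sum.mono_neutral_cong_right) (use A(1) in auto)
    also have "(\<Sum>a\<in>insert \<kappa> A. if a = \<kappa> then w else 0) = w"
      using A(1) by (subst sum.delta) auto
    finally show "(\<Sum>a\<in>insert \<kappa> A. ?y a) = 0" using A(4) by simp
  qed
  then have "w = (if \<kappa> \<in> A then y \<kappa> else 0)" by simp
  then show "w \<in> ?S \<kappa>" using A(3)[of \<kappa>] V.span_zero by auto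
qed

lemma weight_space_words:
  "\<kappa> \<in> dual_space H \<Longrightarrow>
    weight_space H \<kappa> \<subseteq> V.span {word ps v |ps. set ps \<subseteq> I \<and> word_weight lam ps = \<kappa>}"
  by (rule weight_space_words_of[OF v_weight v_nonzero E_v lam_dual])

text \<open>Every simple root is 1 at \<open>\<rho>\<close>, so all words of one weight have the
  same length.\<close>

lemma finite_words: "finite {ps. set ps \<subseteq> I \<and> word_weight \<nu> ps = \<kappa>}"
proof (cases "\<exists>ps. set ps \<subseteq> I \<and> word_weight \<nu> ps = \<kappa>")
  case True
  then obtain qs where qs: "set qs \<subseteq> I" "word_weight \<nu> qs = \<kappa>" by blast
  have "{ps. set ps \<subseteq> I \<and> word_weight \<nu> ps = \<kappa>} \<subseteq> {ps. set ps \<subseteq> I \<and> length ps = length qs}"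
  proof clarify
    fix ps assume "set ps \<subseteq> I" "\<kappa> = word_weight \<nu> ps"
    then have "\<nu> \<rho> - of_nat (length ps) = \<nu> \<rho> - of_nat (length qs)"
      using qs word_weight_\<rho>[of ps \<nu>] word_weight_\<rho>[of qs \<nu>] by simp
    then show "length ps = length qs" by simp
  qed
  then show ?thesis using finite_lists_length_eq[OF finite_index] finite_subset by blast
next
  case False
  then have "{ps. set ps \<subseteq> I \<and> word_weight \<nu> ps = \<kappa>} = {}" by blast
  then show ?thesis by (simp only: finite.emptyI)
qed

lemma weight_space_finite_span:
  assumes "\<kappa> \<in> dual_space H"
  shows "\<exists>B. finite B \<and> weight_space H \<kappa> \<subseteq> V.span B"
proof -
  have "{word ps v |ps. set ps \<subseteq> I \<and> word_weight lam ps = \<kappa>}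
    = (\<lambda>ps. word ps v) ` {ps. set ps \<subseteq> I \<and> word_weight lam ps = \<kappa>}" by blast
  then have "finite {word ps v |ps. set ps \<subseteq> I \<and> word_weight lam ps = \<kappa>}"
    using finite_words by simp
  then show ?thesis using weight_space_words[OF assms] by blast
qed

lemma weight_space_nonzeroE:
  assumes "\<kappa> \<in> dual_space H" "w \<in> weight_space H \<kappa>" "w \<noteq> 0"
  obtains ps where "set ps \<subseteq> I" "word_weight lam ps = \<kappa>"
proof -
  have "\<exists>ps. set ps \<subseteq> I \<and> word_weight lam ps = \<kappa>"
  proof (rule ccontr)
    assume "\<nexists>ps. set ps \<subseteq> I \<and> word_weight lam ps = \<kappa>"
    then have *: "{word ps v |ps. set ps \<subseteq> I \<and> word_weight lam ps = \<kappa>} = {}" by blast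
    show False using weight_space_words[OF assms(1)] assms(2,3) unfolding * by auto
  qed
  then show ?thesis using that by blast
qed

text \<open>By irreducibility a nonzero singular vector generates the module, so words lead from
  \<open>lam\<close> to \<open>\<kappa>\<close> and from \<open>\<kappa>\<close> back to
  \<open>lam\<close>; evaluation at \<open>\<rho>\<close> shows that they are empty.\<close>

lemma singular_vector_weight:
  assumes w: "w \<in> weight_space H \<kappa>" "\<kappa> \<in> dual_space H" "w \<noteq> 0" and sing: "\<And>p. p \<in> I \<Longrightarrow> E p w = 0"
  shows "\<kappa> = lam"
proof -
  obtain ps where ps: "set ps \<subseteq> I" "word_weight lam ps = \<kappa>"
    using weight_space_nonzeroE[OF w(2,1,3)] by blast
  have "{word qs w |qs. set qs \<subseteq> I \<and> word_weight \<kappa> qs = lam} \<noteq> {}"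
  proof
    assume *: "{word qs w |qs. set qs \<subseteq> I \<and> word_weight \<kappa> qs = lam} = {}"
    show False
      using weight_space_words_of[OF w(1,3) sing w(2) lam_dual] v_weight v_nonzero unfolding * by auto
  qed
  then obtain qs where qs: "set qs \<subseteq> I" "word_weight \<kappa> qs = lam" by blast
  have "\<kappa> \<rho> = lam \<rho> - of_nat (length ps)" "lam \<rho> = \<kappa> \<rho> - of_nat (length qs)"
    using ps qs word_weight_\<rho>[of ps lam] word_weight_\<rho>[of qs \<kappa>] by auto
  then have "of_nat (length ps + length qs) = (0 :: complex)" unfolding of_nat_add by algebra
  then have "ps = []" unfolding of_nat_eq_0_iff by simp
  then show ?thesis using ps(2) by (simp add: word_weight_def[abs_def])
qed

section \<open>Local nilpotency of the simple raising and lowering operators\<close>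

lemma F_pow_weight:
  "p \<in> I \<Longrightarrow> u \<in> weight_space H \<nu> \<Longrightarrow> (F p ^^ r) u \<in> weight_space H (\<lambda>h. \<nu> h - of_nat r * simple_root p h)"
proof (induction r)
  case (Suc r)
  have "(\<lambda>h. \<nu> h - of_nat (Suc r) * simple_root p h)
    = (\<lambda>h. \<nu> h - of_nat r * simple_root p h - simple_root p h)"
    by (rule ext) (simp add: algebra_simps)
  then show ?case using F_weight[OF Suc.prems(1) Suc.IH] Suc.prems by simp
qed simp

lemma E_F_pow:
  assumes p: "p \<in> I" and u: "u \<in> weight_space H \<nu>" "E p u = 0"
  shows "E p ((F p ^^ Suc r) u)
    = scaleV (of_nat (Suc r) * (\<nu> (simple_coroot p) - of_nat r)) ((F p ^^ r) u)"
proof (induction r)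
  case 0
  then show ?case using E_F_same[OF p u(1)] u(2) by simp
next
  case (Suc r)
  let ?y = "(F p ^^ Suc r) u" and ?l = "\<nu> (simple_coroot p)"
  have "E p (F p ?y) = F p (E p ?y)
    + scaleV (?l - of_nat (Suc r) * simple_root p (simple_coroot p)) ?y"
    by (rule E_F_same[OF p F_pow_weight[OF p u(1)]])
  also have "F p (E p ?y) = scaleV (of_nat (Suc r) * (?l - of_nat r)) ?y"
    unfolding Suc.IH
    using act_scale[OF weight_space_carrier[OF F_pow_weight[OF p u(1)]]] by simp
  finally have "E p (F p ?y) = scaleV (of_nat (Suc r) * (?l - of_nat r) +
      (?l - of_nat (Suc r) * simple_root p (simple_coroot p))) ?y"
    by (simp only: V.scale_left_distrib)
  also have "of_nat (Suc r) * (?l - of_nat r) + (?l - of_nat (Suc r) * simple_root p (simple_coroot p))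
    = of_nat (Suc (Suc r)) * (?l - of_nat (Suc r))"
    using simple_root_coroot_self[OF p] by (simp add: algebra_simps)
  finally show ?case by simp
qed

lemma F_pow_nonzero:
  assumes p: "p \<in> I" and u: "u \<in> weight_space H \<nu>" "E p u = 0" "u \<noteq> 0"
    and n: "\<nu> (simple_coroot p) = of_nat n" "r \<le> n"
  shows "(F p ^^ r) u \<noteq> 0"
  using n(2)
proof (induction r)
  case (Suc r)
  have "of_nat n - of_nat r \<noteq> (0 :: complex)" using Suc.prems by simp
  then have "E p ((F p ^^ Suc r) u) \<noteq> 0"
    using E_F_pow[OF p u(1,2), of r] n(1) Suc by (simp del: of_nat_Suc)
  then show ?case by auto
qed (use u(3) in simp)

text \<open>The vector would be singular of a weight other than \<open>lam\<close>: the scalar of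
  \<open>E_F_pow\<close> vanishes at \<open>r = k\<close>, and the other raising operators commute
  with \<open>F p\<close> and kill \<open>v\<close>.\<close>

lemma F_pow_v_eq_0:
  assumes p: "p \<in> I" and k: "lam (simple_coroot p) = of_nat k"
  shows "(F p ^^ Suc k) v = 0"
proof (rule ccontr)
  let ?w = "(F p ^^ Suc k) v"
  let ?\<kappa> = "\<lambda>h. lam h - of_nat (Suc k) * simple_root p h"
  assume "?w \<noteq> 0"
  moreover have "?w \<in> weight_space H ?\<kappa>" by (rule F_pow_weight[OF p v_weight])
  moreover have "?\<kappa> \<in> dual_space H"
    using dual_space_diff[OF lam_dual dual_space_scale[OF simple_root_dual[OF p]]] by blast
  moreover have "E q ?w = 0" if q: "q \<in> I" for q
  proof (cases "q = p")
    case True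
    then show ?thesis using E_F_pow[OF p v_weight E_v[OF p], of k] k by simp
  next
    case False
    have "E q ((F p ^^ r) v) = 0" for r
    proof (induction r)
      case 0
      then show ?case using E_v[OF q] by simp
    next
      case (Suc r)
      then show ?case
        using E_F_distinct[OF q p False weight_space_carrier[OF F_pow_weight[OF p v_weight]]] by simp
    qed
    then show ?thesis .
  qed
  ultimately have "?\<kappa> = lam" using singular_vector_weight by blast
  then have "?\<kappa> \<rho> = lam \<rho>" by metis
  then have "of_nat (Suc k) * simple_root p \<rho> = 0" by simp
  then show False using simple_root_\<rho>[OF p] by (simp del: of_nat_Suc)
qed

lemma dominant_label:
  assumes "\<nu> \<in> dominant_weights" "p \<in> I"
  obtains k where "\<nu> (simple_coroot p) = of_nat k"
  using assms unfolding dominant_weights_def dynkin_label_def Nats_def by auto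

text \<open>The vectors on which \<open>F p\<close> is nilpotent form a submodule containing
  \<open>v\<close>, because \<open>ad (f p)\<close> is nilpotent and \<open>F p\<close> acts on
  \<open>act x u\<close> by the Leibniz rule.\<close>

lemma F_locally_nilpotent:
  assumes p: "p \<in> I" and u: "u \<in> M"
  shows "\<exists>r. (F p ^^ r) u = 0"
proof -
  let ?N = "{u \<in> M. \<exists>r. (F p ^^ r) u = 0}"
  have pow_M: "(F p ^^ r) u \<in> M" if "u \<in> M" for r u
    using that act_closed by (induction r) auto
  have pow_add: "(F p ^^ r) (u + w) = (F p ^^ r) u + (F p ^^ r) w" if "u \<in> M" "w \<in> M" for r u w
    using that act_add pow_M by (induction r) auto
  have pow_scale: "(F p ^^ r) (scaleV c u) = scaleV c ((F p ^^ r) u)" if "u \<in> M" for r c u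
    using that act_scale pow_M by (induction r) auto
  have pow_0: "(F p ^^ r) 0 = 0" for r by (induction r) auto
  have mono: "(F p ^^ (s + r)) u = 0" if "(F p ^^ r) u = 0" for r s u
    using that by (simp add: funpow_add pow_0)
  \<comment> \<open>Induction on \<open>r + n\<close>: by the Leibniz rule each application of
    \<open>F p\<close> lowers the nilpotency order of either \<open>x\<close> or \<open>u\<close> by
    one.\<close>
  have key: "(F p ^^ (r + n)) (act x u) = 0"
    if "u \<in> M" "(bracket (f p) ^^ r) x = 0" "(F p ^^ n) u = 0" for r n x u
    using that
  proof (induction "r + n" arbitrary: r n x u)
    case 0
    then show ?case by simp
  next
    case (Suc m)
    show ?case
    proof (cases "r = 0 \<or> n = 0")
      case True
      then show ?thesis
        using Suc.prems act_zero_left pow_0 by auto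
    next
      case False
      then obtain r' n' where rn: "r = Suc r'" "n = Suc n'" by (metis not0_implies_Suc)
      have 1: "(F p ^^ m) (act (bracket (f p) x) u) = 0"
        using Suc.hyps(1)[of r' n u "bracket (f p) x"] Suc.hyps(2) Suc.prems rn
        by (simp add: funpow_swap1)
      have 2: "(F p ^^ m) (act x (F p u)) = 0"
        using Suc.hyps(1)[of r n' "F p u" x] Suc.hyps(2) Suc.prems rn act_closed
        by (simp add: funpow_swap1)
      have "(F p ^^ Suc m) (act x u) = (F p ^^ m) (F p (act x u))"
        by (simp only: funpow_Suc_right o_apply)
      also have "F p (act x u) = act (bracket (f p) x) u + act x (F p u)"
        using bracket_act[OF Suc.prems(1), of "f p" x] by simp
      finally show ?thesis
        using 1 2 pow_add act_closed Suc.prems(1) Suc.hyps(2) by simp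
    qed
  qed
  have sub: "submodule ?N"
    unfolding submodule_def
  proof (intro conjI allI ballI)
    show "V.subspace ?N"
    proof (rule V.subspaceI)
      show "0 \<in> ?N" using zero_in_carrier by (auto intro: exI[of _ 0])
      show "x + y \<in> ?N" if xy: "x \<in> ?N" "y \<in> ?N" for x y
      proof -
        obtain r s where "(F p ^^ r) x = 0" "(F p ^^ s) y = 0" using xy by blast
        then have "(F p ^^ (r + s)) (x + y) = 0"
          using mono[of s y r] mono[of r x s] xy by (simp add: pow_add add.commute)
        then show ?thesis using xy add_in_carrier by blast
      qed
      show "scaleV c x \<in> ?N" if "x \<in> ?N" for c x
        using that pow_scale scale_in_carrier by fastforce
    qed
    show "?N \<subseteq> M" by blast
    show "act x w \<in> ?N" if w: "w \<in> ?N" for x w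
    proof -
      obtain n where n: "(F p ^^ n) w = 0" using w by blast
      have "bracket (simple_coroot p) (f p) = scale (-2) (f p)"
        using bracket_H_f[OF simple_coroot_in_H[OF p] p] simple_root_coroot_self[OF p] by simp
      from ad_nilpotent[OF simple_coroot_in_H[OF p] this]
      obtain r where r: "(bracket (f p) ^^ r) x = 0" by auto
      show ?thesis using key[OF _ r n] w act_closed by blast
    qed
  qed
  obtain k where k: "lam (simple_coroot p) = of_nat k"
    using dominant_label[OF lam_dominant p] .
  have "v \<in> ?N" using F_pow_v_eq_0[OF p k] v_in_carrier by blast
  then have "?N \<noteq> {0}" using v_nonzero by blast
  then have "?N = M" using sub irreducible unfolding irreducible_module_def by blast
  then show ?thesis using u by blast
qed

text \<open>Raising increases the value at \<open>\<rho>\<close> by one, and for weights of the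
  module this value is bounded by that of \<open>lam\<close>.\<close>

lemma E_locally_nilpotent:
  assumes p: "p \<in> I" and \<kappa>: "\<kappa> \<in> dual_space H" and u: "u \<in> weight_space H \<kappa>"
  shows "\<exists>r. (E p ^^ r) u = 0"
proof (rule ccontr)
  assume n: "\<nexists>r. (E p ^^ r) u = 0"
  have ws: "(E p ^^ r) u \<in> weight_space H (\<lambda>h. \<kappa> h + of_nat r * simple_root p h)" for r
  proof (induction r)
    case (Suc r)
    have "(\<lambda>h. \<kappa> h + of_nat (Suc r) * simple_root p h)
      = (\<lambda>h. \<kappa> h + of_nat r * simple_root p h + simple_root p h)"
      by (rule ext) (simp add: algebra_simps)
    then show ?case using E_weight[OF p Suc.IH] by simp
  qed (use u in simp)
  obtain r :: nat where r: "Re (lam \<rho>) - Re (\<kappa> \<rho>) < real r" using reals_Archimedean2 by blast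
  have "(\<lambda>h. \<kappa> h + of_nat r * simple_root p h) \<in> dual_space H"
    using dual_space_add[OF \<kappa> dual_space_scale[OF simple_root_dual[OF p]]] by blast
  then obtain ps where ps: "set ps \<subseteq> I" "word_weight lam ps = (\<lambda>h. \<kappa> h + of_nat r * simple_root p h)"
    using weight_space_nonzeroE[OF _ ws[of r]] n by blast
  have "lam \<rho> - of_nat (length ps) = \<kappa> \<rho> + of_nat r"
    using word_weight_\<rho>[OF ps(1), of lam] unfolding ps(2) simple_root_\<rho>[OF p] by simp
  then have "Re (lam \<rho> - of_nat (length ps)) = Re (\<kappa> \<rho> + of_nat r)" by simp
  then show False using r by simp
qed

section \<open>Joint kernels: highest weight vectors for Levi subalgebras\<close>

definition joint_kernel :: "'i set \<Rightarrow> ('g \<Rightarrow> complex) \<Rightarrow> 'v set" where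
  "joint_kernel Q \<kappa> = {u \<in> weight_space H \<kappa>. \<forall>q\<in>Q. E q u = 0}"

lemma joint_kernel_empty [simp]: "joint_kernel {} \<kappa> = weight_space H \<kappa>"
  by (simp add: joint_kernel_def)

lemma subspace_joint_kernel: "V.subspace (joint_kernel Q \<kappa>)"
  using V.subspace_add[OF subspace_weight_space[of H \<kappa>]] V.subspace_scale[OF subspace_weight_space[of H \<kappa>]]
    V.subspace_0[OF subspace_weight_space[of H \<kappa>]] weight_space_carrier[of _ H \<kappa>]
  by (intro V.subspaceI) (auto simp: joint_kernel_def act_add act_scale)

lemma E_commute:
  assumes "p \<in> I" "q \<in> I" "p \<noteq> q" "C p q = 0" "u \<in> M"
  shows "E p (E q u) = E q (E p u)"
  using serre_e[of p q 0] cartan_integer[of p q] assms bracket_act[of u "e p" "e q"]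
    act_zero_left[of u] by simp

lemma F_commute:
  assumes "p \<in> I" "q \<in> I" "p \<noteq> q" "C p q = 0" "u \<in> M"
  shows "F p (F q u) = F q (F p u)"
  using serre_f[of p q 0] cartan_integer[of p q] assms bracket_act[of u "f p" "f q"]
    act_zero_left[of u] by simp

lemma E_serre:
  assumes "p \<in> I" "q \<in> I" "p \<noteq> q" "C p q = -1" "u \<in> M"
  shows "E p (E p (E q u)) + E q (E p (E p u)) = scaleV 2 (E p (E q (E p u)))"
proof -
  have "bracket (e p) (bracket (e p) (e q)) = 0"
    using serre_e[of p q 1] cartan_integer[of p q] assms by simp
  then have "0 = act (bracket (e p) (bracket (e p) (e q))) u"
    using act_zero_left assms(5) by simp
  also have "\<dots> = E p (E p (E q u) - E q (E p u)) - (E p (E q (E p u)) - E q (E p (E p u)))"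
    using assms(5) by (simp add: bracket_act act_closed)
  also have "\<dots> = E p (E p (E q u)) + E q (E p (E p u)) - (E p (E q (E p u)) + E p (E q (E p u)))"
    using assms(5) by (simp add: act_diff act_closed algebra_simps)
  finally have "E p (E p (E q u)) + E q (E p (E p u)) = E p (E q (E p u)) + E p (E q (E p u))" by simp
  also have "\<dots> = scaleV (1 + 1) (E p (E q (E p u)))" unfolding V.scale_left_distrib by simp
  finally show ?thesis by simp
qed

text \<open>The raising operators of nodes orthogonal to \<open>p\<close> commute with both
  \<open>E p\<close> and \<open>F p\<close>, so their joint kernels are stable under the sl2 of
  \<open>p\<close>.\<close>

lemma joint_kernel_string:
  assumes p: "p \<in> I" and Q: "\<And>q. q \<in> Q \<Longrightarrow> q \<in> I \<and> q \<noteq> p \<and> C p q = 0"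
    and \<kappa>: "\<kappa> \<in> dual_space H" "\<kappa> (simple_coroot p) = of_int m"
  shows "sl2_string scaleV (\<lambda>n. joint_kernel Q (\<lambda>h. \<kappa> h + of_int n * simple_root p h)) (E p) (F p) m"
proof
  fix n u w c
  let ?\<kappa> = "\<lambda>n h. \<kappa> h + of_int n * simple_root p h"
  have dual: "?\<kappa> n \<in> dual_space H"
    using dual_space_add[OF \<kappa>(1) dual_space_scale[OF simple_root_dual[OF p]]] by blast
  show "V.subspace (joint_kernel Q (?\<kappa> n))" by (rule subspace_joint_kernel)
  assume u: "u \<in> joint_kernel Q (?\<kappa> n)"
  then have ws: "u \<in> weight_space H (?\<kappa> n)" and uM: "u \<in> M" and uQ: "\<And>q. q \<in> Q \<Longrightarrow> E q u = 0"
    unfolding joint_kernel_def using weight_space_carrier by auto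
  have "?\<kappa> (n + 1) = (\<lambda>h. ?\<kappa> n h + simple_root p h)" "?\<kappa> (n - 1) = (\<lambda>h. ?\<kappa> n h - simple_root p h)"
    by (rule ext, simp add: algebra_simps)+
  then have "E p u \<in> weight_space H (?\<kappa> (n + 1))" "F p u \<in> weight_space H (?\<kappa> (n - 1))"
    using E_weight[OF p ws] F_weight[OF p ws] by simp_all
  moreover have "E q (E p u) = 0" "E q (F p u) = 0" if "q \<in> Q" for q
    using E_commute[of p q u] E_F_distinct[of q p u] Q[OF that] uQ[OF that] p uM by auto
  ultimately show "E p u \<in> joint_kernel Q (?\<kappa> (n + 1))" "F p u \<in> joint_kernel Q (?\<kappa> (n - 1))"
    unfolding joint_kernel_def by auto
  show "E p (scaleV c u) = scaleV c (E p u)" "F p (scaleV c u) = scaleV c (F p u)"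
    using act_scale uM by auto
  show "\<exists>r. (E p ^^ r) u = 0" using E_locally_nilpotent[OF p dual ws] .
  show "\<exists>r. (F p ^^ r) u = 0" using F_locally_nilpotent[OF p uM] .
  show "E p (F p u) - F p (E p u) = scaleV (of_int (m + 2 * n)) u"
    using E_F_same[OF p ws] \<kappa>(2) simple_root_coroot_self[OF p] by (simp add: mult.commute)
  assume "w \<in> joint_kernel Q (?\<kappa> n)"
  then have "w \<in> M" unfolding joint_kernel_def using weight_space_carrier by auto
  then show "E p (u + w) = E p u + E p w" "F p (u + w) = F p u + F p w"
    using act_add uM by auto
qed

lemma joint_kernel_finite_span:
  assumes "\<kappa> \<in> dual_space H"
  shows "\<exists>B. finite B \<and> joint_kernel Q \<kappa> \<subseteq> V.span B"
  using weight_space_finite_span[OF assms] unfolding joint_kernel_def by blast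

text \<open>The single step of inclusion-exclusion. It works from label -1 upwards, since the weight
  one \<open>p\<close>-root higher then has positive label.\<close>

lemma dim_joint_kernel:
  assumes p: "p \<in> I" and Q: "\<And>q. q \<in> Q \<Longrightarrow> q \<in> I \<and> q \<noteq> p \<and> C p q = 0"
    and \<kappa>: "\<kappa> \<in> dual_space H" "\<kappa> (simple_coroot p) = of_int m" "m + 2 > 0"
  shows "V.dim (joint_kernel Q \<kappa>)
    = V.dim (joint_kernel Q (\<lambda>h. \<kappa> h + simple_root p h)) + V.dim (joint_kernel (insert p Q) \<kappa>)"
proof -
  interpret st: sl2_string scaleV "\<lambda>n. joint_kernel Q (\<lambda>h. \<kappa> h + of_int n * simple_root p h)" "E p" "F p" m
    using p Q \<kappa>(1,2) by (rule joint_kernel_string)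
  obtain B where "finite B" "joint_kernel Q \<kappa> \<subseteq> V.span B" using joint_kernel_finite_span[OF \<kappa>(1)] by blast
  then have "V.dim (joint_kernel Q \<kappa>) = V.dim (joint_kernel Q (\<lambda>h. \<kappa> h + simple_root p h))
    + V.dim {x \<in> joint_kernel Q \<kappa>. E p x = 0}"
    using st.dim_E_kernel[of B 0] \<kappa>(3) by simp
  moreover have "{x \<in> joint_kernel Q \<kappa>. E p x = 0} = joint_kernel (insert p Q) \<kappa>"
    unfolding joint_kernel_def by auto
  ultimately show ?thesis by simp
qed

lemma dim_weight_space_reflect:
  assumes p: "p \<in> I" and \<kappa>: "\<kappa> \<in> dual_space H" "\<kappa> (simple_coroot p) = of_int m"
  shows "V.dim (weight_space H (\<lambda>h. \<kappa> h - of_int m * simple_root p h)) = V.dim (weight_space H \<kappa>)"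
proof -
  interpret st: sl2_string scaleV "\<lambda>n. joint_kernel {} (\<lambda>h. \<kappa> h + of_int n * simple_root p h)" "E p" "F p" m
    using p _ \<kappa> by (rule joint_kernel_string) simp
  have fin: "\<exists>B. finite B \<and> joint_kernel {} (\<lambda>h. \<kappa> h + of_int n * simple_root p h) \<subseteq> V.span B" for n
    using joint_kernel_finite_span dual_space_add[OF \<kappa>(1) dual_space_scale[OF simple_root_dual[OF p]]] by blast
  have "V.dim (joint_kernel {} (\<lambda>h. \<kappa> h + of_int (- m - 0) * simple_root p h)) = V.dim (joint_kernel {} (\<lambda>h. \<kappa> h + of_int 0 * simple_root p h))"
    by (rule st.dim_reflect[OF fin])
  then show ?thesis by simp
qed

lemma dim_weight_space_eq_0:
  "\<kappa> \<in> dual_space H \<Longrightarrow> V.dim (weight_space H \<kappa>) = 0 \<longleftrightarrow> weight_space H \<kappa> = {0}"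
  using weight_space_finite_span V.dim_eq_0_subspace subspace_weight_space by blast

lemma weight_space_down:
  assumes p: "p \<in> I" and \<kappa>: "\<kappa> \<in> dual_space H" "\<kappa> (simple_coroot p) = of_int m" "m > 0"
    and "weight_space H \<kappa> \<noteq> {0}"
  shows "weight_space H (\<lambda>h. \<kappa> h - simple_root p h) \<noteq> {0}"
proof -
  interpret st: sl2_string scaleV "\<lambda>n. joint_kernel {} (\<lambda>h. \<kappa> h + of_int n * simple_root p h)" "E p" "F p" m
    using p _ \<kappa>(1,2) by (rule joint_kernel_string) simp
  obtain u where u: "u \<in> weight_space H \<kappa>" "u \<noteq> 0"
    using assms(5) V.subspace_0[OF subspace_weight_space] by blast
  then have "F p u \<noteq> 0" using st.lowest_positive_eq_0[of u 0] \<kappa>(3) by auto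
  then show ?thesis using F_weight[OF p u(1)] by blast
qed

text \<open>Walk down from \<open>\<nu> + \<Sum>q. n q * \<alpha>\<^sub>q\<close> to \<open>\<nu>\<close>, at each step subtracting a simple root whose
  label is positive, which exists by positivity and dominance.\<close>

lemma dominant_below_weight:
  assumes \<nu>: "\<nu> \<in> dominant_weights"
  shows "weight_space H (\<lambda>h. \<nu> h + (\<Sum>q\<in>I. of_nat (n q) * simple_root q h)) \<noteq> {0} \<Longrightarrow>
    weight_space H \<nu> \<noteq> {0}"
proof (induction "\<Sum>q\<in>I. n q" arbitrary: n rule: less_induct)
  case less
  have \<nu>d: "\<nu> \<in> dual_space H" using \<nu> unfolding dominant_weights_def weight_lattice_def by blast
  let ?a = "\<lambda>n h. \<Sum>q\<in>I. of_nat (n q) * simple_root q h"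
  show ?case
  proof (cases "\<exists>p\<in>I. n p > 0")
    case False
    then show ?thesis using less.prems by simp
  next
    case True
    then obtain p where p: "p \<in> I" "0 < n p" "0 < (\<Sum>q\<in>I. C p q * int (n q))"
      using positivity by blast
    let ?n = "n(p := n p - 1)"
    have a': "?a n h = ?a ?n h + simple_root p h" for h
      by (rule sum_simple_roots_decrement(1)[OF p(1), of n, OF p(2)])
    have lt: "(\<Sum>q\<in>I. ?n q) < (\<Sum>q\<in>I. n q)"
      by (rule sum_simple_roots_decrement(2)[OF p(1), of n, OF p(2)])
    obtain k where k: "\<nu> (simple_coroot p) = of_nat k" using dominant_label[OF \<nu> p(1)] .
    have lab: "\<nu> (simple_coroot p) + ?a n (simple_coroot p) = of_int (int k + (\<Sum>q\<in>I. C p q * int (n q)))"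
      using p(1) k by (simp add: cartan_integer mult.commute)
    have "(\<lambda>h. \<nu> h + ?a n h) \<in> dual_space H"
      by (intro dual_space_add[OF \<nu>d] dual_space_sum dual_space_scale simple_root_dual)
    from weight_space_down[OF p(1) this lab _ less.prems]
    have "weight_space H (\<lambda>h. \<nu> h + ?a n h - simple_root p h) \<noteq> {0}" using p(3) by simp
    moreover have "(\<lambda>h. \<nu> h + ?a n h - simple_root p h) = (\<lambda>h. \<nu> h + ?a ?n h)"
      by (rule ext) (simp add: a' del: fun_upd_apply)
    ultimately show ?thesis using less.hyps[OF lt] by simp
  qed
qed

lemma dominant_below_lam:
  assumes "\<nu> \<in> dominant_weights" "root_le \<nu> lam"
  shows "weight_space H \<nu> \<noteq> {0}"
proof -
  obtain n :: "'i \<Rightarrow> nat" where n: "\<forall>h\<in>H. lam h - \<nu> h = (\<Sum>i\<in>I. of_nat (n i) * simple_root i h)"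
    using assms(2) unfolding root_le_def by blast
  have "weight_space H (\<lambda>h. \<nu> h + (\<Sum>q\<in>I. of_nat (n q) * simple_root q h)) = weight_space H lam"
  proof (rule weight_space_cong)
    fix h assume "h \<in> H"
    then show "\<nu> h + (\<Sum>q\<in>I. of_nat (n q) * simple_root q h) = lam h"
      using n by (metis add_diff_cancel_left' diff_add_cancel add.commute)
  qed
  then show ?thesis using dominant_below_weight[OF assms(1), of n] v_weight v_nonzero by auto
qed

lemma word_weight_count:
  "set ps \<subseteq> I \<Longrightarrow> word_weight \<nu> ps h = \<nu> h - (\<Sum>q\<in>I. of_nat (count_list ps q) * simple_root q h)"
proof (induction ps)
  case (Cons p ps)
  have "(\<Sum>q\<in>I. of_nat (count_list (p # ps) q) * simple_root q h)
    = (\<Sum>q\<in>I. of_nat (count_list ps q) * simple_root q h + (if q = p then simple_root q h else 0))"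
    by (intro sum.cong) (auto simp: algebra_simps)
  also have "\<dots> = (\<Sum>q\<in>I. of_nat (count_list ps q) * simple_root q h) + simple_root p h"
    using Cons.prems finite_index by (simp add: sum.distrib sum.delta)
  finally show ?case using Cons by (simp add: word_weight_def)
qed (simp add: word_weight_def)

lemma weight_below_lam:
  assumes "\<kappa> \<in> dual_space H" "weight_space H \<kappa> \<noteq> {0}"
  shows "root_le \<kappa> lam"
proof -
  obtain u where "u \<in> weight_space H \<kappa>" "u \<noteq> 0"
    using assms(2) V.subspace_0[OF subspace_weight_space] by blast
  then obtain ps where "set ps \<subseteq> I" "word_weight lam ps = \<kappa>"
    using weight_space_nonzeroE[OF assms(1)] by blast
  then have "\<forall>h\<in>H. lam h - \<kappa> h = (\<Sum>i\<in>I. of_nat (count_list ps i) * simple_root i h)"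
    using word_weight_count[of ps lam] by auto
  then show ?thesis unfolding root_le_def by blast
qed

end


section \<open>Atomic numbers\<close>

text \<open>Substitution from the highest rank: at \<open>z\<close> only the row of \<open>z\<close>
  itself contributes, so its coefficient is \<open>G z\<close>, and subtracting that row leaves the
  same problem on \<open>D\<close>.\<close>

lemma triangular_solution:
  fixes T :: "'a \<Rightarrow> 'a \<Rightarrow> int" and r :: "'a \<Rightarrow> real"
  assumes "finite D"
    and "\<And>x. x \<in> D \<Longrightarrow> T x x = 1"
    and "\<And>x y. x \<in> D \<Longrightarrow> y \<in> D \<Longrightarrow> T x y \<noteq> 0 \<Longrightarrow> x = y \<or> r y < r x"
  shows "\<exists>a. \<forall>y\<in>D. G y = (\<Sum>x\<in>D. a x * T x y)"
  using assms
proof (induction D arbitrary: G rule: finite_ranking_induct[where f = r])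
  case empty
  then show ?case by simp
next
  case (insert z D)
  show ?case
  proof (cases "z \<in> D")
    case True
    then have "insert z D = D" by blast
    then show ?thesis using insert by metis
  next
    case False
    obtain a where a: "\<And>y. y \<in> D \<Longrightarrow> G y - G z * T z y = (\<Sum>x\<in>D. a x * T x y)"
      using insert.IH[of "\<lambda>y. G y - G z * T z y"] insert.prems by auto
    let ?a = "a(z := G z)"
    have *: "(\<Sum>x\<in>insert z D. ?a x * T x y) = G z * T z y + (\<Sum>x\<in>D. a x * T x y)" for y
    proof -
      have "(\<Sum>x\<in>D. ?a x * T x y) = (\<Sum>x\<in>D. a x * T x y)"
        using False by (intro sum.cong) auto
      then show ?thesis using False insert.hyps(1) by simp
    qed
    have "T x z = 0" if "x \<in> D" for x
      using insert.prems(2)[of x z] insert.hyps(2)[OF that] that False by force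
    then have "(\<Sum>x\<in>D. a x * T x z) = 0" by simp
    then have "\<forall>y\<in>insert z D. G y = (\<Sum>x\<in>insert z D. ?a x * T x y)"
      unfolding * using a insert.prems(1)[of z] by (auto simp: algebra_simps)
    then show ?thesis by blast
  qed
qed

locale cartan_type_modules =
  cartan_type scale bracket H I simple_root simple_coroot C \<rho> +
  irreducible_highest_weight_modules scale bracket H I simple_root simple_coroot scaleV V act
  for scale :: "complex \<Rightarrow> 'g::ab_group_add \<Rightarrow> 'g" and bracket :: "'g \<Rightarrow> 'g \<Rightarrow> 'g"
    and H :: "'g set" and I :: "'i set"
    and simple_root :: "'i \<Rightarrow> 'g \<Rightarrow> complex" and simple_coroot :: "'i \<Rightarrow> 'g"
    and C :: "'i \<Rightarrow> 'i \<Rightarrow> int" and \<rho> :: 'g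
    and scaleV :: "complex \<Rightarrow> 'v::ab_group_add \<Rightarrow> 'v"
    and V :: "('g \<Rightarrow> complex) \<Rightarrow> 'v set" and act :: "('g \<Rightarrow> complex) \<Rightarrow> 'g \<Rightarrow> 'v \<Rightarrow> 'v"
begin

abbreviation is_hw_module :: "('g \<Rightarrow> complex) \<Rightarrow> 'v \<Rightarrow> bool" where
  "is_hw_module lam \<equiv>
    highest_weight_module scale bracket H I simple_root simple_coroot C \<rho> scaleV (V lam) (act lam) lam"

lemma highest_weight_module:
  assumes lam: "lam \<in> dominant_weights"
  shows "\<exists>v. is_hw_module lam v"
proof -
  obtain v where v: "v \<in> lie_module.weight_space scaleV (V lam) (act lam) H lam" "v \<noteq> 0"
      "\<forall>a\<in>positive_roots. \<forall>x\<in>root_space H a. act lam x v = 0"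
    using highest_weight_vector[OF lam] by blast
  interpret lie_module scale bracket scaleV "V lam" "act lam" using module[OF lam] .
  have "is_hw_module lam v"
    by unfold_locales (use v irreducible[OF lam] lam in auto)
  then show ?thesis ..
qed

abbreviation wspace :: "('g \<Rightarrow> complex) \<Rightarrow> ('g \<Rightarrow> complex) \<Rightarrow> 'v set" where
  "wspace lam \<equiv> lie_module.weight_space scaleV (V lam) (act lam) H"

lemma dominant_dual: "\<kappa> \<in> dominant_weights \<Longrightarrow> \<kappa> \<in> dual_space H"
  unfolding dominant_weights_def weight_lattice_def by blast

lemma ch_eq_0_iff:
  assumes "lam \<in> dominant_weights" "\<nu> \<in> dual_space H"
  shows "ch lam \<nu> = 0 \<longleftrightarrow> wspace lam \<nu> = {0}"
proof -
  obtain v where "is_hw_module lam v"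
    using highest_weight_module[OF assms(1)] ..
  from highest_weight_module.dim_weight_space_eq_0[OF this assms(2)]
  show ?thesis unfolding ch_def by simp
qed

lemma ch_nonzero_le:
  assumes "lam \<in> dominant_weights" "\<nu> \<in> dual_space H" "ch lam \<nu> \<noteq> 0"
  shows "root_le \<nu> lam"
proof -
  obtain v where "is_hw_module lam v"
    using highest_weight_module[OF assms(1)] ..
  from highest_weight_module.weight_below_lam[OF this assms(2)]
  show ?thesis using assms(3) ch_eq_0_iff[OF assms(1,2)] by simp
qed

lemma ch_reflect:
  assumes "lam \<in> dominant_weights" "p \<in> I" "\<nu> \<in> dual_space H" "\<nu> (simple_coroot p) = of_int m"
  shows "ch lam (\<lambda>h. \<nu> h - of_int m * simple_root p h) = ch lam \<nu>"
proof -
  obtain v where "is_hw_module lam v"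
    using highest_weight_module[OF assms(1)] ..
  from highest_weight_module.dim_weight_space_reflect[OF this assms(2-4)]
  show ?thesis unfolding ch_def by simp
qed

lemma Theta_eq:
  assumes "\<kappa> \<in> dominant_weights" "\<nu> \<in> dual_space H"
  shows "Theta \<kappa> \<nu> = (if ch \<kappa> \<nu> \<noteq> 0 then 1 else 0)"
  unfolding Theta_def lie_module.weights_def[OF module[OF assms(1)]]
  using ch_eq_0_iff[OF assms] assms(2) by simp

text \<open>On dominant weights \<open>Theta\<close> is the zeta function of the root order, as
  every dominant weight below \<open>\<kappa>\<close> occurs in the module. This is what makes the
  atomic numbers a Moebius inversion of multiplicities.\<close>

lemma Theta_dominant:
  assumes "\<kappa> \<in> dominant_weights" "\<nu> \<in> dominant_weights"
  shows "Theta \<kappa> \<nu> = (if root_le \<nu> \<kappa> then 1 else 0)"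
proof -
  obtain v where "is_hw_module \<kappa> v"
    using highest_weight_module[OF assms(1)] ..
  from highest_weight_module.dominant_below_lam[OF this assms(2)]
  show ?thesis
    unfolding Theta_eq[OF assms(1) dominant_dual[OF assms(2)]]
    using ch_eq_0_iff[OF assms(1) dominant_dual[OF assms(2)]]
      ch_nonzero_le[OF assms(1) dominant_dual[OF assms(2)]] by auto
qed

lemma root_le_refl: "root_le \<nu> \<nu>"
  unfolding root_le_def by (intro exI[of _ "\<lambda>_. 0"]) simp

lemma root_le_trans:
  assumes "root_le a b" "root_le b c"
  shows "root_le a c"
proof -
  obtain n m :: "'i \<Rightarrow> nat" where
    n: "\<forall>h\<in>H. b h - a h = (\<Sum>i\<in>I. of_nat (n i) * simple_root i h)" and
    m: "\<forall>h\<in>H. c h - b h = (\<Sum>i\<in>I. of_nat (m i) * simple_root i h)"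
    using assms unfolding root_le_def by blast
  have "c h - a h = (\<Sum>i\<in>I. of_nat (n i + m i) * simple_root i h)" if "h \<in> H" for h
  proof -
    have "c h - a h = (b h - a h) + (c h - b h)" by simp
    also have "\<dots> = (\<Sum>i\<in>I. of_nat (n i) * simple_root i h) + (\<Sum>i\<in>I. of_nat (m i) * simple_root i h)"
      using n m that by simp
    finally show ?thesis by (simp add: sum.distrib algebra_simps)
  qed
  then show ?thesis unfolding root_le_def by (intro exI[of _ "\<lambda>i. n i + m i"] ballI)
qed

lemma root_le_\<rho>:
  assumes "root_le \<nu> \<kappa>"
  obtains k where "\<kappa> \<rho> - \<nu> \<rho> = of_nat k" "k = 0 \<Longrightarrow> \<forall>h\<in>H. \<nu> h = \<kappa> h"
proof -
  obtain n :: "'i \<Rightarrow> nat" where n: "\<forall>h\<in>H. \<kappa> h - \<nu> h = (\<Sum>i\<in>I. of_nat (n i) * simple_root i h)"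
    using assms unfolding root_le_def by blast
  show ?thesis
  proof
    show "\<kappa> \<rho> - \<nu> \<rho> = of_nat (\<Sum>i\<in>I. n i)"
      using n \<rho>_in_H by (simp add: simple_root_\<rho>)
    show "\<forall>h\<in>H. \<nu> h = \<kappa> h" if "(\<Sum>i\<in>I. n i) = 0"
      using n that finite_index by simp
  qed
qed

lemma root_le_rank:
  assumes "root_le \<nu> \<kappa>" "\<nu> \<in> dual_space H" "\<kappa> \<in> dual_space H"
  shows "\<nu> = \<kappa> \<or> Re (\<nu> \<rho>) < Re (\<kappa> \<rho>)"
proof -
  obtain k where k: "\<kappa> \<rho> - \<nu> \<rho> = of_nat k" "k = 0 \<Longrightarrow> \<forall>h\<in>H. \<nu> h = \<kappa> h"
    using root_le_\<rho>[OF assms(1)] by blast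
  have "Re (\<kappa> \<rho>) - Re (\<nu> \<rho>) = real k" using arg_cong[OF k(1), of Re] by simp
  then show ?thesis using k(2) dual_space_eqI[OF assms(2,3)] by (cases "k = 0") auto
qed

text \<open>A function with the support and the reflection symmetry of a character vanishes if it
  vanishes on dominant weights: otherwise reflecting in a negative label moves upwards forever.\<close>

lemma symmetric_function_eq_0:
  fixes G :: "('g \<Rightarrow> complex) \<Rightarrow> int"
  assumes lam: "lam \<in> dominant_weights"
    and supp: "\<And>\<nu>. \<nu> \<in> dual_space H \<Longrightarrow> G \<nu> \<noteq> 0 \<Longrightarrow> root_le \<nu> lam"
    and sym: "\<And>p \<nu> m. p \<in> I \<Longrightarrow> \<nu> \<in> dual_space H \<Longrightarrow> \<nu> (simple_coroot p) = of_int m \<Longrightarrow>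
      G (\<lambda>h. \<nu> h - of_int m * simple_root p h) = G \<nu>"
    and dom: "\<And>\<nu>. \<nu> \<in> dominant_weights \<Longrightarrow> root_le \<nu> lam \<Longrightarrow> G \<nu> = 0"
    and \<nu>: "\<nu> \<in> dual_space H"
  shows "G \<nu> = 0"
proof (rule ccontr)
  assume "G \<nu> \<noteq> 0"
  then obtain k where "lam \<rho> - \<nu> \<rho> = of_nat k" using root_le_\<rho>[OF supp[OF \<nu>]] by blast
  then show False
    using \<nu> \<open>G \<nu> \<noteq> 0\<close>
  proof (induction k arbitrary: \<nu> rule: less_induct)
    case (less k)
    have le: "root_le \<nu> lam" using supp less.prems by blast
    then obtain n :: "'i \<Rightarrow> nat" where n: "\<forall>h\<in>H. lam h - \<nu> h = (\<Sum>i\<in>I. of_nat (n i) * simple_root i h)"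
      unfolding root_le_def by blast
    have label: "\<exists>m. \<nu> (simple_coroot p) = of_int m" if p: "p \<in> I" for p
    proof -
      obtain l where l: "lam (simple_coroot p) = of_nat l"
        using lam p unfolding dominant_weights_def dynkin_label_def Nats_def by auto
      have "(\<Sum>i\<in>I. of_nat (n i) * simple_root i (simple_coroot p)) = (of_int (\<Sum>i\<in>I. int (n i) * C p i) :: complex)"
        using p by (simp add: cartan_integer)
      moreover have "\<nu> (simple_coroot p) = lam (simple_coroot p) - (\<Sum>i\<in>I. of_nat (n i) * simple_root i (simple_coroot p))"
        using n simple_coroot_in_H[OF p] by (metis diff_diff_eq2 add_diff_cancel_left' diff_add_cancel add.commute)
      ultimately have "\<nu> (simple_coroot p) = of_int (int l - (\<Sum>i\<in>I. int (n i) * C p i))"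
        using l by simp
      then show ?thesis ..
    qed
    show ?case
    proof (cases "\<exists>p\<in>I. \<exists>m<0. \<nu> (simple_coroot p) = of_int m")
      case True
      then obtain p m where p: "p \<in> I" "m < 0" "\<nu> (simple_coroot p) = of_int m" by blast
      let ?\<nu> = "\<lambda>h. \<nu> h - of_int m * simple_root p h"
      have d: "?\<nu> \<in> dual_space H"
        by (intro dual_space_diff less.prems dual_space_scale simple_root_dual p)
      have G: "G ?\<nu> \<noteq> 0" using sym[OF p(1) less.prems(2) p(3)] less.prems(3) by simp
      obtain j where j: "lam \<rho> - ?\<nu> \<rho> = of_nat j" using root_le_\<rho>[OF supp[OF d G]] by blast
      then have "of_int (int j) = (of_int (int k + m) :: complex)"
        using less.prems(1) simple_root_\<rho>[OF p(1)] by (simp add: algebra_simps)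
      then have "int j = int k + m" unfolding of_int_eq_iff .
      then show ?thesis using less.IH[of j ?\<nu>] p(2) j d G by simp
    next
      case False
      have "\<nu> (simple_coroot p) \<in> \<int> \<and> \<nu> (simple_coroot p) \<in> \<nat>" if p: "p \<in> I" for p
      proof -
        obtain m where m: "\<nu> (simple_coroot p) = of_int m" using label[OF p] by blast
        then have "m \<ge> 0" using False p by force
        then have "\<nu> (simple_coroot p) = of_nat (nat m)" using m by simp
        then show ?thesis using m by simp
      qed
      then have "\<nu> \<in> dominant_weights"
        using less.prems(2) unfolding dominant_weights_def weight_lattice_def dynkin_label_def by blast
      then show ?thesis using dom le less.prems(3) by blast
    qed
  qed
qed

text \<open>The condition inside the definite description of \<open>atomic_number\<close>.\<close>

definition expansion :: "('g \<Rightarrow> complex) \<Rightarrow> (('g \<Rightarrow> complex) \<Rightarrow> int) \<Rightarrow> bool" where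
  "expansion lam a \<longleftrightarrow> finite {\<kappa>. a \<kappa> \<noteq> 0} \<and> {\<kappa>. a \<kappa> \<noteq> 0} \<subseteq> dominant_weights \<and>
     (\<forall>\<nu>\<in>dual_space H. ch lam \<nu> = (\<Sum>\<kappa> | a \<kappa> \<noteq> 0. a \<kappa> * Theta \<kappa> \<nu>))"

text \<open>Comparison on the finitely many dominant weights below \<open>lam\<close> is a
  unitriangular system. The difference of both sides then vanishes everywhere by
  \<open>symmetric_function_eq_0\<close>, since each \<open>Theta \<kappa>\<close> inherits support
  and reflection symmetry from a character.\<close>

lemma expansion_exists:
  assumes lam: "lam \<in> dominant_weights" and fin: "finite {\<kappa> \<in> dominant_weights. root_le \<kappa> lam}"
  shows "\<exists>a. expansion lam a"
proof -
  let ?D = "{\<kappa> \<in> dominant_weights. root_le \<kappa> lam}"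
  have "\<exists>a. \<forall>\<nu>\<in>?D. ch lam \<nu> = (\<Sum>\<kappa>\<in>?D. a \<kappa> * Theta \<kappa> \<nu>)"
  proof (rule triangular_solution[OF fin, where r = "\<lambda>\<kappa>. Re (\<kappa> \<rho>)"])
    fix x y assume x: "x \<in> ?D" and y: "y \<in> ?D"
    show "Theta x x = 1" using Theta_dominant[of x x] root_le_refl x by simp
    show "x = y \<or> Re (y \<rho>) < Re (x \<rho>)" if "Theta x y \<noteq> 0"
    proof -
      have "root_le y x" using that Theta_dominant[of x y] x y by (simp split: if_splits)
      then show ?thesis using root_le_rank[of y x] dominant_dual x y by auto
    qed
  qed
  then obtain b where b: "\<And>\<nu>. \<nu> \<in> ?D \<Longrightarrow> ch lam \<nu> = (\<Sum>\<kappa>\<in>?D. b \<kappa> * Theta \<kappa> \<nu>)" by blast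
  let ?G = "\<lambda>\<nu>. ch lam \<nu> - (\<Sum>\<kappa>\<in>?D. b \<kappa> * Theta \<kappa> \<nu>)"
  have G: "?G \<nu> = 0" if \<nu>: "\<nu> \<in> dual_space H" for \<nu>
  proof (rule symmetric_function_eq_0[OF lam _ _ _ \<nu>])
    fix \<nu> assume \<nu>: "\<nu> \<in> dual_space H" and ne: "?G \<nu> \<noteq> 0"
    show "root_le \<nu> lam"
    proof (cases "ch lam \<nu> = 0")
      case True
      then have "(\<Sum>\<kappa>\<in>?D. b \<kappa> * Theta \<kappa> \<nu>) \<noteq> 0" using ne by simp
      then obtain \<kappa> where \<kappa>: "\<kappa> \<in> ?D" "b \<kappa> * Theta \<kappa> \<nu> \<noteq> 0"
        by (rule sum.not_neutral_contains_not_neutral)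
      then have "ch \<kappa> \<nu> \<noteq> 0" using Theta_eq[of \<kappa> \<nu>] \<nu> by auto
      then show ?thesis using ch_nonzero_le[of \<kappa> \<nu>] \<nu> \<kappa>(1) root_le_trans by blast
    qed (use ch_nonzero_le[OF lam \<nu>] in blast)
  next
    fix p \<nu> m assume p: "p \<in> I" and \<nu>: "\<nu> \<in> dual_space H" and m: "\<nu> (simple_coroot p) = of_int m"
    let ?\<nu> = "\<lambda>h. \<nu> h - of_int m * simple_root p h"
    have d: "?\<nu> \<in> dual_space H"
      by (intro dual_space_diff \<nu> dual_space_scale simple_root_dual p)
    have "Theta \<kappa> ?\<nu> = Theta \<kappa> \<nu>" if "\<kappa> \<in> ?D" for \<kappa>
      using Theta_eq[OF _ d] Theta_eq[OF _ \<nu>] ch_reflect[OF _ p \<nu> m] that by simp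
    then have "(\<Sum>\<kappa>\<in>?D. b \<kappa> * Theta \<kappa> ?\<nu>) = (\<Sum>\<kappa>\<in>?D. b \<kappa> * Theta \<kappa> \<nu>)"
      by (intro sum.cong) auto
    then show "?G ?\<nu> = ?G \<nu>" using ch_reflect[OF lam p \<nu> m] by simp
  next
    fix \<nu> assume "\<nu> \<in> dominant_weights" "root_le \<nu> lam"
    then show "?G \<nu> = 0" using b by simp
  qed
  let ?a = "\<lambda>\<kappa>. if \<kappa> \<in> ?D then b \<kappa> else 0"
  have supp: "{\<kappa>. ?a \<kappa> \<noteq> 0} \<subseteq> ?D" by auto
  have "expansion lam ?a"
    unfolding expansion_def
  proof (intro conjI ballI)
    show "finite {\<kappa>. ?a \<kappa> \<noteq> 0}" using finite_subset[OF supp fin] .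
    show "{\<kappa>. ?a \<kappa> \<noteq> 0} \<subseteq> dominant_weights" using supp by blast
    fix \<nu> assume \<nu>: "\<nu> \<in> dual_space H"
    have "(\<Sum>\<kappa> | ?a \<kappa> \<noteq> 0. ?a \<kappa> * Theta \<kappa> \<nu>) = (\<Sum>\<kappa>\<in>?D. b \<kappa> * Theta \<kappa> \<nu>)"
      by (rule sum.mono_neutral_cong_left[OF fin supp]) auto
    then show "ch lam \<nu> = (\<Sum>\<kappa> | ?a \<kappa> \<noteq> 0. ?a \<kappa> * Theta \<kappa> \<nu>)" using G[OF \<nu>] by linarith
  qed
  then show ?thesis by blast
qed

text \<open>At a weight \<open>z\<close> of greatest height among those where the coefficients
  differ, no other differing term contributes, so the two expansions of \<open>ch lam z\<close>
  force agreement.\<close>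

lemma expansion_unique:
  assumes a: "expansion lam a" and b: "expansion lam b"
  shows "a = b"
proof (rule ccontr)
  assume "a \<noteq> b"
  let ?S = "{\<kappa>. a \<kappa> \<noteq> 0} \<union> {\<kappa>. b \<kappa> \<noteq> 0}"
  let ?N = "{\<kappa>. a \<kappa> \<noteq> b \<kappa>}"
  have fin: "finite ?S" and dom: "?S \<subseteq> dominant_weights" using a b unfolding expansion_def by auto
  have NS: "?N \<subseteq> ?S" by auto
  then have finN: "finite ?N" using fin finite_subset by blast
  have "?N \<noteq> {}" using \<open>a \<noteq> b\<close> by auto
  then have "Max ((\<lambda>\<kappa>. Re (\<kappa> \<rho>)) ` ?N) \<in> (\<lambda>\<kappa>. Re (\<kappa> \<rho>)) ` ?N"
    using finN by (intro Max_in) auto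
  then obtain z where zN: "z \<in> ?N" and max: "Max ((\<lambda>\<kappa>. Re (\<kappa> \<rho>)) ` ?N) = Re (z \<rho>)" by (rule imageE)
  have "Re (\<kappa> \<rho>) \<le> Re (z \<rho>)" if "\<kappa> \<in> ?N" for \<kappa>
    unfolding max[symmetric] using finN that by (intro Max_ge) auto
  note z = zN this
  have zd: "z \<in> dominant_weights" using z(1) NS dom by blast
  have zero: "(a \<kappa> - b \<kappa>) * Theta \<kappa> z = 0" if "\<kappa> \<in> ?S - {z}" for \<kappa>
  proof (cases "a \<kappa> = b \<kappa>")
    case False
    have \<kappa>d: "\<kappa> \<in> dominant_weights" using that dom by blast
    have "\<not> root_le z \<kappa>"
      using root_le_rank[of z \<kappa>] dominant_dual[OF zd] dominant_dual[OF \<kappa>d] that z(2)[of \<kappa>] False by auto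
    then show ?thesis using Theta_dominant[OF \<kappa>d zd] by simp
  qed simp
  have "(\<Sum>\<kappa>\<in>?S. a \<kappa> * Theta \<kappa> z) = (\<Sum>\<kappa> | a \<kappa> \<noteq> 0. a \<kappa> * Theta \<kappa> z)"
    "(\<Sum>\<kappa>\<in>?S. b \<kappa> * Theta \<kappa> z) = (\<Sum>\<kappa> | b \<kappa> \<noteq> 0. b \<kappa> * Theta \<kappa> z)"
    by (intro sum.mono_neutral_right fin, auto)+
  then have "(\<Sum>\<kappa>\<in>?S. (a \<kappa> - b \<kappa>) * Theta \<kappa> z) = 0"
    using a b dominant_dual[OF zd] unfolding expansion_def by (simp add: left_diff_distrib sum_subtractf)
  also have "(\<Sum>\<kappa>\<in>?S. (a \<kappa> - b \<kappa>) * Theta \<kappa> z) = (a z - b z) * Theta z z"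
    using sum.remove[OF fin, of z "\<lambda>\<kappa>. (a \<kappa> - b \<kappa>) * Theta \<kappa> z"] z(1) NS zero by (simp add: subset_iff)
  finally show False using z(1) Theta_dominant[OF zd zd] root_le_refl by simp
qed

lemma atomic_number_expansion:
  assumes "lam \<in> dominant_weights" "finite {\<kappa> \<in> dominant_weights. root_le \<kappa> lam}"
  shows "expansion lam (\<lambda>\<mu>. atomic_number \<mu> lam)"
proof -
  obtain a where a: "expansion lam a" using expansion_exists[OF assms] by blast
  have "(THE a. expansion lam a) = a" by (rule the_equality) (use a expansion_unique in blast)+
  then have "(\<lambda>\<mu>. atomic_number \<mu> lam) = a"
    unfolding atomic_number_def expansion_def by simp
  then show ?thesis using a by simp
qed

end


section \<open>Weight multiplicities in type D4\<close>

text \<open>Simple roots are independent, so the order can be read off from any integral coordinates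
  of the difference.\<close>

lemma (in based_semisimple_lie_algebra) root_le_iff:
  fixes z :: "'i \<Rightarrow> int"
  assumes "\<And>h. h \<in> H \<Longrightarrow> \<kappa> h - \<nu> h = (\<Sum>q\<in>I. of_int (z q) * simple_root q h)"
  shows "root_le \<nu> \<kappa> \<longleftrightarrow> (\<forall>q\<in>I. 0 \<le> z q)"
proof
  assume "root_le \<nu> \<kappa>"
  then obtain n :: "'i \<Rightarrow> nat" where n: "\<forall>h\<in>H. \<kappa> h - \<nu> h = (\<Sum>q\<in>I. of_nat (n q) * simple_root q h)"
    unfolding root_le_def by (rule exE)
  have "of_int (z q) = (of_nat (n q) :: complex)" if "q \<in> I" for q
    by (rule simple_roots_unique[OF _ that]) (use assms n in simp)
  then have "z q = int (n q)" if "q \<in> I" for q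
    using that by (metis of_int_eq_iff of_int_of_nat_eq)
  then show "\<forall>q\<in>I. 0 \<le> z q" by simp
next
  assume "\<forall>q\<in>I. 0 \<le> z q"
  then have "(\<Sum>q\<in>I. of_int (z q) * simple_root q h) = (\<Sum>q\<in>I. of_nat (nat (z q)) * simple_root q h)" for h
    by (intro sum.cong) auto
  then show "root_le \<nu> \<kappa>"
    unfolding root_le_def using assms by (intro exI[of _ "\<lambda>q. nat (z q)"]) simp
qed

lemma (in vector_space) dim_span_3:
  assumes "\<And>x y z. scale x u + scale y v + scale z w = 0 \<Longrightarrow> x = 0 \<and> y = 0 \<and> z = 0"
    and "S \<subseteq> span {u, v, w}" "{u, v, w} \<subseteq> S"
  shows "dim S = 3"
proof -
  have uv: "u \<noteq> v" using assms(1)[of 1 "-1" 0] by auto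
  have uw: "u \<noteq> w" using assms(1)[of 1 0 "-1"] by auto
  have vw: "v \<noteq> w" using assms(1)[of 0 1 "-1"] by auto
  have "independent {u, v, w}"
  proof (rule independent_if_scalars_zero)
    fix f x assume f: "(\<Sum>x\<in>{u, v, w}. scale (f x) x) = 0" and x: "x \<in> {u, v, w}"
    have "scale (f u) u + scale (f v) v + scale (f w) w = 0"
      using f uv uw vw by (simp add: add.assoc)
    then show "f x = 0" using assms(1) x by blast
  qed simp
  from basis_card_eq_dim[OF assms(3,2) this] show ?thesis using uv uw vw by simp
qed

lemma (in vector_space) dim_span_1:
  assumes "u \<noteq> 0" "u \<in> S" "S \<subseteq> span {u}"
  shows "dim S = 1"
  using basis_card_eq_dim[of "{u}" S] assms by simp

locale D4_type = cartan_type scale bracket H I simple_root simple_coroot C \<rho>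
  for scale :: "complex \<Rightarrow> 'g::ab_group_add \<Rightarrow> 'g" and bracket :: "'g \<Rightarrow> 'g \<Rightarrow> 'g"
    and H :: "'g set" and I :: "'i set"
    and simple_root :: "'i \<Rightarrow> 'g \<Rightarrow> complex" and simple_coroot :: "'i \<Rightarrow> 'g"
    and C :: "'i \<Rightarrow> 'i \<Rightarrow> int" and \<rho> :: 'g +
  fixes c i j k :: 'i
  assumes I_eq: "I = {c, i, j, k}" and distinct: "distinct [c, i, j, k]"
    and C_eq: "p \<in> I \<Longrightarrow> q \<in> I \<Longrightarrow> C p q = (if p = q then 2 else if p = c \<or> q = c then -1 else 0)"
begin

lemma nodes [simp]: "c \<in> I" "i \<in> I" "j \<in> I" "k \<in> I"
  and nodes_distinct [simp]: "c \<noteq> i" "c \<noteq> j" "c \<noteq> k" "i \<noteq> j" "i \<noteq> k" "j \<noteq> k"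
    "i \<noteq> c" "j \<noteq> c" "k \<noteq> c" "j \<noteq> i" "k \<noteq> i" "k \<noteq> j"
  using I_eq distinct by auto

lemma C_leaves: "C c c = 2" "C i i = 2" "C j j = 2" "C k k = 2"
    "C c i = -1" "C c j = -1" "C c k = -1" "C i c = -1" "C j c = -1" "C k c = -1"
    "C i j = 0" "C i k = 0" "C j i = 0" "C j k = 0" "C k i = 0" "C k j = 0"
  by (simp_all add: C_eq)

lemma sum_I: "(\<Sum>q\<in>I. g q) = g i + g c + g j + g k" for g :: "'i \<Rightarrow> 'x::comm_monoid_add"
  unfolding I_eq using distinct by (simp add: ac_simps)

lemma ball_I: "(\<forall>q\<in>I. P q) \<longleftrightarrow> P i \<and> P c \<and> P j \<and> P k"
  unfolding I_eq by auto

text \<open>Coordinates count downwards from \<open>\<nu>\<close>, in the order leaf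
  \<open>i\<close>, hub \<open>c\<close>, leaves \<open>j\<close> and \<open>k\<close>; below
  \<open>lam\<close>, the weight \<mu> has the coordinates 1, 2, 2, 2 of \<beta>.\<close>

definition down :: "('g \<Rightarrow> complex) \<Rightarrow> nat \<Rightarrow> nat \<Rightarrow> nat \<Rightarrow> nat \<Rightarrow> 'g \<Rightarrow> complex" where
  "down \<nu> ni nc nj nk h = \<nu> h - (of_nat ni * simple_root i h + of_nat nc * simple_root c h
     + of_nat nj * simple_root j h + of_nat nk * simple_root k h)"

lemma down_0 [simp]: "down \<nu> 0 0 0 0 = \<nu>"
  by (rule ext) (simp add: down_def)

lemma down_dual: "\<nu> \<in> dual_space H \<Longrightarrow> down \<nu> ni nc nj nk \<in> dual_space H"
  unfolding down_def[abs_def]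
  by (intro dual_space_diff dual_space_add dual_space_scale simple_root_dual nodes)

lemma down_label:
  "down \<nu> ni nc nj nk (simple_coroot i) = \<nu> (simple_coroot i) - 2 * of_nat ni + of_nat nc"
  "down \<nu> ni nc nj nk (simple_coroot j) = \<nu> (simple_coroot j) - 2 * of_nat nj + of_nat nc"
  "down \<nu> ni nc nj nk (simple_coroot k) = \<nu> (simple_coroot k) - 2 * of_nat nk + of_nat nc"
  "down \<nu> ni nc nj nk (simple_coroot c) = \<nu> (simple_coroot c) - 2 * of_nat nc + of_nat ni + of_nat nj + of_nat nk"
  by (simp_all add: down_def cartan_integer C_leaves)

lemma down_add:
  "(\<lambda>h. down \<nu> (Suc ni) nc nj nk h + simple_root i h) = down \<nu> ni nc nj nk"
  "(\<lambda>h. down \<nu> ni (Suc nc) nj nk h + simple_root c h) = down \<nu> ni nc nj nk"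
  "(\<lambda>h. down \<nu> ni nc (Suc nj) nk h + simple_root j h) = down \<nu> ni nc nj nk"
  "(\<lambda>h. down \<nu> ni nc nj (Suc nk) h + simple_root k h) = down \<nu> ni nc nj nk"
  by (rule ext, simp add: down_def algebra_simps)+

lemma down_diff:
  "(\<lambda>h. down \<nu> ni nc nj nk h - simple_root i h) = down \<nu> (Suc ni) nc nj nk"
  "(\<lambda>h. down \<nu> ni nc nj nk h - simple_root c h) = down \<nu> ni (Suc nc) nj nk"
  "(\<lambda>h. down \<nu> ni nc nj nk h - simple_root j h) = down \<nu> ni nc (Suc nj) nk"
  "(\<lambda>h. down \<nu> ni nc nj nk h - simple_root k h) = down \<nu> ni nc nj (Suc nk)"
  by (rule ext, simp add: down_def algebra_simps)+

lemma down_\<rho>: "down \<nu> ni nc nj nk \<rho> = \<nu> \<rho> - of_nat (ni + nc + nj + nk)"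
  by (simp add: down_def simple_root_\<rho>)

end

text \<open>The labels of \<beta> at \<open>i\<close>, \<open>c\<close>, \<open>j\<close>,
  \<open>k\<close> are 0, -1, 2, 2. For \<mu> = \<lambda> - \<beta> with hub label 1 the labels of
  \<open>lam\<close> therefore have the form assumed here, with \<open>a\<close>, \<open>b\<close>,
  \<open>d\<close> the leaf labels of \<mu>.\<close>

locale D4_module =
  highest_weight_module scale bracket H I simple_root simple_coroot C \<rho> scaleV M act lam v +
  D4_type scale bracket H I simple_root simple_coroot C \<rho> c i j k
  for scale :: "complex \<Rightarrow> 'g::ab_group_add \<Rightarrow> 'g" and bracket :: "'g \<Rightarrow> 'g \<Rightarrow> 'g"
    and H :: "'g set" and I :: "'i set"
    and simple_root :: "'i \<Rightarrow> 'g \<Rightarrow> complex" and simple_coroot :: "'i \<Rightarrow> 'g"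
    and C :: "'i \<Rightarrow> 'i \<Rightarrow> int" and \<rho> :: 'g
    and scaleV :: "complex \<Rightarrow> 'v::ab_group_add \<Rightarrow> 'v" and M :: "'v set" and act :: "'g \<Rightarrow> 'v \<Rightarrow> 'v"
    and lam :: "'g \<Rightarrow> complex" and v :: 'v and c i j k :: 'i +
  fixes a b d :: nat
  assumes lam_labels: "lam (simple_coroot i) = of_nat a" "lam (simple_coroot c) = 0"
    "lam (simple_coroot j) = of_nat (b + 2)" "lam (simple_coroot k) = of_nat (d + 2)"
begin

abbreviation W :: "nat \<Rightarrow> nat \<Rightarrow> nat \<Rightarrow> nat \<Rightarrow> 'v set" where
  "W ni nc nj nk \<equiv> weight_space H (down lam ni nc nj nk)"

lemma v_W: "v \<in> W 0 0 0 0"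
  using v_weight by simp

lemma E_W:
  "u \<in> W (Suc ni) nc nj nk \<Longrightarrow> E i u \<in> W ni nc nj nk"
  "u \<in> W ni (Suc nc) nj nk \<Longrightarrow> E c u \<in> W ni nc nj nk"
  "u \<in> W ni nc (Suc nj) nk \<Longrightarrow> E j u \<in> W ni nc nj nk"
  "u \<in> W ni nc nj (Suc nk) \<Longrightarrow> E k u \<in> W ni nc nj nk"
  using E_weight[of i u "down lam (Suc ni) nc nj nk"] E_weight[of c u "down lam ni (Suc nc) nj nk"]
    E_weight[of j u "down lam ni nc (Suc nj) nk"] E_weight[of k u "down lam ni nc nj (Suc nk)"]
  by (simp_all add: down_add)

lemma F_W:
  "u \<in> W ni nc nj nk \<Longrightarrow> F i u \<in> W (Suc ni) nc nj nk"
  "u \<in> W ni nc nj nk \<Longrightarrow> F c u \<in> W ni (Suc nc) nj nk"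
  "u \<in> W ni nc nj nk \<Longrightarrow> F j u \<in> W ni nc (Suc nj) nk"
  "u \<in> W ni nc nj nk \<Longrightarrow> F k u \<in> W ni nc nj (Suc nk)"
  using F_weight[of i u "down lam ni nc nj nk"] F_weight[of c u "down lam ni nc nj nk"]
    F_weight[of j u "down lam ni nc nj nk"] F_weight[of k u "down lam ni nc nj nk"]
  by (simp_all add: down_diff)

lemma E_outside:
  assumes p: "p \<in> I" and u: "u \<in> W ni nc nj nk"
    and z: "(if p = i then ni = 0 else if p = c then nc = 0 else if p = j then nj = 0 else nk = 0)"
  shows "E p u = 0"
proof (rule ccontr)
  assume ne: "E p u \<noteq> 0"
  let ?\<kappa> = "\<lambda>h. down lam ni nc nj nk h + simple_root p h"
  let ?z = "\<lambda>q. (if q = i then int ni else if q = c then int nc else if q = j then int nj else int nk)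
      - (if q = p then 1 else 0)"
  have "E p u \<in> weight_space H ?\<kappa>" using E_weight[OF p u] .
  moreover have "?\<kappa> \<in> dual_space H" using dual_space_add[OF down_dual[OF lam_dual] simple_root_dual[OF p]] .
  ultimately have "root_le ?\<kappa> lam" using weight_below_lam ne by blast
  moreover have "lam h - ?\<kappa> h = (\<Sum>q\<in>I. of_int (?z q) * simple_root q h)" for h
    unfolding sum_I using p I_eq by (auto simp: down_def algebra_simps)
  ultimately have "0 \<le> ?z p" using root_le_iff[of lam ?\<kappa> ?z] p by blast
  then show False using z p I_eq by (auto split: if_splits)
qed

lemma E_outside_simps:
  "u \<in> W 0 nc nj nk \<Longrightarrow> E i u = 0"
  "u \<in> W ni 0 nj nk \<Longrightarrow> E c u = 0"
  "u \<in> W ni nc 0 nk \<Longrightarrow> E j u = 0"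
  "u \<in> W ni nc nj 0 \<Longrightarrow> E k u = 0"
  by (rule E_outside, simp, assumption, simp)+

lemma singular_eq_0:
  assumes u: "u \<in> W ni nc nj nk" and "E i u = 0" "E c u = 0" "E j u = 0" "E k u = 0" "ni + nc + nj + nk > 0"
  shows "u = 0"
proof (rule ccontr)
  assume "u \<noteq> 0"
  then have "down lam ni nc nj nk = lam"
    using singular_vector_weight[OF u down_dual[OF lam_dual]] assms unfolding I_eq by blast
  then have "lam \<rho> - of_nat (ni + nc + nj + nk) = lam \<rho>" using down_\<rho>[of lam ni nc nj nk] by simp
  then have "of_nat (ni + nc + nj + nk) = (0 :: complex)" by (simp only: diff_eq_eq add_cancel_right_right)
  then show False using assms(6) unfolding of_nat_eq_0_iff by simp
qed

lemma word_counts: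
  assumes ps: "set ps \<subseteq> I" "word_weight lam ps = down lam ni nc nj nk"
  shows "count_list ps i = ni" "count_list ps c = nc" "count_list ps j = nj" "count_list ps k = nk"
    "length ps = ni + nc + nj + nk"
proof -
  let ?n = "\<lambda>q. if q = i then ni else if q = c then nc else if q = j then nj else nk"
  have cancel: "y = z" if "x - y = x - z" for x y z :: complex using that by simp
  have "(\<Sum>q\<in>I. of_nat (count_list ps q) * simple_root q h) = (\<Sum>q\<in>I. of_nat (?n q) * simple_root q h)" for h
  proof (rule cancel[of "lam h"])
    have "down lam ni nc nj nk h = lam h - (\<Sum>q\<in>I. of_nat (?n q) * simple_root q h)"
      unfolding sum_I by (simp add: down_def)
    then show "lam h - (\<Sum>q\<in>I. of_nat (count_list ps q) * simple_root q h) = lam h - (\<Sum>q\<in>I. of_nat (?n q) * simple_root q h)"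
      using word_weight_count[OF ps(1), of lam h] unfolding ps(2) by simp
  qed
  then have "of_nat (count_list ps q) = (of_nat (?n q) :: complex)" if "q \<in> I" for q
    by (rule simple_roots_unique[OF _ that])
  then have "count_list ps q = ?n q" if "q \<in> I" for q
    using that unfolding of_nat_eq_iff by blast
  then show *: "count_list ps i = ni" "count_list ps c = nc" "count_list ps j = nj" "count_list ps k = nk"
    by simp_all
  have "lam \<rho> - of_nat (length ps) = lam \<rho> - of_nat (ni + nc + nj + nk)"
    using word_weight_\<rho>[OF ps(1), of lam] unfolding ps(2) down_\<rho> by simp
  from cancel[OF this] show "length ps = ni + nc + nj + nk" unfolding of_nat_eq_iff by simp
qed

lemma leaves_commute:
  assumes "u \<in> M"
  shows "E j (E i u) = E i (E j u)" "E k (E i u) = E i (E k u)" "E k (E j u) = E j (E k u)"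
    "F j (F i u) = F i (F j u)" "F k (F i u) = F i (F k u)" "F k (F j u) = F j (F k u)"
  using assms by (auto intro: E_commute F_commute simp: C_leaves)

lemma serre_leaf:
  assumes "p \<in> {i, j, k}" "u \<in> M"
  shows "E p (E p (E c u)) + E c (E p (E p u)) = scaleV 2 (E p (E c (E p u)))"
  using assms E_serre[of p c u] by (auto simp: C_leaves)

lemma serre_hub:
  assumes "p \<in> {i, j, k}" "u \<in> M"
  shows "E c (E c (E p u)) + E p (E c (E c u)) = scaleV 2 (E c (E p (E c u)))"
  using assms E_serre[of c p u] by (auto simp: C_leaves)

lemma E_pow_closed: "u \<in> M \<Longrightarrow> (E q ^^ n) u \<in> M"
  using act_closed by (induction n) auto

lemma E_pow_commute:
  assumes "p \<in> I" "q \<in> I" "p \<noteq> q" "C p q = 0" "u \<in> M"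
  shows "E p ((E q ^^ n) u) = (E q ^^ n) (E p u)"
proof (induction n)
  case (Suc n)
  then show ?case using E_commute[OF assms(1-4) E_pow_closed[OF assms(5)]] by simp
qed simp

text \<open>Without hub roots between the weight and \<open>lam\<close>, only the commuting leaf
  operators can act, so one ordered word decides. Each \<open>E p u\<close> satisfies the hypothesis
  with one exponent less, hence vanishes by induction, and \<open>u\<close> is singular.\<close>

lemma hubless_eq_0:
  assumes "u \<in> W ni 0 nj nk" "(E i ^^ ni) ((E j ^^ nj) ((E k ^^ nk) u)) = 0"
  shows "u = 0"
  using assms
proof (induction "ni + nj + nk" arbitrary: ni nj nk u rule: less_induct)
  case less
  note u = less.prems(1)
  have uM: "u \<in> M" using u by (rule weight_space_carrier)
  show ?case
  proof (cases "ni + nj + nk = 0")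
    case True
    then show ?thesis using less.prems(2) by simp
  next
    case False
    have "E i u = 0"
    proof (cases ni)
      case 0
      then show ?thesis using E_outside_simps(1) u by blast
    next
      case (Suc m)
      have "(E j ^^ nj) ((E k ^^ nk) (E i u)) = E i ((E j ^^ nj) ((E k ^^ nk) u))"
        using uM E_pow_closed[OF uM] E_pow_commute[of i j] E_pow_commute[of i k]
        by (simp add: C_leaves)
      then have "(E i ^^ m) ((E j ^^ nj) ((E k ^^ nk) (E i u))) = 0"
        using less.prems(2) Suc by (simp add: funpow_swap1)
      then show ?thesis
        using less.hyps[of m nj nk "E i u"] E_W(1)[of u m] u Suc by simp
    qed
    moreover have "E j u = 0"
    proof (cases nj)
      case 0
      then show ?thesis using E_outside_simps(3) u by blast
    next
      case (Suc m)
      have "(E k ^^ nk) (E j u) = E j ((E k ^^ nk) u)"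
        using uM E_pow_commute[of j k] by (simp add: C_leaves)
      then have "(E i ^^ ni) ((E j ^^ m) ((E k ^^ nk) (E j u))) = 0"
        using less.prems(2) Suc by (simp add: funpow_swap1)
      then show ?thesis
        using less.hyps[of ni m nk "E j u"] E_W(3)[of u ni 0 m] u Suc by simp
    qed
    moreover have "E k u = 0"
    proof (cases nk)
      case 0
      then show ?thesis using E_outside_simps(4) u by blast
    next
      case (Suc m)
      then have "(E i ^^ ni) ((E j ^^ nj) ((E k ^^ m) (E k u))) = 0"
        using less.prems(2) by (simp add: funpow_swap1)
      then show ?thesis
        using less.hyps[of ni nj m "E k u"] E_W(4)[of u ni 0 nj m] u Suc by simp
    qed
    ultimately show ?thesis
      using singular_eq_0[OF u] E_outside_simps(2)[OF u] False by simp
  qed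
qed

subsection \<open>An upper bound for the singular vectors of a Levi subalgebra\<close>

definition corner :: "'v \<Rightarrow> 'v" where
  "corner w = E j (E k (E c (E i (E j (E k (E c w))))))"

text \<open>By the Serre relations, every word in the raising operators that does not annihilate \<open>w\<close>
  has the same value on \<open>w\<close> as \<^const>\<open>corner\<close>, up to a power of two.\<close>

lemma joint_kernel_relations:
  assumes w: "w \<in> joint_kernel {i, j, k} (down lam 1 2 2 2)"
  defines "x \<equiv> E c w"
  shows "p \<in> {i, j, k} \<Longrightarrow> E p (E p x) = 0"
    and "p \<in> {i, j, k} \<Longrightarrow> E p (E c x) = scaleV 2 (E c (E p x))"
    and "x \<in> W 1 1 2 2"
proof -
  have wW: "w \<in> W 1 2 2 2" and Ew: "\<And>p. p \<in> {i, j, k} \<Longrightarrow> E p w = 0"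
    using w unfolding joint_kernel_def by auto
  have wM: "w \<in> M" using wW by (rule weight_space_carrier)
  show "E p (E p x) = 0" if "p \<in> {i, j, k}"
    using serre_leaf[OF that wM] Ew[OF that] by (simp add: x_def)
  show "E p (E c x) = scaleV 2 (E c (E p x))" if "p \<in> {i, j, k}"
    using serre_hub[OF that wM] Ew[OF that] by (simp add: x_def)
  show "x \<in> W 1 1 2 2" unfolding x_def using E_W(2)[of w 1 1 2 2] wW by (simp add: numeral_2_eq_2)
qed

text \<open>If \<open>E p\<close> applied twice kills \<open>u\<close>, the Serre relation becomes
  the rule \<open>E p E p E c u = 2 E p E c E p u\<close>. It is used for \<open>u\<close> obtained
  from \<open>x\<close> by other leaves, which commute with \<open>E p\<close>.\<close>

lemma corner_relations:
  assumes w: "w \<in> joint_kernel {i, j, k} (down lam 1 2 2 2)"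
  defines "x \<equiv> E c w"
  shows "E j (E j (E c (E i x))) = scaleV 2 (E j (E c (E i (E j x))))"
    and "E j (E j (E c (E i (E k x)))) = scaleV 2 (E j (E c (E i (E j (E k x)))))"
    and "E k (E k (E c (E i x))) = scaleV 2 (E k (E c (E i (E k x))))"
    and "E k (E k (E c (E i (E j x)))) = scaleV 2 (E k (E c (E i (E j (E k x)))))"
    and "E k (E k (E c (E j x))) = scaleV 2 (E k (E c (E j (E k x))))"
proof -
  note rel = joint_kernel_relations[OF w, folded x_def]
  have xM: "x \<in> M" using rel(3) by (rule weight_space_carrier)
  have step: "E p (E p (E c u)) = scaleV 2 (E p (E c (E p u)))" if "p \<in> {i, j, k}" "u \<in> M" "E p (E p u) = 0" for p u
    using serre_leaf[OF that(1,2)] that(3) by simp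
  have 0: "E j (E j x) = 0" "E k (E k x) = 0" using rel(1) by auto
  show "E j (E j (E c (E i x))) = scaleV 2 (E j (E c (E i (E j x))))"
    using step[of j "E i x"] xM 0 by (simp add: act_closed leaves_commute)
  show "E k (E k (E c (E i x))) = scaleV 2 (E k (E c (E i (E k x))))"
    using step[of k "E i x"] xM 0 by (simp add: act_closed leaves_commute)
  show "E k (E k (E c (E i (E j x)))) = scaleV 2 (E k (E c (E i (E j (E k x)))))"
    using step[of k "E i (E j x)"] xM 0 by (simp add: act_closed leaves_commute)
  show "E k (E k (E c (E j x))) = scaleV 2 (E k (E c (E j (E k x))))"
    using step[of k "E j x"] xM 0 by (simp add: act_closed leaves_commute)
  have "E j (E j (E k x)) = E k (E j (E j x))" using xM by (simp add: act_closed leaves_commute)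
  then have "E j (E j (E i (E k x))) = 0" using xM 0 by (simp add: act_closed leaves_commute)
  then show "E j (E j (E c (E i (E k x)))) = scaleV 2 (E j (E c (E i (E j (E k x)))))"
    using step[of j "E i (E k x)"] xM by (simp add: act_closed leaves_commute)
qed

text \<open>The vectors \<open>E c y\<close>, with \<open>y\<close> obtained from \<open>x\<close>
  by leaf operators, are shown to vanish, beginning with all three leaves. Then the vectors
  \<open>y\<close> vanish from the highest weight downwards, each being killed by all raising
  operators, until \<open>x\<close> and \<open>w\<close> are reached.\<close>

lemma corner_eq_0:
  assumes w: "w \<in> joint_kernel {i, j, k} (down lam 1 2 2 2)" and t: "corner w = 0"
  shows "w = 0"
proof -
  define x where "x = E c w"
  note rel = joint_kernel_relations[OF w, folded x_def]
  note cr = corner_relations[OF w, folded x_def]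
  have x: "x \<in> W (Suc 0) (Suc 0) (Suc (Suc 0)) (Suc (Suc 0))" using rel(3) by (simp add: numeral_2_eq_2)
  have M: "x \<in> M" using x by (rule weight_space_carrier)
  note [simp] = M act_closed leaves_commute
  have sq: "E i (E i x) = 0" "E j (E j x) = 0" "E k (E k x) = 0" using rel(1) by auto
  have xk: "E k x \<in> W (Suc 0) (Suc 0) (Suc (Suc 0)) (Suc 0)"
    and xj: "E j x \<in> W (Suc 0) (Suc 0) (Suc 0) (Suc (Suc 0))"
    and xi: "E i x \<in> W 0 (Suc 0) (Suc (Suc 0)) (Suc (Suc 0))"
    using E_W[OF x] by auto
  have xjk: "E j (E k x) \<in> W (Suc 0) (Suc 0) (Suc 0) (Suc 0)"
    and xik: "E i (E k x) \<in> W 0 (Suc 0) (Suc (Suc 0)) (Suc 0)"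
    and xij: "E i (E j x) \<in> W 0 (Suc 0) (Suc 0) (Suc (Suc 0))"
    using E_W(3)[OF xk] E_W(1)[OF xk] E_W(1)[OF xj] by auto
  have xijk: "E i (E j (E k x)) \<in> W 0 (Suc 0) (Suc 0) (Suc 0)"
    using E_W(1)[OF xjk] .
  note y = E_W(2)[OF x] E_W(2)[OF xi] E_W(2)[OF xj] E_W(2)[OF xk] E_W(2)[OF xij] E_W(2)[OF xik]
    E_W(2)[OF xjk] E_W(2)[OF xijk]
  have yijk: "E c (E i (E j (E k x))) = 0"
    using hubless_eq_0[OF y(8)] t by (simp add: corner_def x_def)
  have yij: "E c (E i (E j x)) = 0"
    using hubless_eq_0[OF y(5)] cr(4) yijk by simp
  have "E j (E j (E k (E c (E i (E k x))))) = E k (E j (E j (E c (E i (E k x)))))" by simp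
  then have yik: "E c (E i (E k x)) = 0"
    using hubless_eq_0[OF y(6)] cr(2) yijk by simp
  have yi: "E c (E i x) = 0"
    using hubless_eq_0[OF y(2)] cr(3) yik by simp
  \<comment> \<open>The ordered word for \<open>E c x\<close> contains \<open>E i\<close>; moved to
    the right, it meets \<open>E c x\<close> and gives \<open>2 E c E i x\<close>, which is
    zero.\<close>
  have "E i (E c x) = 0" using rel(2)[of i] yi by simp
  moreover have "E i (E j (E j (E k (E k (E c x))))) = E j (E j (E k (E k (E i (E c x)))))" by simp
  ultimately have s: "E c x = 0"
    using hubless_eq_0[OF y(1)] by simp
  have yj: "E c (E j x) = 0" and yk: "E c (E k x) = 0"
    using rel(2)[of j] rel(2)[of k] s by simp_all
  have "E k (E c (E j (E k x))) = 0" using cr(5) yj by simp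
  then have yjk: "E c (E j (E k x)) = 0"
    using hubless_eq_0[OF y(7)] by simp
  have iij: "E i (E i (E j x)) = 0" "E i (E i (E k x)) = 0" "E i (E i (E j (E k x))) = 0"
    "E j (E j (E k x)) = 0"
  proof -
    have "E i (E i (E j x)) = E j (E i (E i x))" "E i (E i (E k x)) = E k (E i (E i x))"
      "E i (E i (E j (E k x))) = E j (E k (E i (E i x)))" "E j (E j (E k x)) = E k (E j (E j x))"
      by simp_all
    then show "E i (E i (E j x)) = 0" "E i (E i (E k x)) = 0" "E i (E i (E j (E k x))) = 0" "E j (E j (E k x)) = 0"
      unfolding sq by simp_all
  qed
  have xijk0: "E i (E j (E k x)) = 0"
    by (rule singular_eq_0[OF xijk]) (use yijk sq iij in simp_all)
  have xjk0: "E j (E k x) = 0"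
    by (rule singular_eq_0[OF xjk]) (use yjk sq iij xijk0 in simp_all)
  have xik0: "E i (E k x) = 0"
    by (rule singular_eq_0[OF xik]) (use yik sq iij xijk0 in simp_all)
  have xij0: "E i (E j x) = 0"
    by (rule singular_eq_0[OF xij]) (use yij sq iij xijk0 in simp_all)
  have xi0: "E i x = 0"
    by (rule singular_eq_0[OF xi]) (use yi sq xij0 xik0 in simp_all)
  have xj0: "E j x = 0"
    by (rule singular_eq_0[OF xj]) (use yj sq xij0 xjk0 in simp_all)
  have xk0: "E k x = 0"
    by (rule singular_eq_0[OF xk]) (use yk sq xik0 xjk0 in simp_all)
  have "x = 0"
    by (rule singular_eq_0[OF x]) (use s xi0 xj0 xk0 in simp_all)
  then show "w = 0"
    using singular_eq_0[of w 1 2 2 2] w unfolding joint_kernel_def x_def by simp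
qed

lemma corner_W:
  assumes "w \<in> W 1 2 2 2"
  shows "corner w \<in> W 0 0 0 0"
proof -
  have "w \<in> W (Suc 0) (Suc (Suc 0)) (Suc (Suc 0)) (Suc (Suc 0))" using assms by (simp add: numeral_2_eq_2)
  from E_W(3)[OF E_W(4)[OF E_W(2)[OF E_W(1)[OF E_W(3)[OF E_W(4)[OF E_W(2)[OF this]]]]]]]
  show ?thesis unfolding corner_def .
qed

lemma W_0_scale:
  assumes "u \<in> W 0 0 0 0"
  shows "\<exists>x. u = scaleV x v"
proof -
  have "{word ps v |ps. set ps \<subseteq> I \<and> word_weight lam ps = lam} \<subseteq> {v}"
  proof clarify
    fix ps assume "set ps \<subseteq> I" "word_weight lam ps = lam"
    then have "lam \<rho> - of_nat (length ps) = lam \<rho>" using word_weight_\<rho>[of ps lam] by simp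
    then show "word ps v = v" by simp
  qed
  from V.span_mono[OF this] have "u \<in> V.span {v}" using weight_space_words[OF lam_dual] assms by auto
  then show ?thesis unfolding V.span_singleton by blast
qed

lemma joint_kernel_trivial:
  assumes w: "w \<in> joint_kernel {i, j, k} (down lam 1 2 2 2)" and a: "a = 0"
  shows "w = 0"
proof (rule corner_eq_0[OF w])
  define x where "x = E c w"
  note rel = joint_kernel_relations[OF w, folded x_def]
  note cr = corner_relations[OF w, folded x_def]
  have M: "x \<in> M" using rel(3) by (rule weight_space_carrier)
  note [simp] = M act_closed leaves_commute act_scale scale_in_carrier
  have "x \<in> W 1 (Suc 0) (Suc (Suc 0)) (Suc (Suc 0))" using rel(3) by (simp add: numeral_2_eq_2)
  from E_W(3)[OF E_W(3)[OF E_W(4)[OF E_W(4)[OF E_W(2)[OF this]]]]]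
  have u: "E j (E j (E k (E k (E c x)))) \<in> W (Suc 0) 0 0 0" by simp
  have "E i (E j (E j (E k (E k (E c x))))) = 0"
  proof -
    have Fv: "F i v = 0" using F_pow_v_eq_0[of i 0] lam_labels(1) a by simp
    let ?u = "E j (E j (E k (E k (E c x))))"
    have in_span: "?u \<in> V.span {word ps v |ps. set ps \<subseteq> I \<and> word_weight lam ps = down lam (Suc 0) 0 0 0}"
      using weight_space_words[OF down_dual[OF lam_dual]] u by blast
    have "{word ps v |ps. set ps \<subseteq> I \<and> word_weight lam ps = down lam (Suc 0) 0 0 0} \<subseteq> {0}"
    proof clarify
      fix ps assume ps: "set ps \<subseteq> I" "word_weight lam ps = down lam (Suc 0) 0 0 0"
      then have "length ps = Suc 0" "count_list ps i = Suc 0" using word_counts by auto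
      then have "ps = [i]" by (auto simp: length_Suc_conv split: if_splits)
      then show "word ps v = 0" using Fv by simp
    qed
    from subsetD[OF V.span_mono[OF this] in_span] have "?u = 0" by simp
    then show ?thesis by simp
  qed
  \<comment> \<open>Moving \<open>E i\<close> to the right and applying the Serre rules shows that
    this vanishing word is 8 times \<open>corner w\<close>.\<close>
  moreover have "E i (E j (E j (E k (E k (E c x))))) = E j (E j (E k (E k (E i (E c x)))))" by simp
  moreover have "E i (E c x) = scaleV 2 (E c (E i x))" using rel(2)[of i] by simp
  ultimately have "E j (E j (E k (E k (E c (E i x))))) = 0" by simp
  then have "E j (E j (E k (E c (E i (E k x))))) = 0" unfolding cr(3) by simp
  then have "E k (E j (E j (E c (E i (E k x))))) = 0" by simp
  then have "E j (E k (E c (E i (E j (E k x))))) = 0" unfolding cr(2) by simp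
  then show "corner w = 0" by (simp only: corner_def x_def)
qed

lemma dim_joint_kernel_corner:
  assumes w: "w \<in> joint_kernel {i, j, k} (down lam 1 2 2 2)" and "w \<noteq> 0"
  shows "V.dim (joint_kernel {i, j, k} (down lam 1 2 2 2)) = 1"
proof (rule V.dim_span_1[OF assms(2,1)], rule subsetI)
  fix u assume u: "u \<in> joint_kernel {i, j, k} (down lam 1 2 2 2)"
  have W: "w \<in> W 1 2 2 2" "u \<in> W 1 2 2 2" using w u unfolding joint_kernel_def by auto
  then have M: "w \<in> M" "u \<in> M" using weight_space_carrier by auto
  obtain x y where x: "corner w = scaleV x v" and y: "corner u = scaleV y v"
    using corner_W[OF W(1)] corner_W[OF W(2)] W_0_scale by blast
  have "x \<noteq> 0" using x corner_eq_0[OF w] assms(2) by auto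
  let ?u = "u - scaleV (y / x) w"
  have "corner ?u = corner u - scaleV (y / x) (corner w)"
    unfolding corner_def using M by (simp add: act_diff act_scale act_closed scale_in_carrier)
  also have "\<dots> = 0" using x y \<open>x \<noteq> 0\<close> by simp
  finally have "?u = 0"
    using corner_eq_0 V.subspace_diff[OF subspace_joint_kernel u V.subspace_scale[OF subspace_joint_kernel w]]
    by blast
  then show "u \<in> V.span {w}" by (simp add: V.span_base V.span_scale)
qed

text \<open>The correction term of the second inclusion-exclusion, at \<mu> plus the hub root. One
  hub raising leads to the hub-free layer, where the Serre relation for \<open>j\<close> already
  kills the ordered word.\<close>

lemma joint_kernel_layer_1:
  assumes w: "w \<in> joint_kernel {i, j, k} (down lam 1 1 2 2)"
  shows "w = 0"
proof -
  have wW: "w \<in> W 1 (Suc 0) 2 2" and Ew: "E i w = 0" "E j w = 0" "E k w = 0"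
    using w unfolding joint_kernel_def by auto
  have M: "w \<in> M" using wW by (rule weight_space_carrier)
  have "E j (E j (E c w)) = 0" using serre_leaf[of j w] M Ew by simp
  moreover have "E j (E j (E k (E k (E c w)))) = E k (E k (E j (E j (E c w))))"
    using M by (simp add: act_closed leaves_commute)
  ultimately have "E c w = 0"
    using hubless_eq_0[OF E_W(2)[OF wW]] by (simp add: numeral_2_eq_2)
  then show ?thesis using singular_eq_0[OF wW] Ew by simp
qed

end

subsection \<open>Construction of a singular vector\<close>

context highest_weight_module
begin

definition weight_op :: "('v \<Rightarrow> 'v) \<Rightarrow> ('g \<Rightarrow> complex) \<Rightarrow> bool" where
  "weight_op X \<beta> \<longleftrightarrow>
     (\<forall>u\<in>M. X u \<in> M) \<and> (\<forall>u\<in>M. \<forall>w\<in>M. X (u + w) = X u + X w) \<and>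
     (\<forall>u\<in>M. \<forall>x. X (scaleV x u) = scaleV x (X u)) \<and>
     (\<forall>\<nu>. \<forall>u\<in>weight_space H \<nu>. X u \<in> weight_space H (\<lambda>h. \<nu> h - \<beta> h))"

text \<open>If \<open>E p\<close> commutes with \<open>X\<close> and \<open>X\<close> raises the \<open>p\<close>-th label by one, this combination
  sends vectors of label \<open>n\<close> killed by \<open>E p\<close> to vectors killed by \<open>E p\<close>.\<close>

definition twist :: "'i \<Rightarrow> complex \<Rightarrow> ('v \<Rightarrow> 'v) \<Rightarrow> 'v \<Rightarrow> 'v" where
  "twist p n X u = scaleV n (F p (X u)) - scaleV (n + 1) (X (F p u))"

definition preserves_kernel :: "'i \<Rightarrow> complex \<Rightarrow> ('v \<Rightarrow> 'v) \<Rightarrow> bool" where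
  "preserves_kernel p n X \<longleftrightarrow>
     (\<forall>\<nu>. \<forall>u\<in>weight_space H \<nu>. E p u = 0 \<longrightarrow> \<nu> (simple_coroot p) = n \<longrightarrow> E p (X u) = 0)"

lemma preserves_kernelD:
  "preserves_kernel p n X \<Longrightarrow> u \<in> weight_space H \<nu> \<Longrightarrow> E p u = 0 \<Longrightarrow> \<nu> (simple_coroot p) = n \<Longrightarrow>
    E p (X u) = 0"
  unfolding preserves_kernel_def by blast

lemma weight_opD:
  assumes "weight_op X \<beta>"
  shows "u \<in> M \<Longrightarrow> X u \<in> M"
    and "u \<in> M \<Longrightarrow> w \<in> M \<Longrightarrow> X (u + w) = X u + X w"
    and "u \<in> M \<Longrightarrow> X (scaleV x u) = scaleV x (X u)"
    and "u \<in> weight_space H \<nu> \<Longrightarrow> X u \<in> weight_space H (\<lambda>h. \<nu> h - \<beta> h)"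
  using assms unfolding weight_op_def by auto

lemma weight_op_zero: "weight_op X \<beta> \<Longrightarrow> X 0 = 0"
  using weight_opD(3)[of X \<beta> 0 0] zero_in_carrier by simp

lemma weight_op_F: "p \<in> I \<Longrightarrow> weight_op (F p) (simple_root p)"
  unfolding weight_op_def using act_closed act_add act_scale F_weight by auto

lemma weight_op_twist:
  assumes X: "weight_op X \<beta>" and p: "p \<in> I"
  shows "weight_op (twist p n X) (\<lambda>h. \<beta> h + simple_root p h)"
  unfolding weight_op_def
proof (intro conjI ballI allI)
  note Xd = weight_opD[OF X]
  fix u assume u: "u \<in> M"
  show "twist p n X u \<in> M"
    unfolding twist_def by (intro diff_in_carrier scale_in_carrier) (simp_all add: u Xd(1) act_closed)
  show "twist p n X (scaleV x u) = scaleV x (twist p n X u)" for x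
    using u Xd(1,3) by (simp add: twist_def act_scale act_closed V.scale_right_diff_distrib mult.commute)
  fix w assume w: "w \<in> M"
  show "twist p n X (u + w) = twist p n X u + twist p n X w"
    using u w Xd(1,2) by (simp add: twist_def act_add act_closed V.scale_right_distrib)
next
  note Xd = weight_opD[OF X]
  fix \<nu> u assume u: "u \<in> weight_space H \<nu>"
  have 1: "F p (X u) \<in> weight_space H (\<lambda>h. \<nu> h - (\<beta> h + simple_root p h))"
    using F_weight[OF p Xd(4)[OF u]] by (simp add: diff_diff_eq)
  have "(\<lambda>h. \<nu> h - (\<beta> h + simple_root p h)) = (\<lambda>h. \<nu> h - simple_root p h - \<beta> h)"
    by (rule ext) simp
  then have 2: "X (F p u) \<in> weight_space H (\<lambda>h. \<nu> h - (\<beta> h + simple_root p h))"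
    using Xd(4)[OF F_weight[OF p u]] by simp
  show "twist p n X u \<in> weight_space H (\<lambda>h. \<nu> h - (\<beta> h + simple_root p h))"
    unfolding twist_def
    by (intro V.subspace_diff[OF subspace_weight_space] V.subspace_scale[OF subspace_weight_space] 1 2)
qed

lemma E_twist_commute:
  assumes X: "weight_op X \<beta>" and "\<And>u. u \<in> M \<Longrightarrow> E q (X u) = X (E q u)"
    and pq: "p \<in> I" "q \<in> I" "q \<noteq> p" and u: "u \<in> M"
  shows "E q (twist p n X u) = twist p n X (E q u)"
  using assms weight_opD(1)[OF X]
  by (simp add: twist_def act_diff act_scale scale_in_carrier act_closed E_F_distinct)

text \<open>For \<open>u\<close> of label \<open>n\<close>, \<open>X u\<close> has label
  \<open>n + 1\<close>; so \<open>E p\<close> sends \<open>F p (X u)\<close> to \<open>n + 1\<close>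
  times \<open>X u\<close> and \<open>X (F p u)\<close> to \<open>n\<close> times
  \<open>X u\<close>, and the crossed coefficients of \<open>twist\<close> make these
  cancel.\<close>

lemma preserves_kernel_twist_same:
  assumes X: "weight_op X \<beta>" and com: "\<And>u. u \<in> M \<Longrightarrow> E p (X u) = X (E p u)"
    and p: "p \<in> I" "\<beta> (simple_coroot p) = -1"
  shows "preserves_kernel p n (twist p n X)"
  unfolding preserves_kernel_def
proof (intro allI ballI impI)
  note Xd = weight_opD[OF X]
  fix \<nu> u assume u: "u \<in> weight_space H \<nu>" "E p u = 0" "\<nu> (simple_coroot p) = n"
  have M: "u \<in> M" using u(1) by (rule weight_space_carrier)
  have "E p (F p (X u)) = scaleV (n + 1) (X u)"
    using E_F_same[OF p(1) Xd(4)[OF u(1)]] com[OF M] u(2,3) p(2) weight_op_zero[OF X] by simp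
  moreover have "E p (X (F p u)) = scaleV n (X u)"
    using E_F_same[OF p(1) u(1)] com[OF act_closed[OF M]] u(2,3) Xd(3)[OF M] by simp
  ultimately show "E p (twist p n X u) = 0"
    using M Xd(1) by (simp add: twist_def act_diff act_scale scale_in_carrier act_closed mult.commute)
qed

text \<open>Lowering by an orthogonal node \<open>q\<close> changes neither the label at
  \<open>p\<close> nor the vanishing under \<open>E p\<close>.\<close>

lemma preserves_kernel_twist:
  assumes X: "weight_op X \<beta>" and ker: "preserves_kernel p n X"
    and pq: "p \<in> I" "q \<in> I" "p \<noteq> q" "C p q = 0"
  shows "preserves_kernel p n (twist q m X)"
  unfolding preserves_kernel_def
proof (intro allI ballI impI)
  fix \<nu> u assume u: "u \<in> weight_space H \<nu>" "E p u = 0" "\<nu> (simple_coroot p) = n"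
  have M: "u \<in> M" using u(1) by (rule weight_space_carrier)
  have "E p (X u) = 0" using ker u unfolding preserves_kernel_def by blast
  then have 1: "E p (F q (X u)) = 0"
    using E_F_distinct[OF pq(1-3)] weight_opD(1)[OF X M] by simp
  have "E p (F q u) = 0" using E_F_distinct[OF pq(1-3) M] u(2) by simp
  moreover have "\<nu> (simple_coroot p) - simple_root q (simple_coroot p) = n"
    using u(3) cartan_integer[OF pq(1,2)] pq(4) by simp
  ultimately have 2: "E p (X (F q u)) = 0"
    by (rule preserves_kernelD[OF ker F_weight[OF pq(2) u(1)]])
  show "E p (twist q m X u) = 0"
    using 1 2 M weight_opD(1)[OF X] by (simp add: twist_def act_diff act_scale scale_in_carrier act_closed)
qed

end

context D4_module
begin

text \<open>Lowering operators in the manner of Mickelsson's step algebras: \<open>F c\<close>,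
  corrected leaf by leaf so as to preserve the kernels of the leaf raising operators. The parameters
  are to be the labels of the vector operated on.\<close>

definition lower2 :: "complex \<Rightarrow> complex \<Rightarrow> 'v \<Rightarrow> 'v" where
  "lower2 m n = twist j m (twist k n (F c))"

definition lower3 :: "complex \<Rightarrow> complex \<Rightarrow> complex \<Rightarrow> 'v \<Rightarrow> 'v" where
  "lower3 l m n = twist i l (lower2 m n)"

lemma weight_op_lower:
  "weight_op (twist k n (F c)) (\<lambda>h. simple_root c h + simple_root k h)"
  "weight_op (lower2 m n) (\<lambda>h. simple_root c h + simple_root k h + simple_root j h)"
  "weight_op (lower3 l m n) (\<lambda>h. simple_root c h + simple_root k h + simple_root j h + simple_root i h)"
  unfolding lower3_def lower2_def by (intro weight_op_twist weight_op_F nodes)+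

lemma E_Fc_commute: "p \<in> {i, j, k} \<Longrightarrow> u \<in> M \<Longrightarrow> E p (F c u) = F c (E p u)"
  by (rule E_F_distinct) auto

lemma E_twist_Fc_commute:
  "p \<in> {i, j} \<Longrightarrow> u \<in> M \<Longrightarrow> E p (twist k n (F c) u) = twist k n (F c) (E p u)"
  by (rule E_twist_commute[OF weight_op_F]) (auto intro: E_Fc_commute)

lemma E_lower2_commute: "u \<in> M \<Longrightarrow> E i (lower2 m n u) = lower2 m n (E i u)"
  unfolding lower2_def by (rule E_twist_commute[OF weight_op_lower(1)]) (auto intro: E_twist_Fc_commute)

lemma preserves_kernel_lower2: "preserves_kernel k n (lower2 m n)" "preserves_kernel j m (lower2 m n)"
proof -
  have "preserves_kernel k n (twist k n (F c))"
    by (rule preserves_kernel_twist_same[OF weight_op_F])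
      (auto intro: E_Fc_commute simp: cartan_integer C_leaves)
  then show "preserves_kernel k n (lower2 m n)"
    unfolding lower2_def by (intro preserves_kernel_twist[OF weight_op_lower(1)]) (auto simp: C_leaves)
  show "preserves_kernel j m (lower2 m n)"
    unfolding lower2_def
    by (rule preserves_kernel_twist_same[OF weight_op_lower(1)])
      (auto intro: E_twist_Fc_commute simp: cartan_integer C_leaves)
qed

lemma preserves_kernel_lower3:
  "preserves_kernel k n (lower3 l m n)" "preserves_kernel j m (lower3 l m n)" "preserves_kernel i l (lower3 l m n)"
proof -
  show "preserves_kernel k n (lower3 l m n)" "preserves_kernel j m (lower3 l m n)"
    unfolding lower3_def
    by (intro preserves_kernel_twist[OF weight_op_lower(2)] preserves_kernel_lower2; simp add: C_leaves)+
  show "preserves_kernel i l (lower3 l m n)"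
    unfolding lower3_def
    by (rule preserves_kernel_twist_same[OF weight_op_lower(2)])
      (auto intro: E_lower2_commute simp: cartan_integer C_leaves)
qed

lemma E_twist_c:
  assumes "p \<in> {i, j, k}" "weight_op X \<beta>" "u \<in> M"
  shows "E c (twist p n X u) = scaleV n (F p (E c (X u))) - scaleV (n + 1) (E c (X (F p u)))"
  using assms weight_opD(1)[OF assms(2)] E_F_distinct[of c p]
  by (auto simp: twist_def act_diff act_scale scale_in_carrier act_closed)

text \<open>Since \<open>lam\<close> has hub label 0, the hub label of a weight without hub roots is
  its number of leaf roots, and \<open>E c (F c u)\<close> is that multiple of \<open>u\<close>.
  Each twist combines two such scalars at neighbouring weights, and the products with the leaf label
  cancel.\<close>

lemma E_lower2:
  assumes u: "u \<in> W ni 0 nj nk"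
  shows "E c (lower2 m n u) = scaleV (m + n + of_nat (ni + nj + nk) + 2) (F j (F k u))"
proof -
  have base: "E c (F c u) = scaleV (of_nat (ni + nj + nk)) u" if u: "u \<in> W ni 0 nj nk" for u ni nj nk
  proof -
    have "down lam ni 0 nj nk (simple_coroot c) = of_nat (ni + nj + nk)"
      by (simp add: down_label lam_labels)
    then show ?thesis using E_F_same[OF _ u, of c] E_outside_simps(2)[OF u] by simp
  qed
  have k1: "E c (twist k n (F c) u) = scaleV (- (n + of_nat (ni + nj + nk) + 1)) (F k u)"
    if u: "u \<in> W ni 0 nj nk" for u ni nj nk
  proof -
    have M: "u \<in> M" using u by (rule weight_space_carrier)
    have "E c (twist k n (F c) u) = scaleV n (scaleV (of_nat (ni + nj + nk)) (F k u))
      - scaleV (n + 1) (scaleV (of_nat (ni + nj + Suc nk)) (F k u))"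
      using E_twist_c[of k "F c", OF _ weight_op_F M] base[OF u] base[OF F_W(4)[OF u]] M
      by (simp add: act_scale)
    also have "\<dots> = scaleV (n * of_nat (ni + nj + nk) - (n + 1) * of_nat (ni + nj + Suc nk)) (F k u)"
      by (simp only: V.scale_scale V.scale_left_diff_distrib[symmetric])
    also have "n * of_nat (ni + nj + nk) - (n + 1) * of_nat (ni + nj + Suc nk) = - (n + of_nat (ni + nj + nk) + 1)"
      by (simp add: algebra_simps)
    finally show ?thesis .
  qed
  have M: "u \<in> M" using u by (rule weight_space_carrier)
  have "E c (lower2 m n u) = scaleV m (scaleV (- (n + of_nat (ni + nj + nk) + 1)) (F j (F k u)))
      - scaleV (m + 1) (scaleV (- (n + of_nat (ni + Suc nj + nk) + 1)) (F j (F k u)))"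
    unfolding lower2_def
    using E_twist_c[of j "twist k n (F c)", OF _ weight_op_lower(1) M] k1[OF u] k1[OF F_W(3)[OF u]] M
    by (simp add: act_scale act_closed leaves_commute)
  also have "\<dots> = scaleV (m * (- (n + of_nat (ni + nj + nk) + 1)) - (m + 1) * (- (n + of_nat (ni + Suc nj + nk) + 1))) (F j (F k u))"
    by (simp only: V.scale_scale V.scale_left_diff_distrib[symmetric])
  also have "m * (- (n + of_nat (ni + nj + nk) + 1)) - (m + 1) * (- (n + of_nat (ni + Suc nj + nk) + 1))
    = m + n + of_nat (ni + nj + nk) + 2"
    by (simp add: algebra_simps)
  finally show ?thesis .
qed

text \<open>Applied to a vector with one hub root, \<open>lower3\<close> creates a second one; two
  hub raisings remove both and leave one monomial in the leaf operators, with a scalar found as in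
  \<open>E_lower2\<close>.\<close>

lemma E_E_lower3:
  assumes u: "u \<in> W ni (Suc 0) nj nk"
  shows "E c (E c (lower3 l m n u))
    = scaleV (- 2 * (l + m + n + of_nat (ni + nj + nk) + 2)) (F i (F j (F k (E c u))))"
proof -
  have base: "E c (E c (F c u)) = scaleV (2 * of_nat (ni + nj + nk) - 2) (E c u)"
    if u: "u \<in> W ni (Suc 0) nj nk" for u ni nj nk
  proof -
    have M: "u \<in> M" using u by (rule weight_space_carrier)
    have w: "E c u \<in> W ni 0 nj nk" using E_W(2)[OF u] .
    have l1: "down lam ni (Suc 0) nj nk (simple_coroot c) = of_nat (ni + nj + nk) - 2"
      and l2: "down lam ni 0 nj nk (simple_coroot c) = of_nat (ni + nj + nk)"
      by (simp_all add: down_label lam_labels)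
    have "E c (F c u) = F c (E c u) + scaleV (of_nat (ni + nj + nk) - 2) u"
      using E_F_same[OF _ u, of c] l1 by simp
    then have "E c (E c (F c u)) = E c (F c (E c u)) + scaleV (of_nat (ni + nj + nk) - 2) (E c u)"
      using M by (simp add: act_add act_scale act_closed scale_in_carrier)
    also have "E c (F c (E c u)) = scaleV (of_nat (ni + nj + nk)) (E c u)"
      using E_F_same[OF _ w, of c] l2 E_outside_simps(2)[OF w] by simp
    finally show ?thesis by (simp flip: V.scale_left_distrib)
  qed
  have EE: "E c (E c (twist p n X u)) = scaleV n (F p (E c (E c (X u)))) - scaleV (n + 1) (E c (E c (X (F p u))))"
    if "p \<in> {i, j, k}" "weight_op X \<beta>" "u \<in> M" for p n X \<beta> u
    using that E_twist_c[OF that] weight_opD(1)[OF that(2)] E_F_distinct[of c p]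
    by (auto simp: act_diff act_scale scale_in_carrier act_closed)
  have k1: "E c (E c (twist k n (F c) u)) = scaleV (- 2 * (n + of_nat (ni + nj + nk))) (F k (E c u))"
    if u: "u \<in> W ni (Suc 0) nj nk" for u ni nj nk
  proof -
    have M: "u \<in> M" using u by (rule weight_space_carrier)
    have "E c (E c (twist k n (F c) u)) = scaleV n (scaleV (2 * of_nat (ni + nj + nk) - 2) (F k (E c u)))
      - scaleV (n + 1) (scaleV (2 * of_nat (ni + nj + Suc nk) - 2) (F k (E c u)))"
      using EE[of k "F c", OF _ weight_op_F M] base[OF u] base[OF F_W(4)[OF u]] M E_F_distinct[of c k]
      by (simp add: act_scale act_closed)
    also have "\<dots> = scaleV (n * (2 * of_nat (ni + nj + nk) - 2) - (n + 1) * (2 * of_nat (ni + nj + Suc nk) - 2)) (F k (E c u))"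
      by (simp only: V.scale_scale V.scale_left_diff_distrib[symmetric])
    also have "n * (2 * of_nat (ni + nj + nk) - 2) - (n + 1) * (2 * of_nat (ni + nj + Suc nk) - 2) = - 2 * (n + of_nat (ni + nj + nk))"
      by (simp add: algebra_simps)
    finally show ?thesis .
  qed
  have j1: "E c (E c (lower2 m n u)) = scaleV (2 * (m + n + of_nat (ni + nj + nk) + 1)) (F j (F k (E c u)))"
    if u: "u \<in> W ni (Suc 0) nj nk" for u ni nj nk
  proof -
    have M: "u \<in> M" using u by (rule weight_space_carrier)
    have "E c (E c (lower2 m n u)) = scaleV m (scaleV (- 2 * (n + of_nat (ni + nj + nk))) (F j (F k (E c u))))
      - scaleV (m + 1) (scaleV (- 2 * (n + of_nat (ni + Suc nj + nk))) (F j (F k (E c u))))"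
      unfolding lower2_def
      using EE[of j "twist k n (F c)", OF _ weight_op_lower(1) M] k1[OF u] k1[OF F_W(3)[OF u]] M E_F_distinct[of c j]
      by (simp add: act_scale act_closed leaves_commute)
    also have "\<dots> = scaleV (m * (- 2 * (n + of_nat (ni + nj + nk))) - (m + 1) * (- 2 * (n + of_nat (ni + Suc nj + nk)))) (F j (F k (E c u)))"
      by (simp only: V.scale_scale V.scale_left_diff_distrib[symmetric])
    also have "m * (- 2 * (n + of_nat (ni + nj + nk))) - (m + 1) * (- 2 * (n + of_nat (ni + Suc nj + nk)))
      = 2 * (m + n + of_nat (ni + nj + nk) + 1)"
      by (simp add: algebra_simps)
    finally show ?thesis .
  qed
  have M: "u \<in> M" using u by (rule weight_space_carrier)
  have "E c (E c (lower3 l m n u)) = scaleV l (scaleV (2 * (m + n + of_nat (ni + nj + nk) + 1)) (F i (F j (F k (E c u)))))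
    - scaleV (l + 1) (scaleV (2 * (m + n + of_nat (Suc ni + nj + nk) + 1)) (F i (F j (F k (E c u)))))"
    unfolding lower3_def
    using EE[of i "lower2 m n", OF _ weight_op_lower(2) M] j1[OF u] j1[OF F_W(1)[OF u]] M E_F_distinct[of c i]
    by (simp add: act_scale act_closed leaves_commute)
  also have "\<dots> = scaleV (l * (2 * (m + n + of_nat (ni + nj + nk) + 1)) - (l + 1) * (2 * (m + n + of_nat (Suc ni + nj + nk) + 1))) (F i (F j (F k (E c u))))"
    by (simp only: V.scale_scale V.scale_left_diff_distrib[symmetric])
  also have "l * (2 * (m + n + of_nat (ni + nj + nk) + 1)) - (l + 1) * (2 * (m + n + of_nat (Suc ni + nj + nk) + 1))
    = - 2 * (l + m + n + of_nat (ni + nj + nk) + 2)"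
    by (simp add: algebra_simps)
  finally show ?thesis .
qed

lemma F_W_nonzero:
  assumes u: "u \<in> W ni 0 nj nk" "u \<noteq> 0"
  shows "ni = 0 \<Longrightarrow> r \<le> a \<Longrightarrow> (F i ^^ r) u \<noteq> 0"
    and "nj = 0 \<Longrightarrow> r \<le> b + 2 \<Longrightarrow> (F j ^^ r) u \<noteq> 0"
    and "nk = 0 \<Longrightarrow> r \<le> d + 2 \<Longrightarrow> (F k ^^ r) u \<noteq> 0"
proof -
  show "(F i ^^ r) u \<noteq> 0" if "ni = 0" "r \<le> a"
    by (rule F_pow_nonzero[OF _ u(1) _ u(2) _ that(2)])
      (use that u E_outside_simps(1) in \<open>auto simp: down_label lam_labels\<close>)
  show "(F j ^^ r) u \<noteq> 0" if "nj = 0" "r \<le> b + 2"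
    by (rule F_pow_nonzero[OF _ u(1) _ u(2) _ that(2)])
      (use that u E_outside_simps(3) in \<open>auto simp: down_label lam_labels\<close>)
  show "(F k ^^ r) u \<noteq> 0" if "nk = 0" "r \<le> d + 2"
    by (rule F_pow_nonzero[OF _ u(1) _ u(2) _ that(2)])
      (use that u E_outside_simps(4) in \<open>auto simp: down_label lam_labels\<close>)
qed

text \<open>The constructed \<open>w\<close> is nonzero because two hub raisings turn it into a
  nonzero multiple of a monomial in the leaf operators applied to \<open>v\<close>. That monomial
  contains \<open>F i\<close> once, which is where \<open>a > 0\<close> enters.\<close>

lemma joint_kernel_nontrivial:
  assumes a: "a > 0"
  shows "\<exists>w\<in>joint_kernel {i, j, k} (down lam 1 2 2 2). w \<noteq> 0"
proof -
  let ?m = "of_nat (b + 2) :: complex" and ?n = "of_nat (d + 2) :: complex"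
  define h where "h = lower2 ?m ?n v"
  have M: "v \<in> M" by (rule v_in_carrier)
  have "(\<lambda>x. lam x - (simple_root c x + simple_root k x + simple_root j x)) = down lam 0 1 1 1"
    by (rule ext) (simp add: down_def)
  then have hW: "h \<in> W 0 1 1 1"
    using weight_opD(4)[OF weight_op_lower(2) v_weight] unfolding h_def by simp
  have "E j h = 0" "E k h = 0"
    using preserves_kernel_lower2 v_weight E_v lam_labels unfolding preserves_kernel_def h_def by auto
  moreover have "E i h = 0"
    unfolding h_def E_lower2_commute[OF M] using E_v weight_op_zero[OF weight_op_lower(2)] by simp
  ultimately have Eh: "E i h = 0" "E j h = 0" "E k h = 0" by auto
  have Ech: "E c h = scaleV (?m + ?n + 2) (F j (F k v))"
    using E_lower2[of v 0 0 0 ?m ?n] v_W unfolding h_def by simp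
  \<comment> \<open>The second corrected lowering starts from the weight of \<open>h\<close>, whose
    leaf labels these are.\<close>
  let ?l' = "of_nat (a + 1) :: complex" and ?m' = "of_nat (b + 1) :: complex" and ?n' = "of_nat (d + 1) :: complex"
  define w where "w = lower3 ?l' ?m' ?n' h"
  have labels: "down lam 0 1 1 1 (simple_coroot i) = ?l'" "down lam 0 1 1 1 (simple_coroot j) = ?m'"
    "down lam 0 1 1 1 (simple_coroot k) = ?n'"
    by (simp_all add: down_label lam_labels)
  have "(\<lambda>x. down lam 0 1 1 1 x - (simple_root c x + simple_root k x + simple_root j x + simple_root i x)) = down lam 1 2 2 2"
    by (rule ext) (simp add: down_def)
  then have "w \<in> W 1 2 2 2"
    using weight_opD(4)[OF weight_op_lower(3) hW] unfolding w_def by simp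
  moreover have "E k w = 0" "E j w = 0" "E i w = 0"
    using preserves_kernel_lower3[where l = ?l' and m = ?m' and n = ?n'] hW Eh labels unfolding preserves_kernel_def w_def by auto
  ultimately have wK: "w \<in> joint_kernel {i, j, k} (down lam 1 2 2 2)" unfolding joint_kernel_def by auto
  have "E c (E c w) = scaleV (- 2 * (?l' + ?m' + ?n' + of_nat (0 + 1 + 1) + 2)) (F i (F j (F k (E c h))))"
    unfolding w_def by (rule E_E_lower3) (use hW in simp)
  also have "F i (F j (F k (E c h))) = scaleV (?m + ?n + 2) (F i (F j (F j (F k (F k v)))))"
    unfolding Ech using M by (simp add: act_scale act_closed leaves_commute)
  finally have EEw: "E c (E c w) = scaleV (- 2 * (?l' + ?m' + ?n' + of_nat (0 + 1 + 1) + 2) * (?m + ?n + 2))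
      (F i (F j (F j (F k (F k v)))))" by simp
  have y: "F k (F k v) \<in> W 0 0 0 (Suc (Suc 0))" using F_W(4)[OF F_W(4)[OF v_W]] .
  have "(F k ^^ 2) v \<noteq> 0" by (rule F_W_nonzero(3)[OF v_W v_nonzero]) auto
  then have "F k (F k v) \<noteq> 0" by (simp add: numeral_2_eq_2)
  then have "(F j ^^ 2) (F k (F k v)) \<noteq> 0" by (rule F_W_nonzero(2)[OF y]) auto
  then have "F j (F j (F k (F k v))) \<noteq> 0" by (simp add: numeral_2_eq_2)
  then have "(F i ^^ 1) (F j (F j (F k (F k v)))) \<noteq> 0"
    by (rule F_W_nonzero(1)[OF F_W(3)[OF F_W(3)[OF y]]]) (use a in auto)
  then have "F i (F j (F j (F k (F k v)))) \<noteq> 0" by simp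
  \<comment> \<open>The scalar is \<open>- 2 * (a + b + d + 7) * (b + d + 6)\<close>.\<close>
  moreover have "- 2 * (?l' + ?m' + ?n' + of_nat (0 + 1 + 1) + 2) * (?m + ?n + 2) \<noteq> 0"
  proof -
    have "?l' + ?m' + ?n' + of_nat (0 + 1 + 1) + 2 = of_nat (a + b + d + 7)"
      "?m + ?n + 2 = of_nat (b + d + 6)" by simp_all
    then show ?thesis by (simp only: mult_eq_0_iff of_nat_eq_0_iff) simp
  qed
  ultimately have "E c (E c w) \<noteq> 0" unfolding EEw V.scale_eq_0_iff by blast
  then have "w \<noteq> 0" by auto
  then show ?thesis using wK by blast
qed

lemma dim_joint_kernel_122:
  "V.dim (joint_kernel {i, j, k} (down lam 1 2 2 2)) = (if a = 0 then 0 else 1)"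
proof (cases "a = 0")
  case True
  then have "joint_kernel {i, j, k} (down lam 1 2 2 2) = {0}"
    using joint_kernel_trivial V.subspace_0[OF subspace_joint_kernel] by blast
  then show ?thesis using True V.dim_eq_0_subspace[of "{}" "{0}"] by simp
next
  case False
  then show ?thesis using joint_kernel_nontrivial dim_joint_kernel_corner by auto
qed

lemma dim_joint_kernel_112: "V.dim (joint_kernel {i, j, k} (down lam 1 1 2 2)) = 0"
proof -
  have "joint_kernel {i, j, k} (down lam 1 1 2 2) = {0}"
    using joint_kernel_layer_1 V.subspace_0[OF subspace_joint_kernel] by blast
  then show ?thesis using V.dim_eq_0_subspace[of "{}" "{0}"] by simp
qed

subsection \<open>Small weight spaces\<close>

lemma Fc_v: "F c v = 0"
  using F_pow_v_eq_0[of c 0] lam_labels by simp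

lemma dim_W_0011: "V.dim (W 0 0 1 1) = 1"
proof (rule V.dim_span_1)
  show "F j (F k v) \<in> W 0 0 1 1" using F_W(3)[OF F_W(4)[OF v_W]] by simp
  have 1: "F k v \<noteq> 0" using F_W_nonzero(3)[OF v_W v_nonzero, of 1] by simp
  show "F j (F k v) \<noteq> 0" using F_W_nonzero(2)[OF F_W(4)[OF v_W] 1, of 1] by simp
  have "{word ps v |ps. set ps \<subseteq> I \<and> word_weight lam ps = down lam 0 0 1 1} \<subseteq> {F j (F k v)}"
  proof clarify
    fix ps assume "set ps \<subseteq> I" "word_weight lam ps = down lam 0 0 1 1"
    then have n: "length ps = 2" "count_list ps j = 1" "count_list ps k = 1" using word_counts by auto
    then obtain p q where "ps = [p, q]" by (auto simp: numeral_2_eq_2 length_Suc_conv)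
    then have "ps = [j, k] \<or> ps = [k, j]" using n by (auto split: if_splits)
    then show "word ps v = F j (F k v)" using v_in_carrier leaves_commute by auto
  qed
  from V.span_mono[OF this] show "W 0 0 1 1 \<subseteq> V.span {F j (F k v)}"
    using weight_space_words[OF down_dual[OF lam_dual], of 0 0 1 1] by blast
qed

text \<open>Of the six orders of the lowering operators two give zero because
  \<open>F c v = 0\<close>, and two agree because the leaves commute. Independence of the remaining
  three vectors is tested with \<open>E c\<close>, \<open>E j\<close> and
  \<open>E k\<close>.\<close>

lemma dim_W_0111: "V.dim (W 0 1 1 1) = 3"
proof -
  let ?u1 = "F j (F c (F k v))" and ?u2 = "F k (F c (F j v))" and ?u3 = "F c (F j (F k v))"
  have M: "v \<in> M" by (rule v_in_carrier)
  have vj: "F j v \<in> W 0 0 1 0" and vk: "F k v \<in> W 0 0 0 1" and vjk: "F j (F k v) \<in> W 0 0 1 1"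
    and vck: "F c (F k v) \<in> W 0 1 0 1" and vcj: "F c (F j v) \<in> W 0 1 1 0"
    using F_W(3)[OF v_W] F_W(4)[OF v_W] F_W(3)[OF F_W(4)[OF v_W]] F_W(2)[OF F_W(4)[OF v_W]] F_W(2)[OF F_W(3)[OF v_W]]
    by simp_all
  have sub: "{?u1, ?u2, ?u3} \<subseteq> W 0 1 1 1"
    using F_W(3)[OF vck] F_W(4)[OF vcj] F_W(2)[OF vjk] by simp
  have "{word ps v |ps. set ps \<subseteq> I \<and> word_weight lam ps = down lam 0 1 1 1} \<subseteq> {?u1, ?u2, ?u3, 0}"
  proof
    fix x assume "x \<in> {word ps v |ps. set ps \<subseteq> I \<and> word_weight lam ps = down lam 0 1 1 1}"
    then obtain ps where x: "x = word ps v" and ps: "set ps \<subseteq> I" "word_weight lam ps = down lam 0 1 1 1"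
      by blast
    then have n: "length ps = 3" "count_list ps c = 1" "count_list ps j = 1" "count_list ps k = 1"
      using word_counts by auto
    then obtain p q r where "ps = [p, q, r]" by (auto simp: numeral_3_eq_3 length_Suc_conv)
    then have "ps \<in> {[j, c, k], [k, c, j], [c, j, k], [c, k, j], [j, k, c], [k, j, c]}"
      using n by (auto split: if_splits)
    then show "x \<in> {?u1, ?u2, ?u3, 0}" unfolding x using M leaves_commute Fc_v by auto
  qed
  from V.span_mono[OF this] have sup: "W 0 1 1 1 \<subseteq> V.span {?u1, ?u2, ?u3}"
    using weight_space_words[OF down_dual[OF lam_dual], of 0 1 1 1]
    by (simp add: insert_commute[of _ 0])
  have vk0: "F k v \<noteq> 0" using F_W_nonzero(3)[OF v_W v_nonzero, of 1] by simp
  have vj0: "F j v \<noteq> 0" using F_W_nonzero(2)[OF v_W v_nonzero, of 1] by simp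
  have vjk0: "F j (F k v) \<noteq> 0" using F_W_nonzero(2)[OF vk vk0, of 1] by simp
  have Ecj: "E c (F c (F j v)) = F j v"
    using E_F_same[OF _ vj, of c] E_outside_simps(2)[OF vj] by (simp add: down_label lam_labels)
  have Eck: "E c (F c (F k v)) = F k v"
    using E_F_same[OF _ vk, of c] E_outside_simps(2)[OF vk] by (simp add: down_label lam_labels)
  have Ecjk: "E c (F c (F j (F k v))) = scaleV 2 (F j (F k v))"
    using E_F_same[OF _ vjk, of c] E_outside_simps(2)[OF vjk] by (simp add: down_label lam_labels)
  have ck0: "F c (F k v) \<noteq> 0" and cj0: "F c (F j v) \<noteq> 0" using Ecj Eck vj0 vk0 by auto
  have indep: "x = 0 \<and> y = 0 \<and> z = 0" if eq: "scaleV x ?u1 + scaleV y ?u2 + scaleV z ?u3 = 0" for x y z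
  proof -
    have lin: "act g (scaleV x ?u1 + scaleV y ?u2 + scaleV z ?u3)
      = scaleV x (act g ?u1) + scaleV y (act g ?u2) + scaleV z (act g ?u3)" for g
      using M by (simp add: act_add act_scale act_closed scale_in_carrier add_in_carrier)
    have "E c ?u1 = F j (F k v)" "E c ?u2 = F j (F k v)"
      using E_F_distinct[of c j "F c (F k v)"] E_F_distinct[of c k "F c (F j v)"] Ecj Eck M
      by (simp_all add: act_closed leaves_commute)
    then have "scaleV (x + y + z * 2) (F j (F k v)) = 0"
      using lin[of "e c"] eq Ecjk by (simp add: V.scale_left_distrib)
    then have e1: "x + y + z * 2 = 0" using vjk0 by simp
    have "E j ?u1 = scaleV (of_nat (b + 3)) (F c (F k v))"
      using E_F_same[OF _ vck, of j] E_outside_simps(3)[OF vck] by (simp add: down_label lam_labels)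
    moreover have "E j ?u2 = 0"
    proof -
      have "E j (F j v) = scaleV (of_nat (b + 2)) v"
        using E_F_same[OF _ v_W, of j] E_outside_simps(3)[OF v_W] by (simp add: lam_labels)
      then show ?thesis using M E_F_distinct[of j k] E_F_distinct[of j c] Fc_v
        by (simp add: act_closed act_scale)
    qed
    moreover have "E j ?u3 = scaleV (of_nat (b + 2)) (F c (F k v))"
      using E_F_same[OF _ vk, of j] E_outside_simps(3)[OF vk] M E_F_distinct[of j c "F j (F k v)"]
      by (simp add: act_closed act_scale down_label lam_labels)
    ultimately have "scaleV (x * of_nat (b + 3) + z * of_nat (b + 2)) (F c (F k v)) = 0"
      using lin[of "e j"] eq by (simp add: V.scale_left_distrib V.scale_right_distrib distrib_left)
    then have e2: "x * of_nat (b + 3) + z * of_nat (b + 2) = 0" using ck0 by simp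
    have "E k ?u2 = scaleV (of_nat (d + 3)) (F c (F j v))"
      using E_F_same[OF _ vcj, of k] E_outside_simps(4)[OF vcj] by (simp add: down_label lam_labels)
    moreover have "E k ?u1 = 0"
    proof -
      have "E k (F k v) = scaleV (of_nat (d + 2)) v"
        using E_F_same[OF _ v_W, of k] E_outside_simps(4)[OF v_W] by (simp add: lam_labels)
      then show ?thesis using M E_F_distinct[of k j] E_F_distinct[of k c] Fc_v
        by (simp add: act_closed act_scale)
    qed
    moreover have "E k ?u3 = scaleV (of_nat (d + 2)) (F c (F j v))"
    proof -
      have "E k (F k v) = scaleV (of_nat (d + 2)) v"
        using E_F_same[OF _ v_W, of k] E_outside_simps(4)[OF v_W] by (simp add: lam_labels)
      then show ?thesis using M E_F_distinct[of k j] E_F_distinct[of k c]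
        by (simp add: act_closed act_scale)
    qed
    ultimately have "scaleV (y * of_nat (d + 3) + z * of_nat (d + 2)) (F c (F j v)) = 0"
      using lin[of "e k"] eq by (simp add: V.scale_left_distrib V.scale_right_distrib distrib_left)
    then have e3: "y * of_nat (d + 3) + z * of_nat (d + 2) = 0" using cj0 by simp
    \<comment> \<open>The combination of the three equations that eliminates \<open>x\<close> and
      \<open>y\<close>.\<close>
    have "z * of_nat (b + d + 6) = 0"
    proof -
      have "z * of_nat (b + d + 6) = of_nat (b + 3) * of_nat (d + 3) * (x + y + z * 2)
        - of_nat (d + 3) * (x * of_nat (b + 3) + z * of_nat (b + 2))
        - of_nat (b + 3) * (y * of_nat (d + 3) + z * of_nat (d + 2))"
        by (simp add: algebra_simps)
      then show ?thesis unfolding e1 e2 e3 by simp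
    qed
    then have z: "z = 0" unfolding mult_eq_0_iff of_nat_eq_0_iff by simp
    then have "x * of_nat (b + 3) = 0" "y * of_nat (d + 3) = 0" using e2 e3 by simp_all
    then show ?thesis using z unfolding mult_eq_0_iff of_nat_eq_0_iff by simp
  qed
  show ?thesis by (rule V.dim_span_3[OF indep sup sub])
qed

end

section \<open>Inclusion-exclusion over the leaves and reflections of small weights\<close>

context D4_module
begin

lemma down_dominant:
  assumes "2 * ni \<le> a + nc" "2 * nc \<le> ni + nj + nk" "2 * nj \<le> b + 2 + nc" "2 * nk \<le> d + 2 + nc"
  shows "down lam ni nc nj nk \<in> dominant_weights"
proof -
  have "down lam ni nc nj nk (simple_coroot i) = of_nat (a + nc - 2 * ni)"
    "down lam ni nc nj nk (simple_coroot c) = of_nat (ni + nj + nk - 2 * nc)"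
    "down lam ni nc nj nk (simple_coroot j) = of_nat (b + 2 + nc - 2 * nj)"
    "down lam ni nc nj nk (simple_coroot k) = of_nat (d + 2 + nc - 2 * nk)"
    using assms by (simp_all add: down_label lam_labels of_nat_diff)
  then show ?thesis
    unfolding dominant_weights_def weight_lattice_def dynkin_label_def ball_I
    using down_dual[OF lam_dual] by (auto simp: ball_I)
qed

lemma dim_joint_kernel_leaf:
  assumes "Q \<subseteq> {i, j, k}"
  shows "i \<notin> Q \<Longrightarrow> 2 * ni < a + nc \<Longrightarrow> V.dim (joint_kernel Q (down lam (Suc ni) nc nj nk))
      = V.dim (joint_kernel Q (down lam ni nc nj nk)) + V.dim (joint_kernel (insert i Q) (down lam (Suc ni) nc nj nk))"
    and "j \<notin> Q \<Longrightarrow> 2 * nj < b + 2 + nc \<Longrightarrow> V.dim (joint_kernel Q (down lam ni nc (Suc nj) nk))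
      = V.dim (joint_kernel Q (down lam ni nc nj nk)) + V.dim (joint_kernel (insert j Q) (down lam ni nc (Suc nj) nk))"
    and "k \<notin> Q \<Longrightarrow> 2 * nk < d + 2 + nc \<Longrightarrow> V.dim (joint_kernel Q (down lam ni nc nj (Suc nk)))
      = V.dim (joint_kernel Q (down lam ni nc nj nk)) + V.dim (joint_kernel (insert k Q) (down lam ni nc nj (Suc nk)))"
proof -
  have Q: "q \<in> I \<and> q \<noteq> p \<and> C p q = 0" if "q \<in> Q" "p \<notin> Q" "p \<in> {i, j, k}" for p q
  proof -
    have "q \<in> I" "p \<in> I" "q \<noteq> p" "p \<noteq> c" "q \<noteq> c" using that assms by auto
    then show ?thesis by (simp add: C_eq)
  qed
  note dual = down_dual[OF lam_dual]
  show "V.dim (joint_kernel Q (down lam (Suc ni) nc nj nk))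
      = V.dim (joint_kernel Q (down lam ni nc nj nk)) + V.dim (joint_kernel (insert i Q) (down lam (Suc ni) nc nj nk))"
    if "i \<notin> Q" "2 * ni < a + nc"
  proof -
    have "down lam (Suc ni) nc nj nk (simple_coroot i) = of_int (int a - 2 * int (Suc ni) + int nc)"
      unfolding down_label by (simp add: lam_labels)
    from dim_joint_kernel[OF _ Q dual this] show ?thesis using that by (simp add: down_add)
  qed
  show "V.dim (joint_kernel Q (down lam ni nc (Suc nj) nk))
      = V.dim (joint_kernel Q (down lam ni nc nj nk)) + V.dim (joint_kernel (insert j Q) (down lam ni nc (Suc nj) nk))"
    if "j \<notin> Q" "2 * nj < b + 2 + nc"
  proof -
    have "down lam ni nc (Suc nj) nk (simple_coroot j) = of_int (int b + 2 - 2 * int (Suc nj) + int nc)"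
      unfolding down_label by (simp add: lam_labels)
    from dim_joint_kernel[OF _ Q dual this] show ?thesis using that by (simp add: down_add)
  qed
  show "V.dim (joint_kernel Q (down lam ni nc nj (Suc nk)))
      = V.dim (joint_kernel Q (down lam ni nc nj nk)) + V.dim (joint_kernel (insert k Q) (down lam ni nc nj (Suc nk)))"
    if "k \<notin> Q" "2 * nk < d + 2 + nc"
  proof -
    have "down lam ni nc nj (Suc nk) (simple_coroot k) = of_int (int d + 2 - 2 * int (Suc nk) + int nc)"
      unfolding down_label by (simp add: lam_labels)
    from dim_joint_kernel[OF _ Q dual this] show ?thesis using that by (simp add: down_add)
  qed
qed

text \<open>Leaf steps telescoped over the eight corners of a cube; terms stand on the side where
  they are positive because dimensions are natural numbers. The hypotheses say that the leaf labels
  at the lowest corner are at least -1.\<close>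

lemma dim_joint_kernel_alternating:
  assumes "2 * ni < a + nc" "2 * nj < b + 2 + nc" "2 * nk < d + 2 + nc"
  shows "V.dim (W (Suc ni) nc (Suc nj) (Suc nk)) + V.dim (W ni nc nj (Suc nk)) + V.dim (W ni nc (Suc nj) nk)
      + V.dim (W (Suc ni) nc nj nk)
    = V.dim (W ni nc (Suc nj) (Suc nk)) + V.dim (W (Suc ni) nc nj (Suc nk)) + V.dim (W (Suc ni) nc (Suc nj) nk)
      + V.dim (W ni nc nj nk) + V.dim (joint_kernel {i, j, k} (down lam (Suc ni) nc (Suc nj) (Suc nk)))"
proof -
  have I: "V.dim (W (Suc ni) nc mj mk) = V.dim (W ni nc mj mk) + V.dim (joint_kernel {i} (down lam (Suc ni) nc mj mk))" for mj mk
    using dim_joint_kernel_leaf(1)[of "{}"] assms(1) by simp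
  have J: "V.dim (joint_kernel {i} (down lam (Suc ni) nc (Suc nj) mk))
    = V.dim (joint_kernel {i} (down lam (Suc ni) nc nj mk)) + V.dim (joint_kernel {j, i} (down lam (Suc ni) nc (Suc nj) mk))" for mk
    using dim_joint_kernel_leaf(2)[of "{i}"] assms(2) by simp
  have K: "V.dim (joint_kernel {j, i} (down lam (Suc ni) nc (Suc nj) (Suc nk)))
    = V.dim (joint_kernel {j, i} (down lam (Suc ni) nc (Suc nj) nk)) + V.dim (joint_kernel {k, j, i} (down lam (Suc ni) nc (Suc nj) (Suc nk)))"
    using dim_joint_kernel_leaf(3)[of "{j, i}"] assms(3) by simp
  have "{k, j, i} = {i, j, k}" by blast
  then show ?thesis using I[of "Suc nj" "Suc nk"] I[of nj "Suc nk"] I[of "Suc nj" nk] I[of nj nk] J[of "Suc nk"] J[of nk] K by simp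
qed

lemma dim_W_reflect:
  assumes "p \<in> I" "down lam ni nc nj nk (simple_coroot p) = of_int m"
    and "\<And>h. down lam ni' nc' nj' nk' h = down lam ni nc nj nk h - of_int m * simple_root p h"
  shows "V.dim (W ni nc nj nk) = V.dim (W ni' nc' nj' nk')"
proof -
  have "down lam ni' nc' nj' nk' = (\<lambda>h. down lam ni nc nj nk h - of_int m * simple_root p h)"
    using assms(3) by blast
  then show ?thesis using dim_weight_space_reflect[OF assms(1) down_dual[OF lam_dual] assms(2)] by simp
qed

text \<open>Every left-hand weight has a label -1 or -2, at the hub or at a leaf where the label of
  \<mu> is zero.\<close>

lemma dim_W_reflections:
  shows "V.dim (W 0 2 1 2) = V.dim (W 0 1 1 2)"
    and "V.dim (W 0 2 2 1) = V.dim (W 0 1 2 1)"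
    and "V.dim (W 1 2 1 1) = V.dim (W 1 1 1 1)"
    and "V.dim (W 0 2 1 1) = 1"
    and "a = 0 \<Longrightarrow> V.dim (W 1 1 1 1) = 3"
    and "b = 0 \<Longrightarrow> V.dim (W 0 1 2 1) = 3"
    and "d = 0 \<Longrightarrow> V.dim (W 0 1 1 2) = 3"
proof -
  show "V.dim (W 0 2 1 2) = V.dim (W 0 1 1 2)" "V.dim (W 0 2 2 1) = V.dim (W 0 1 2 1)"
    "V.dim (W 1 2 1 1) = V.dim (W 1 1 1 1)"
    by (rule dim_W_reflect[of c _ _ _ _ "-1"]; simp add: down_label lam_labels; simp add: down_def)+
  have "V.dim (W 0 2 1 1) = V.dim (W 0 0 1 1)"
    by (rule dim_W_reflect[of c _ _ _ _ "-2"]; simp add: down_label lam_labels; simp add: down_def)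
  then show "V.dim (W 0 2 1 1) = 1" using dim_W_0011 by simp
  have "V.dim (W 1 1 1 1) = V.dim (W 0 1 1 1)" if "a = 0"
    by (rule dim_W_reflect[of i _ _ _ _ "-1"]; simp add: down_label lam_labels that; simp add: down_def)
  then show "a = 0 \<Longrightarrow> V.dim (W 1 1 1 1) = 3" using dim_W_0111 by simp
  have "V.dim (W 0 1 2 1) = V.dim (W 0 1 1 1)" if "b = 0"
    by (rule dim_W_reflect[of j _ _ _ _ "-1"]; simp add: down_label lam_labels that; simp add: down_def)
  then show "b = 0 \<Longrightarrow> V.dim (W 0 1 2 1) = 3" using dim_W_0111 by simp
  have "V.dim (W 0 1 1 2) = V.dim (W 0 1 1 1)" if "d = 0"
    by (rule dim_W_reflect[of k _ _ _ _ "-1"]; simp add: down_label lam_labels that; simp add: down_def)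
  then show "d = 0 \<Longrightarrow> V.dim (W 0 1 1 2) = 3" using dim_W_0111 by simp
qed

text \<open>The cubes with lowest corner \<mu> and with lowest corner \<mu> plus the hub root. Hub
  reflections identify the last three terms on the left of the first relation with those of the
  second.\<close>

lemma dim_W_relations:
  shows "V.dim (W 1 2 2 2) + V.dim (W 0 2 1 2) + V.dim (W 0 2 2 1) + V.dim (W 1 2 1 1)
    = V.dim (W 0 2 2 2) + V.dim (W 1 2 1 2) + V.dim (W 1 2 2 1) + 1 + (if a = 0 then 0 else 1)"
    and "V.dim (W 1 1 2 2) + V.dim (W 0 1 1 2) + V.dim (W 0 1 2 1) + V.dim (W 1 1 1 1)
    = V.dim (W 0 1 2 2) + V.dim (W 1 1 1 2) + V.dim (W 1 1 2 1) + 3"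
  using dim_joint_kernel_alternating[of 0 2 1 1] dim_joint_kernel_alternating[of 0 1 1 1]
    dim_joint_kernel_122 dim_joint_kernel_112 dim_W_0111 dim_W_reflections(4)
  by (simp_all add: numeral_2_eq_2)

end

section \<open>The atomic number\<close>

lemma (in D4_type) finite_dominant_below:
  assumes lam: "lam \<in> dominant_weights"
  shows "finite {\<kappa> \<in> dominant_weights. root_le \<kappa> lam}"
proof -
  have dual: "\<kappa> \<in> dual_space H" if "\<kappa> \<in> dominant_weights" for \<kappa>
    using that unfolding dominant_weights_def weight_lattice_def by blast
  have label: "\<exists>n. \<kappa> (simple_coroot p) = of_nat n" if "\<kappa> \<in> dominant_weights" "p \<in> I" for \<kappa> p
    using that unfolding dominant_weights_def dynkin_label_def Nats_def by auto
  obtain a s b d :: nat where l: "lam (simple_coroot i) = of_nat a" "lam (simple_coroot c) = of_nat s"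
    "lam (simple_coroot j) = of_nat b" "lam (simple_coroot k) = of_nat d"
    using label[OF lam nodes(1)] label[OF lam nodes(2)] label[OF lam nodes(3)] label[OF lam nodes(4)] by blast
  let ?N = "2 * (a + s + b + d)"
  have "{\<kappa> \<in> dominant_weights. root_le \<kappa> lam}
    \<subseteq> (\<lambda>(ni, nc, nj, nk). down lam ni nc nj nk) ` ({..?N} \<times> {..?N} \<times> {..?N} \<times> {..?N})"
  proof clarify
    fix \<kappa> assume \<kappa>: "\<kappa> \<in> dominant_weights" "root_le \<kappa> lam"
    then obtain n :: "'i \<Rightarrow> nat" where n: "\<forall>h\<in>H. lam h - \<kappa> h = (\<Sum>i\<in>I. of_nat (n i) * simple_root i h)"
      unfolding root_le_def by (elim exE)
    have eq: "\<kappa> = down lam (n i) (n c) (n j) (n k)"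
    proof (rule dual_space_eqI[OF dual[OF \<kappa>(1)] down_dual[OF dual[OF lam]]])
      fix h assume "h \<in> H"
      then have "lam h - \<kappa> h = of_nat (n i) * simple_root i h + of_nat (n c) * simple_root c h
        + of_nat (n j) * simple_root j h + of_nat (n k) * simple_root k h"
        using n by (simp add: sum_I)
      then show "\<kappa> h = down lam (n i) (n c) (n j) (n k) h"
        unfolding down_def by (metis diff_diff_eq2 add_diff_cancel_left')
    qed
    obtain a' e' b' d' :: nat where l': "\<kappa> (simple_coroot i) = of_nat a'" "\<kappa> (simple_coroot c) = of_nat e'"
      "\<kappa> (simple_coroot j) = of_nat b'" "\<kappa> (simple_coroot k) = of_nat d'"
      using label[OF \<kappa>(1) nodes(1)] label[OF \<kappa>(1) nodes(2)] label[OF \<kappa>(1) nodes(3)]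
        label[OF \<kappa>(1) nodes(4)] by blast
    have "of_nat (a' + 2 * n i) = (of_nat (a + n c) :: complex)"
      "of_nat (b' + 2 * n j) = (of_nat (b + n c) :: complex)"
      "of_nat (d' + 2 * n k) = (of_nat (d + n c) :: complex)"
      "of_nat (e' + 2 * n c) = (of_nat (s + n i + n j + n k) :: complex)"
      using l' unfolding eq down_label l by (simp_all flip: l' add: algebra_simps)
    then have eqs: "a' + 2 * n i = a + n c" "b' + 2 * n j = b + n c"
      "d' + 2 * n k = d + n c" "e' + 2 * n c = s + n i + n j + n k"
      unfolding of_nat_eq_iff by simp_all
    \<comment> \<open>Doubling the hub equation and inserting the leaf equations gives
      \<open>w \<le> 2 * s + a + b + d\<close>.\<close>
    have "w \<le> 2 * (a + s + b + d)"
      if "a' + 2 * x = a + w" "b' + 2 * y = b + w" "d' + 2 * z = d + w" "e' + 2 * w = s + x + y + z"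
      for x y z w :: nat
      using that by presburger
    from this[OF eqs] have "n c \<le> ?N" .
    moreover from this have "n i \<le> ?N" "n j \<le> ?N" "n k \<le> ?N" using eqs by simp_all
    ultimately show "\<kappa> \<in> (\<lambda>(ni, nc, nj, nk). down lam ni nc nj nk) ` ({..?N} \<times> {..?N} \<times> {..?N} \<times> {..?N})"
      using eq by (intro image_eqI[of _ _ "(n i, n c, n j, n k)"]) auto
  qed
  then show ?thesis by (rule finite_subset) simp
qed

locale D4_modules =
  cartan_type_modules scale bracket H I simple_root simple_coroot C \<rho> scaleV V act +
  D4_type scale bracket H I simple_root simple_coroot C \<rho> c i j k
  for scale :: "complex \<Rightarrow> 'g::ab_group_add \<Rightarrow> 'g" and bracket :: "'g \<Rightarrow> 'g \<Rightarrow> 'g"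
    and H :: "'g set" and I :: "'i set"
    and simple_root :: "'i \<Rightarrow> 'g \<Rightarrow> complex" and simple_coroot :: "'i \<Rightarrow> 'g"
    and C :: "'i \<Rightarrow> 'i \<Rightarrow> int" and \<rho> :: 'g
    and scaleV :: "complex \<Rightarrow> 'v::ab_group_add \<Rightarrow> 'v"
    and V :: "('g \<Rightarrow> complex) \<Rightarrow> 'v set" and act :: "('g \<Rightarrow> complex) \<Rightarrow> 'g \<Rightarrow> 'v \<Rightarrow> 'v"
    and c i j k :: 'i
begin

lemma D4_module_exists:
  assumes "lam \<in> dominant_weights" "lam (simple_coroot i) = of_nat a" "lam (simple_coroot c) = 0"
    "lam (simple_coroot j) = of_nat (b + 2)" "lam (simple_coroot k) = of_nat (d + 2)"
  shows "\<exists>v. D4_module scale bracket H I simple_root simple_coroot C \<rho> scaleV (V lam) (act lam) lam v c i j k a b d"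
proof -
  obtain v where "is_hw_module lam v"
    using highest_weight_module[OF assms(1)] ..
  then have "D4_module scale bracket H I simple_root simple_coroot C \<rho> scaleV (V lam) (act lam) lam v c i j k a b d"
    unfolding D4_module_def D4_module_axioms_def using D4_type_axioms assms by blast
  then show ?thesis ..
qed

lemma atomic_number_sum:
  assumes lam: "lam \<in> dominant_weights" and \<nu>: "\<nu> \<in> dominant_weights"
  shows "ch lam \<nu> = (\<Sum>\<kappa> | atomic_number \<kappa> lam \<noteq> 0. atomic_number \<kappa> lam * of_bool (root_le \<nu> \<kappa>))"
proof -
  note ex = atomic_number_expansion[OF lam finite_dominant_below[OF lam], unfolded expansion_def]
  have "ch lam \<nu> = (\<Sum>\<kappa> | atomic_number \<kappa> lam \<noteq> 0. atomic_number \<kappa> lam * Theta \<kappa> \<nu>)"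
    using ex dominant_dual[OF \<nu>] by blast
  also have "\<dots> = (\<Sum>\<kappa> | atomic_number \<kappa> lam \<noteq> 0. atomic_number \<kappa> lam * of_bool (root_le \<nu> \<kappa>))"
    using ex by (intro sum.cong refl) (simp add: Theta_dominant[OF _ \<nu>] subset_iff)
  finally show ?thesis .
qed

text \<open>The interval above \<open>\<mu>\<close>: a dominant \<open>\<kappa> = \<mu> + \<Sum>q. g q * \<alpha>\<^sub>q\<close> is compared with the
  weights \<open>lam - \<Sum>q. n q * \<alpha>\<^sub>q\<close>, where \<open>\<mu>\<close> itself has \<open>n = (1, 2, 2, 2)\<close>.\<close>

lemma above_coordinates:
  assumes \<mu>: "\<mu> = down lam 1 2 2 2" and lam: "lam \<in> dual_space H"
    and l: "\<mu> (simple_coroot i) = of_nat a" "\<mu> (simple_coroot c) = 1"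
      "\<mu> (simple_coroot j) = of_nat b" "\<mu> (simple_coroot k) = of_nat d"
    and \<kappa>: "\<kappa> \<in> dominant_weights" "root_le \<mu> \<kappa>"
  obtains gi gc gj gk :: nat where
    "\<And>ni nc nj nk. root_le (down lam ni nc nj nk) \<kappa> \<longleftrightarrow>
       1 \<le> gi + ni \<and> 2 \<le> gc + nc \<and> 2 \<le> gj + nj \<and> 2 \<le> gk + nk"
    "\<kappa> = \<mu> \<longleftrightarrow> gi = 0 \<and> gc = 0 \<and> gj = 0 \<and> gk = 0"
    "gc \<le> a + 2 * gi" "gi + gj + gk \<le> 2 * gc + 1" "gc \<le> b + 2 * gj" "gc \<le> d + 2 * gk"
proof -
  obtain g :: "'i \<Rightarrow> nat" where g: "\<forall>h\<in>H. \<kappa> h - \<mu> h = (\<Sum>q\<in>I. of_nat (g q) * simple_root q h)"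
    using \<kappa>(2) unfolding root_le_def by (elim exE)
  have \<kappa>eq: "\<kappa> h = \<mu> h + of_nat (g i) * simple_root i h + of_nat (g c) * simple_root c h
      + of_nat (g j) * simple_root j h + of_nat (g k) * simple_root k h" if "h \<in> H" for h
  proof -
    have "\<kappa> h = \<mu> h + (\<kappa> h - \<mu> h)" by simp
    then show ?thesis using g that by (simp add: sum_I add.assoc)
  qed
  have \<mu>d: "\<mu> \<in> dual_space H" unfolding \<mu> by (rule down_dual[OF lam])
  have le: "root_le (down lam ni nc nj nk) \<kappa> \<longleftrightarrow>
      1 \<le> g i + ni \<and> 2 \<le> g c + nc \<and> 2 \<le> g j + nj \<and> 2 \<le> g k + nk" for ni nc nj nk
  proof -
    let ?z = "\<lambda>q. int (g q) + (if q = i then int ni - 1 else if q = c then int nc - 2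
      else if q = j then int nj - 2 else int nk - 2)"
    have "\<kappa> h - down lam ni nc nj nk h = (\<Sum>q\<in>I. of_int (?z q) * simple_root q h)" if "h \<in> H" for h
      unfolding \<kappa>eq[OF that] unfolding \<mu> sum_I by (simp add: down_def algebra_simps)
    from root_le_iff[of \<kappa> "down lam ni nc nj nk" ?z, OF this] show ?thesis unfolding ball_I by auto
  qed
  have eq: "\<kappa> = \<mu> \<longleftrightarrow> g i = 0 \<and> g c = 0 \<and> g j = 0 \<and> g k = 0"
  proof
    assume "\<kappa> = \<mu>"
    then have "(\<Sum>q\<in>I. of_nat (g q) * simple_root q h) = (\<Sum>q\<in>I. 0 * simple_root q h)" if "h \<in> H" for h
      using g that by simp
    from simple_roots_unique[of "\<lambda>q. of_nat (g q)" "\<lambda>_. 0", OF this] have "g q = 0" if "q \<in> I" for q using that by simp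
    then show "g i = 0 \<and> g c = 0 \<and> g j = 0 \<and> g k = 0" by simp
  next
    assume "g i = 0 \<and> g c = 0 \<and> g j = 0 \<and> g k = 0"
    then show "\<kappa> = \<mu>" using \<kappa>eq by (intro dual_space_eqI[OF dominant_dual[OF \<kappa>(1)] \<mu>d]) simp
  qed
  have label: "\<exists>n. \<kappa> (simple_coroot p) = of_nat n" if "p \<in> I" for p
    using \<kappa>(1) that unfolding dominant_weights_def dynkin_label_def Nats_def by auto
  obtain a' e' b' d' :: nat where l': "\<kappa> (simple_coroot i) = of_nat a'" "\<kappa> (simple_coroot c) = of_nat e'"
    "\<kappa> (simple_coroot j) = of_nat b'" "\<kappa> (simple_coroot k) = of_nat d'"
    using label[OF nodes(1)] label[OF nodes(2)] label[OF nodes(3)] label[OF nodes(4)] by blast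
  have "of_nat (a' + g c) = (of_nat (a + 2 * g i) :: complex)"
    "of_nat (b' + g c) = (of_nat (b + 2 * g j) :: complex)"
    "of_nat (d' + g c) = (of_nat (d + 2 * g k) :: complex)"
    "of_nat (e' + g i + g j + g k) = (of_nat (2 * g c + 1) :: complex)"
    using \<kappa>eq[OF simple_coroot_in_H[OF nodes(2)]] \<kappa>eq[OF simple_coroot_in_H[OF nodes(3)]]
      \<kappa>eq[OF simple_coroot_in_H[OF nodes(4)]] \<kappa>eq[OF simple_coroot_in_H[OF nodes(1)]]
    unfolding l l' by (simp_all add: cartan_integer C_leaves)
  then have "a' + g c = a + 2 * g i" "b' + g c = b + 2 * g j" "d' + g c = d + 2 * g k"
    "e' + g i + g j + g k = 2 * g c + 1"
    unfolding of_nat_eq_iff by simp_all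
  then show ?thesis by (intro that[of "g i" "g c" "g j" "g k"] le eq) linarith+
qed

text \<open>The coefficients below are the values of the Moebius function of the root order on the
  interval above \<open>\<mu>\<close>. Its atoms are \<open>\<mu> + \<alpha>\<^sub>p\<close> for the leaves \<open>p\<close>, and \<open>\<mu> + \<alpha>\<^sub>c\<close> if all the
  labels of \<open>\<mu>\<close> are positive.\<close>

theorem atomic_number_D4:
  assumes lam: "lam \<in> dominant_weights" and \<mu>: "\<mu> = down lam 1 2 2 2"
    and l: "\<mu> (simple_coroot i) = of_nat a" "\<mu> (simple_coroot c) = 1"
      "\<mu> (simple_coroot j) = of_nat b" "\<mu> (simple_coroot k) = of_nat d"
  shows "atomic_number \<mu> lam = (if a = 0 then -2 else -1)"
proof -
  note lamd = dominant_dual[OF lam]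
  have ll: "lam (simple_coroot i) = of_nat a" "lam (simple_coroot c) = 0"
    "lam (simple_coroot j) = of_nat (b + 2)" "lam (simple_coroot k) = of_nat (d + 2)"
    using l unfolding \<mu> down_label by (simp_all add: algebra_simps)
  obtain v where "D4_module scale bracket H I simple_root simple_coroot C \<rho> scaleV (V lam) (act lam) lam v c i j k a b d"
    using D4_module_exists[OF lam ll] ..
  then interpret D4_module scale bracket H I simple_root simple_coroot C \<rho> scaleV "V lam" "act lam" lam v c i j k a b d .
  define m where "m ni nc nj nk = ch lam (down lam ni nc nj nk)" for ni nc nj nk
  have m: "m ni nc nj nk = int (V.dim (W ni nc nj nk))" for ni nc nj nk
    unfolding m_def ch_def ..
  define L where "L ni nc nj nk \<kappa> = (of_bool (root_le (down lam ni nc nj nk) \<kappa>) :: int)" for ni nc nj nk \<kappa>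
  define A where "A \<kappa> = atomic_number \<kappa> lam" for \<kappa>
  define S where "S = {\<kappa>. A \<kappa> \<noteq> 0}"
  have S: "finite S" "S \<subseteq> dominant_weights"
    using atomic_number_expansion[OF lam finite_dominant_below[OF lam], unfolded expansion_def]
    unfolding S_def A_def by auto
  have mL: "m ni nc nj nk = (\<Sum>\<kappa>\<in>S. A \<kappa> * L ni nc nj nk \<kappa>)"
    if "down lam ni nc nj nk \<in> dominant_weights" for ni nc nj nk
    unfolding m_def L_def A_def S_def by (rule atomic_number_sum[OF lam that])
  have dom: "down lam 1 2 2 2 \<in> dominant_weights" "down lam 0 2 2 2 \<in> dominant_weights"
    "down lam 1 2 1 2 \<in> dominant_weights" "down lam 1 2 2 1 \<in> dominant_weights"
    "down lam 0 1 1 1 \<in> dominant_weights"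
    "d > 0 \<Longrightarrow> down lam 0 1 1 2 \<in> dominant_weights"
    "b > 0 \<Longrightarrow> down lam 0 1 2 1 \<in> dominant_weights"
    "a > 0 \<Longrightarrow> down lam 1 1 1 1 \<in> dominant_weights"
    "a > 0 \<Longrightarrow> b > 0 \<Longrightarrow> d > 0 \<Longrightarrow> down lam 1 1 2 2 \<in> dominant_weights"
    "b > 0 \<Longrightarrow> d > 0 \<Longrightarrow> down lam 0 1 2 2 \<in> dominant_weights"
    "a > 0 \<Longrightarrow> d > 0 \<Longrightarrow> down lam 1 1 1 2 \<in> dominant_weights"
    "a > 0 \<Longrightarrow> b > 0 \<Longrightarrow> down lam 1 1 2 1 \<in> dominant_weights"
    by (rule down_dominant; simp)+
  \<comment> \<open>All these weights lie above \<mu>, so a \<kappa> above one of them is above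
    \<mu>.\<close>
  have below: "L ni nc nj nk \<kappa> = 0" if "\<not> root_le \<mu> \<kappa>" "ni \<le> 1" "nc \<le> 2" "nj \<le> 2" "nk \<le> 2" for ni nc nj nk \<kappa>
  proof -
    let ?z = "\<lambda>q. (if q = i then 1 - int ni else if q = c then 2 - int nc else if q = j then 2 - int nj else 2 - int nk)"
    have "down lam ni nc nj nk h - \<mu> h = (\<Sum>q\<in>I. of_int (?z q) * simple_root q h)" for h
      unfolding \<mu> sum_I by (simp add: down_def algebra_simps)
    from root_le_iff[of "down lam ni nc nj nk" \<mu> ?z, OF this]
    have "root_le \<mu> (down lam ni nc nj nk)" unfolding ball_I using that by simp
    then show ?thesis unfolding L_def using that(1) root_le_trans by auto
  qed
  have single: "(\<Sum>\<kappa>\<in>S. A \<kappa> * of_bool (\<kappa> = \<mu>)) = A \<mu>"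
    using S(1) by (cases "\<mu> \<in> S") (auto simp: S_def of_bool_def if_distrib sum.delta cong: if_cong)
  have rel: "m 1 2 2 2 + m 0 2 1 2 + m 0 2 2 1 + m 1 2 1 1 = m 0 2 2 2 + m 1 2 1 2 + m 1 2 2 1 + 1 + (if a = 0 then 0 else 1)"
    "m 1 1 2 2 + m 0 1 1 2 + m 0 1 2 1 + m 1 1 1 1 = m 0 1 2 2 + m 1 1 1 2 + m 1 1 2 1 + 3"
    using arg_cong[OF dim_W_relations(1), of int] arg_cong[OF dim_W_relations(2), of int]
    unfolding m by simp_all
  have refl: "m 0 2 1 2 = m 0 1 1 2" "m 0 2 2 1 = m 0 1 2 1" "m 1 2 1 1 = m 1 1 1 1" "m 0 1 1 1 = 3"
    "a = 0 \<Longrightarrow> m 1 1 1 1 = 3" "b = 0 \<Longrightarrow> m 0 1 2 1 = 3" "d = 0 \<Longrightarrow> m 0 1 1 2 = 3"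
    using dim_W_reflections dim_W_0111 unfolding m by simp_all
  have "A \<mu> = (if a = 0 then -2 else -1)"
  proof (cases "a > 0 \<and> b > 0 \<and> d > 0")
    case True
    \<comment> \<open>Sets of atoms with two leaves cancel:
      \<open>gi + gj + gk \<le> 2 * gc + 1\<close> forces \<open>gc > 0\<close> above two leaves, so
      such a set has the same upper bounds with and without the hub atom, at opposite signs.\<close>
    have moebius: "L 1 2 2 2 \<kappa> - L 0 2 2 2 \<kappa> - L 1 2 1 2 \<kappa> - L 1 2 2 1 \<kappa> - L 1 1 2 2 \<kappa>
        + L 0 1 2 2 \<kappa> + L 1 1 1 2 \<kappa> + L 1 1 2 1 \<kappa> = of_bool (\<kappa> = \<mu>)" if \<kappa>: "\<kappa> \<in> S" for \<kappa>
    proof (cases "root_le \<mu> \<kappa>")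
      case False
      then have "\<kappa> \<noteq> \<mu>" using root_le_refl by blast
      then show ?thesis using below[OF False] by simp
    next
      case True
      obtain gi gc gj gk :: nat where g:
        "\<And>ni nc nj nk. root_le (down lam ni nc nj nk) \<kappa> \<longleftrightarrow> 1 \<le> gi + ni \<and> 2 \<le> gc + nc \<and> 2 \<le> gj + nj \<and> 2 \<le> gk + nk"
        "\<kappa> = \<mu> \<longleftrightarrow> gi = 0 \<and> gc = 0 \<and> gj = 0 \<and> gk = 0"
        "gc \<le> a + 2 * gi" "gi + gj + gk \<le> 2 * gc + 1" "gc \<le> b + 2 * gj" "gc \<le> d + 2 * gk"
        using above_coordinates[OF \<mu> lamd l _ True] \<kappa> S(2) by blast
      show ?thesis
        unfolding L_def g(1,2) using g(4)
        by (cases "gi = 0"; cases "gj = 0"; cases "gk = 0"; cases "gc = 0"; simp)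
    qed
    have "A \<mu> = (\<Sum>\<kappa>\<in>S. A \<kappa> * (L 1 2 2 2 \<kappa> - L 0 2 2 2 \<kappa> - L 1 2 1 2 \<kappa> - L 1 2 2 1 \<kappa> - L 1 1 2 2 \<kappa>
        + L 0 1 2 2 \<kappa> + L 1 1 1 2 \<kappa> + L 1 1 2 1 \<kappa>))"
      unfolding single[symmetric] using moebius by (intro sum.cong) auto
    also have "\<dots> = m 1 2 2 2 - m 0 2 2 2 - m 1 2 1 2 - m 1 2 2 1 - m 1 1 2 2 + m 0 1 2 2 + m 1 1 1 2 + m 1 1 2 1"
      using True dom by (simp add: mL distrib_left right_diff_distrib sum.distrib sum_subtractf)
    \<comment> \<open>Subtracting the two relations, the hub reflections cancel the added terms on
      the left, and \<open>1 - 3\<close> plus the kernel dimension remains.\<close>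
    finally show ?thesis using rel refl True by simp
  next
    case False
    \<comment> \<open>Two leaf atoms force a hub root above them, and this forces a root at the
      third leaf too if \<mu> has label 0 there; the coordinate of the third leaf in the join is
      then one smaller.\<close>
    define x where "x = (if d = 0 then 1 else 2 :: nat)"
    define y where "y = (if b = 0 then 1 else 2 :: nat)"
    define z where "z = (if a = 0 then 0 else 1 :: nat)"
    have xyz: "down lam 0 1 1 x \<in> dominant_weights" "down lam 0 1 y 1 \<in> dominant_weights" "down lam z 1 1 1 \<in> dominant_weights"
      unfolding x_def y_def z_def using dom by auto
    have moebius: "L 1 2 2 2 \<kappa> - L 0 2 2 2 \<kappa> - L 1 2 1 2 \<kappa> - L 1 2 2 1 \<kappa>
        + L 0 1 1 x \<kappa> + L 0 1 y 1 \<kappa> + L z 1 1 1 \<kappa> - L 0 1 1 1 \<kappa> = of_bool (\<kappa> = \<mu>)" if \<kappa>: "\<kappa> \<in> S" for \<kappa>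
    proof (cases "root_le \<mu> \<kappa>")
      case False
      then have "\<kappa> \<noteq> \<mu>" using root_le_refl by blast
      then show ?thesis using below[OF False] by (simp add: x_def y_def z_def)
    next
      case True
      obtain gi gc gj gk :: nat where g:
        "\<And>ni nc nj nk. root_le (down lam ni nc nj nk) \<kappa> \<longleftrightarrow> 1 \<le> gi + ni \<and> 2 \<le> gc + nc \<and> 2 \<le> gj + nj \<and> 2 \<le> gk + nk"
        "\<kappa> = \<mu> \<longleftrightarrow> gi = 0 \<and> gc = 0 \<and> gj = 0 \<and> gk = 0"
        "gc \<le> a + 2 * gi" "gi + gj + gk \<le> 2 * gc + 1" "gc \<le> b + 2 * gj" "gc \<le> d + 2 * gk"
        using above_coordinates[OF \<mu> lamd l _ True] \<kappa> S(2) by blast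
      have "L 0 1 1 x \<kappa> = of_bool (gi > 0 \<and> gj > 0)" "L 0 1 y 1 \<kappa> = of_bool (gi > 0 \<and> gk > 0)"
        "L z 1 1 1 \<kappa> = of_bool (gj > 0 \<and> gk > 0)"
        unfolding L_def g(1) x_def y_def z_def of_bool_eq_iff using g(3-6) by auto
      moreover have "L 0 1 1 1 \<kappa> = of_bool (gi > 0 \<and> gj > 0 \<and> gk > 0)"
        unfolding L_def g(1) of_bool_eq_iff using g(4) by auto
      \<comment> \<open>Some leaf label of \<mu> is zero here, so without leaf roots there can be no
        hub root either.\<close>
      moreover have "\<kappa> = \<mu> \<longleftrightarrow> gi = 0 \<and> gj = 0 \<and> gk = 0"
        unfolding g(2) using g(3-6) False by auto
      moreover have "L 1 2 2 2 \<kappa> = 1" "L 0 2 2 2 \<kappa> = of_bool (gi > 0)" "L 1 2 1 2 \<kappa> = of_bool (gj > 0)"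
        "L 1 2 2 1 \<kappa> = of_bool (gk > 0)"
        unfolding L_def g(1) by auto
      ultimately show ?thesis by (cases "gi = 0"; cases "gj = 0"; cases "gk = 0") simp_all
    qed
    have "A \<mu> = (\<Sum>\<kappa>\<in>S. A \<kappa> * (L 1 2 2 2 \<kappa> - L 0 2 2 2 \<kappa> - L 1 2 1 2 \<kappa> - L 1 2 2 1 \<kappa>
        + L 0 1 1 x \<kappa> + L 0 1 y 1 \<kappa> + L z 1 1 1 \<kappa> - L 0 1 1 1 \<kappa>))"
      unfolding single[symmetric] using moebius by (intro sum.cong) auto
    also have "\<dots> = m 1 2 2 2 - m 0 2 2 2 - m 1 2 1 2 - m 1 2 2 1 + m 0 1 1 x + m 0 1 y 1 + m z 1 1 1 - m 0 1 1 1"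
      using dom xyz by (simp add: mL distrib_left right_diff_distrib sum.distrib sum_subtractf)
    finally have "A \<mu> = m 1 2 2 2 - m 0 2 2 2 - m 1 2 1 2 - m 1 2 2 1 + m 0 1 1 x + m 0 1 y 1 + m z 1 1 1 - m 0 1 1 1" .
    \<comment> \<open>Where the coordinate was decreased, a leaf label vanishes, and reflection
      gives both multiplicities the value 3.\<close>
    moreover have "m 0 1 1 x = m 0 1 1 2" "m 0 1 y 1 = m 0 1 2 1" "m z 1 1 1 = m 1 1 1 1"
      using refl by (simp_all add: x_def y_def z_def)
    ultimately have "A \<mu> = (if a = 0 then 0 else 1) - 2" using rel(1) refl(1-4) by linarith
    then show ?thesis by simp
  qed
  then show ?thesis unfolding A_def .
qed

end

section \<open>Specialization to the standard labelling of D4\<close>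

theorem proposition6p8:
  fixes scale :: "complex \<Rightarrow> 'g::ab_group_add \<Rightarrow> 'g"
    and bracket :: "'g \<Rightarrow> 'g \<Rightarrow> 'g"
    and H :: "'g set"
    and \<alpha> :: "nat \<Rightarrow> 'g \<Rightarrow> complex"
    and coroot :: "nat \<Rightarrow> 'g"
    and scaleV :: "complex \<Rightarrow> 'v::ab_group_add \<Rightarrow> 'v"
    and V :: "('g \<Rightarrow> complex) \<Rightarrow> 'v set"
    and act :: "('g \<Rightarrow> complex) \<Rightarrow> 'g \<Rightarrow> 'v \<Rightarrow> 'v"
    and i j k :: nat
    and \<mu> lam \<beta> :: "'g \<Rightarrow> complex"
  assumes "irreducible_highest_weight_modules scale bracket H {1, 2, 3, 4} \<alpha> coroot scaleV V act"
    and "\<forall>p\<in>{1, 2, 3, 4}. \<forall>q\<in>{1, 2, 3, 4}. \<alpha> q (coroot p) = D4_cartan p q"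
    and "{i, j, k} = {1, 3, 4}"
    and "\<beta> = (\<lambda>h. \<alpha> i h + 2 * \<alpha> 2 h + 2 * \<alpha> j h + 2 * \<alpha> k h)"
    and "\<mu> \<in> based_semisimple_lie_algebra.dominant_weights scale H {1, 2, 3, 4} coroot"
    and "based_semisimple_lie_algebra.dynkin_label coroot \<mu> 2 = 1"
    and "lam = (\<lambda>h. \<mu> h + \<beta> h)"
    and "lam \<in> based_semisimple_lie_algebra.dominant_weights scale H {1, 2, 3, 4} coroot"
  shows "irreducible_highest_weight_modules.atomic_number scale H {1, 2, 3, 4} coroot scaleV V act \<mu> lam
         = (if based_semisimple_lie_algebra.dynkin_label coroot \<mu> i = 0 then -2 else -1)"
proof -
  interpret irreducible_highest_weight_modules scale bracket H "{1, 2, 3, 4}" \<alpha> coroot scaleV V act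
    by (rule assms(1))
  define C :: "nat \<Rightarrow> nat \<Rightarrow> int" where
    "C p q = (if p = q then 2 else if p = 2 \<or> q = 2 then -1 else 0)" for p q
  \<comment> \<open>Half the sum of the positive coroots of D4.\<close>
  define \<rho> where "\<rho> = scale 3 (coroot 1) + (scale 5 (coroot 2) + (scale 3 (coroot 3) + scale 3 (coroot 4)))"
  have H: "coroot p \<in> H" if "p \<in> {1, 2, 3, 4}" for p by (rule simple_coroot_in_H[OF that])
  have cartan: "\<alpha> q (coroot p) = of_int (C p q)" if "p \<in> {1, 2, 3, 4}" "q \<in> {1, 2, 3, 4}" for p q
    using assms(2) that unfolding D4_cartan_def C_def by auto
  have sc: "scale x (coroot p) \<in> H" if "p \<in> {1, 2, 3, 4}" for x p
    using subspace_scale[OF subspace_H H[OF that]] .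
  have add: "x + y \<in> H" if "x \<in> H" "y \<in> H" for x y using subspace_add[OF subspace_H that] .
  have \<rho>H: "\<rho> \<in> H" unfolding \<rho>_def by (intro add sc) auto
  have \<rho>1: "\<alpha> p \<rho> = 1" if p: "p \<in> {1, 2, 3, 4}" for p
  proof -
    note D = dual_spaceD[OF simple_root_dual[OF p]]
    have "\<alpha> p \<rho> = 3 * \<alpha> p (coroot 1) + (5 * \<alpha> p (coroot 2) + (3 * \<alpha> p (coroot 3) + 3 * \<alpha> p (coroot 4)))"
      unfolding \<rho>_def using H by (simp add: D(1,2) sc add)
    then show ?thesis using p by (auto simp: cartan C_def)
  qed
  have pos: "\<exists>p\<in>{1, 2, 3, 4}. 0 < n p \<and> 0 < (\<Sum>q\<in>{1, 2, 3, 4}. C p q * int (n q))"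
    if "\<exists>p\<in>{1, 2, 3, 4}. n p > 0" for n
  proof (rule ccontr)
    assume neg: "\<not> ?thesis"
    have leaves: "2 * n 1 \<le> n 2" "2 * n 3 \<le> n 2" "2 * n 4 \<le> n 2"
      using neg by (auto simp: C_def)
    have hub: "n 2 = 0 \<or> 2 * n 2 \<le> n 1 + n 3 + n 4"
      using neg by (auto simp: C_def)
    \<comment> \<open>The leaf bounds give \<open>2 * (x + y + z) \<le> 3 * w\<close>, the hub bound
      gives \<open>4 * w \<le> 2 * (x + y + z)\<close>.\<close>
    have "w = 0" if "2 * x \<le> w" "2 * y \<le> w" "2 * z \<le> w" "2 * w \<le> x + y + z" for x y z w :: nat
      using that by linarith
    from this[OF leaves] hub have "n 2 = 0" by blast
    then have "n 1 = 0 \<and> n 2 = 0 \<and> n 3 = 0 \<and> n 4 = 0" using leaves by simp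
    then show False using that by auto
  qed
  have ijk: "{1, 2, 3, 4} = {2, i, j, k}" "distinct [2, i, j, k]"
  proof -
    show "{1, 2, 3, 4} = {2, i, j, k}" using assms(3) by auto
    have "card {i, j, k} = 3" unfolding assms(3) by simp
    then have "i \<noteq> j" "i \<noteq> k" "j \<noteq> k" by (auto simp: card_insert_if split: if_splits)
    moreover have "2 \<notin> {i, j, k}" unfolding assms(3) by simp
    ultimately show "distinct [2, i, j, k]" by auto
  qed
  interpret D4: D4_modules scale bracket H "{1, 2, 3, 4}" \<alpha> coroot C \<rho> scaleV V act 2 i j k
  proof (unfold_locales, goal_cases)
    case (1 p q)
    then show ?case by (rule cartan)
  next
    case (2 n)
    then show ?case by (rule pos)
  next
    case 3
    show ?case by (rule \<rho>H)
  next
    case (4 p)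
    then show ?case by (rule \<rho>1)
  next
    case 5
    show ?case by (rule ijk(1))
  next
    case 6
    show ?case by (rule ijk(2))
  next
    case (7 p q)
    show ?case by (simp only: C_def)
  qed
  have label: "\<exists>n. \<mu> (coroot p) = of_nat n" if "p \<in> {1, 2, 3, 4}" for p
    using assms(5) that unfolding dominant_weights_def dynkin_label_def Nats_def by auto
  obtain a b d :: nat where l: "\<mu> (coroot i) = of_nat a" "\<mu> (coroot j) = of_nat b" "\<mu> (coroot k) = of_nat d"
    using label[OF D4.nodes(2)] label[OF D4.nodes(3)] label[OF D4.nodes(4)] by blast
  have "\<mu> = D4.down lam 1 2 2 2"
    unfolding assms(4,7) D4.down_def by (rule ext) simp
  from D4.atomic_number_D4[OF assms(8) this l(1) _ l(2,3)] show ?thesis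
    using assms(6) l(1) unfolding dynkin_label_def by simp
qed

end
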